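(* Let $n,d\ge 1$, let $\mathcal{G}=\{G_1,\dots,G_m\}\subseteq\mathcal{S}_n(\mathbb{R}[X])$ be a finite set, and let $G\subseteq\mathbb{R}[X]$ be a finite set such that $\mathbf{K}_{\mathcal{G}}=K_G$, $(M_G)^n\subseteq\mathcal{M}_{\mathcal{G}}$ and $(T_G)^n\subseteq\mathcal{T}_{\mathcal{G}}$. Let $\mathbf{D}=D(d_1,\dots,d_r)$, $r\le n$, be an $n\times n$ diagonal polynomial matrix in $\mathcal{S}_n(\mathbb{R}[X])$. Assume: (1) $\mathbf{K}_{\mathcal{G}}$ is compact (resp. $M_G$ is Archimedean); (2) $\mathbf{D}\succcurlyeq\mathbf{0}$ on $\mathbf{K}_{\mathcal{G}}$; (3) each $d_i$ ($1\le i\le r$) has only finitely many zeros in $\mathbf{K}_{\mathcal{G}}$, and all of them lie in the interior of $\mathbf{K}_{\mathcal{G}}$; (4) at each zero $p$ of each $d_i$ in $\mathbf{K}_{\mathcal{G}}$, the Hessian $D^2d_i(p)$ is positive definite. Then $\mathbf{D}\in(T_G)^n\subseteq\mathcal{T}_{\mathcal{G}}$ (resp. $\mathbf{D}\in(M_G)^n\subseteq\mathcal{M}_{\mathcal{G}}$).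
   Context: $\mathbb{R}[X]=\mathbb{R}[x_1,\dots,x_d]$. For a commutative unital ring $R$, $\mathcal{M}_n(R)$ is the ring of $n\times n$ matrices over $R$, $\mathcal{S}_n(R)$ its subset of symmetric matrices, $\mathbf{I}_n$ the identity matrix. A quadratic module in $\mathcal{M}_n(R)$ is a set $\mathcal{M}\subseteq\mathcal{S}_n(R)$ with $\mathbf{I}_n\in\mathcal{M}$, $\mathcal{M}+\mathcal{M}\subseteq\mathcal{M}$, and $A^T\mathcal{M}A\subseteq\mathcal{M}$ for all $A\in\mathcal{M}_n(R)$. A preordering in $\mathcal{M}_n(R)$ is a quadratic module $\mathcal{T}$ such that $\mathcal{T}\cap(R\cdot\mathbf{I}_n)$ is closed under multiplication. $\mathcal{M}_{\mathcal{G}}$ and $\mathcal{T}_{\mathcal{G}}$ denote the smallest quadratic module and the smallest preordering in $\mathcal{M}_n(\mathbb{R}[X])$ containing $\mathcal{G}$. For $G\subseteq\mathbb{R}[X]$, $M_G$ and $T_G$ denote the smallest quadratic module and the smallest preordering of $\mathbb{R}[X]$ containing $G$ (that is, quadratic modules and preorderings in $\mathcal{M}_1(\mathbb{R}[X])=\mathbb{R}[X]$; explicitly, a quadratic module of $\mathbb{R}[X]$ contains $1$ and is closed under addition and multiplication by squares, a preordering is closed under addition and multiplication and contains all squares). $M_G$ is Archimedean if for each $a\in\mathbb{R}[X]$ there is $k\in\mathbb{N}$ with $k-a^2\in M_G$. For a quadratic module $M\subseteq\mathbb{R}[X]$, $M^n$ denotes the set of all finite sums $\sum_i m_iA_i^TA_i$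 with $m_i\in M$, $A_i\in\mathcal{M}_n(\mathbb{R}[X])$. $\mathbf{K}_{\mathcal{G}}=\{x\in\mathbb{R}^d : \mathbf{G}(x)\succcurlyeq\mathbf{0}\ \forall\,\mathbf{G}\in\mathcal{G}\}$ and $K_G=\{x\in\mathbb{R}^d: g(x)\ge 0\ \forall g\in G\}$. $D(d_1,\dots,d_r)$ is the $n\times n$ diagonal matrix with diagonal entries $d_1,\dots,d_r,0,\dots,0$. "$\succcurlyeq\mathbf 0$ on a set" means positive semidefinite at each point of the set. $D^2f(p)$ is the Hessian matrix of $f$ at $p$. The statement has two versions: the one without the parenthetical "(resp. ...)" parts and the one with them. *)

theory Defs
  imports "HOL-Analysis.Analysis" "HOL-Library.Poly_Mapping"
begin

section \<open>Real polynomials in the variables indexed by \<open>'d\<close>\<close>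

text \<open>A monomial is its exponent vector \<open>'d \<Rightarrow>\<^sub>0 nat\<close>, and a polynomial is the finitely supported
  family of its coefficients; the ring operations are those of \<^theory>\<open>HOL-Library.Poly_Mapping\<close>.\<close>

type_synonym 'd rpoly = "('d \<Rightarrow>\<^sub>0 nat) \<Rightarrow>\<^sub>0 real"

definition peval :: "('d::finite) rpoly \<Rightarrow> real ^ 'd \<Rightarrow> real" where
  "peval p x = (\<Sum>m\<in>Poly_Mapping.keys p. Poly_Mapping.lookup p m * (\<Prod>i\<in>UNIV. x $ i ^ Poly_Mapping.lookup m i))"

lemma peval_superset:
  assumes "finite S" "Poly_Mapping.keys p \<subseteq> S"
  shows "peval p x = (\<Sum>m\<in>S. Poly_Mapping.lookup p m * (\<Prod>i\<in>UNIV. x $ i ^ Poly_Mapping.lookup m i))"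
  unfolding peval_def
  by (rule sum.mono_neutral_left) (use assms in \<open>auto simp: in_keys_iff\<close>)

lemma peval_add [simp]: "peval (p + q) x = peval p x + peval q x"
proof -
  let ?S = "Poly_Mapping.keys p \<union> Poly_Mapping.keys q"
  have "Poly_Mapping.keys (p + q) \<subseteq> ?S" by (rule keys_add)
  then show ?thesis
    by (simp add: peval_superset[of ?S] lookup_add distrib_right sum.distrib)
qed

lemma peval_zero [simp]: "peval 0 x = 0"
  by (simp add: peval_def)

lemma peval_sum [simp]: "peval (sum f A) x = (\<Sum>a\<in>A. peval (f a) x)"
  by (induction A rule: infinite_finite_induct) auto

lemma peval_single [simp]:
  "peval (Poly_Mapping.single m c) x = c * (\<Prod>i\<in>UNIV. x $ i ^ Poly_Mapping.lookup m i)"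
  by (simp add: peval_def)

lemma peval_one [simp]: "peval 1 x = 1"
  by (simp flip: single_one)

lemma rpoly_sum_monomials:
  "(p :: 'd rpoly) = (\<Sum>m\<in>Poly_Mapping.keys p. Poly_Mapping.single m (Poly_Mapping.lookup p m))"
  by (rule poly_mapping_eqI) (auto simp: lookup_sum lookup_single when_def in_keys_iff)

lemma peval_mult [simp]: "peval (p * q) x = peval p x * peval q x"
proof -
  let ?mon = "\<lambda>m. \<Prod>i\<in>UNIV. x $ i ^ Poly_Mapping.lookup m i"
  have "p * q = (\<Sum>m\<in>Poly_Mapping.keys p. Poly_Mapping.single m (Poly_Mapping.lookup p m)) *
                (\<Sum>k\<in>Poly_Mapping.keys q. Poly_Mapping.single k (Poly_Mapping.lookup q k))"
    by (rule arg_cong2[of _ _ _ _ "(*)"]) (rule rpoly_sum_monomials)+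
  also have "\<dots> = (\<Sum>m\<in>Poly_Mapping.keys p. \<Sum>k\<in>Poly_Mapping.keys q.
                     Poly_Mapping.single (m + k) (Poly_Mapping.lookup p m * Poly_Mapping.lookup q k))"
    by (simp add: sum_product mult_single)
  finally have "peval (p * q) x =
      (\<Sum>m\<in>Poly_Mapping.keys p. \<Sum>k\<in>Poly_Mapping.keys q. (Poly_Mapping.lookup p m * Poly_Mapping.lookup q k) * ?mon (m + k))"
    by simp
  also have "\<dots> = (\<Sum>m\<in>Poly_Mapping.keys p. \<Sum>k\<in>Poly_Mapping.keys q. (Poly_Mapping.lookup p m * ?mon m) * (Poly_Mapping.lookup q k * ?mon k))"
    by (intro sum.cong refl)
       (simp add: lookup_add power_add prod.distrib mult_ac)
  also have "\<dots> = peval p x * peval q x"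
    by (simp add: peval_def sum_product)
  finally show ?thesis .
qed

abbreviation meval :: "('d::finite) rpoly ^ 'n ^ 'n \<Rightarrow> real ^ 'd \<Rightarrow> real ^ 'n ^ 'n" where
  "meval A x \<equiv> map_matrix (\<lambda>p. peval p x) A"

section \<open>Positivity and the Hessian\<close>

definition symmetric_matrix :: "'a ^ 'n ^ 'n \<Rightarrow> bool" where
  "symmetric_matrix A \<longleftrightarrow> transpose A = A"

definition psd :: "real ^ 'n ^ 'n \<Rightarrow> bool" where
  "psd A \<longleftrightarrow> symmetric_matrix A \<and> (\<forall>v. 0 \<le> v \<bullet> (A *v v))"

definition pos_def :: "real ^ 'n ^ 'n \<Rightarrow> bool" where
  "pos_def A \<longleftrightarrow> symmetric_matrix A \<and> (\<forall>v. v \<noteq> 0 \<longrightarrow> 0 < v \<bullet> (A *v v))"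

definition partial :: "'d \<Rightarrow> (real ^ 'd \<Rightarrow> real) \<Rightarrow> real ^ ('d::finite) \<Rightarrow> real" where
  "partial i f p = deriv (\<lambda>t. f (p + t *\<^sub>R axis i 1)) 0"

definition hessian :: "(real ^ 'd \<Rightarrow> real) \<Rightarrow> real ^ ('d::finite) \<Rightarrow> real ^ 'd ^ 'd" where
  "hessian f p = (\<chi> i j. partial i (partial j f) p)"

section \<open>Quadratic modules and preorderings\<close>

definition quadratic_module :: "'a::comm_ring_1 set \<Rightarrow> bool" where
  "quadratic_module M \<longleftrightarrow>
     1 \<in> M \<and> (\<forall>a\<in>M. \<forall>b\<in>M. a + b \<in> M) \<and> (\<forall>c. \<forall>a\<in>M. c\<^sup>2 * a \<in> M)"

definition ring_preordering :: "'a::comm_ring_1 set \<Rightarrow> bool" where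
  "ring_preordering T \<longleftrightarrow>
     (\<forall>a\<in>T. \<forall>b\<in>T. a + b \<in> T) \<and> (\<forall>a\<in>T. \<forall>b\<in>T. a * b \<in> T) \<and> (\<forall>c. c\<^sup>2 \<in> T)"

definition qm_gen :: "'a::comm_ring_1 set \<Rightarrow> 'a set" where
  "qm_gen G = \<Inter>{M. quadratic_module M \<and> G \<subseteq> M}"

definition po_gen :: "'a::comm_ring_1 set \<Rightarrow> 'a set" where
  "po_gen G = \<Inter>{T. ring_preordering T \<and> G \<subseteq> T}"

definition archimedean :: "'a::comm_ring_1 set \<Rightarrow> bool" where
  "archimedean M \<longleftrightarrow> (\<forall>a. \<exists>k::nat. of_nat k - a\<^sup>2 \<in> M)"

definition mat_quadratic_module :: "('a::comm_ring_1 ^ 'n ^ 'n) set \<Rightarrow> bool" where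
  "mat_quadratic_module M \<longleftrightarrow>
     M \<subseteq> {A. symmetric_matrix A} \<and> mat 1 \<in> M \<and> (\<forall>A\<in>M. \<forall>B\<in>M. A + B \<in> M) \<and>
     (\<forall>A. \<forall>B\<in>M. transpose A ** B ** A \<in> M)"

text \<open>\<open>range mat\<close> is the set of scalar matrices, since \<open>mat c\<close> is \<open>c\<close> times the identity matrix.\<close>

definition mat_preordering :: "('a::comm_ring_1 ^ 'n ^ 'n) set \<Rightarrow> bool" where
  "mat_preordering T \<longleftrightarrow>
     mat_quadratic_module T \<and>
     (\<forall>A\<in>T \<inter> range mat. \<forall>B\<in>T \<inter> range mat. A ** B \<in> T \<inter> range mat)"

text \<open>For a family \<open>\<G>\<close> of symmetric matrices the following two intersections are over nonempty
  collections, and are the smallest quadratic module and the smallest preordering containing \<open>\<G>\<close>.\<close>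

definition mat_qm_gen :: "('a::comm_ring_1 ^ 'n ^ 'n) set \<Rightarrow> ('a ^ 'n ^ 'n) set" where
  "mat_qm_gen \<G> = \<Inter>{M. mat_quadratic_module M \<and> \<G> \<subseteq> M}"

definition mat_po_gen :: "('a::comm_ring_1 ^ 'n ^ 'n) set \<Rightarrow> ('a ^ 'n ^ 'n) set" where
  "mat_po_gen \<G> = \<Inter>{T. mat_preordering T \<and> \<G> \<subseteq> T}"

text \<open>The set \<open>M\<^sup>n\<close> of finite sums of the matrices \<open>m A\<^sup>T A\<close> with \<open>m \<in> M\<close> and \<open>A\<close> square; the
  scaling by \<open>m\<close> is multiplication by the scalar matrix \<open>mat m\<close>.\<close>

definition mat_power :: "'a::comm_ring_1 set \<Rightarrow> ('a ^ 'n ^ 'n) set" where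
  "mat_power M =
     {\<Sum>i<k. mat (m i) ** (transpose (A i) ** A i) |
        (k::nat) m (A :: nat \<Rightarrow> 'a ^ 'n ^ 'n). \<forall>i<k. m i \<in> M}"

definition nonneg_set :: "('d::finite) rpoly set \<Rightarrow> (real ^ 'd) set" where
  "nonneg_set G = {x. \<forall>g\<in>G. 0 \<le> peval g x}"

definition psd_set :: "(('d::finite) rpoly ^ 'n ^ 'n) set \<Rightarrow> (real ^ 'd) set" where
  "psd_set \<G> = {x. \<forall>A\<in>\<G>. psd (meval A x)}"

text \<open>\<open>D(d\<^sub>1, \<dots>, d\<^sub>r)\<close>: the index \<open>i\<close> has the position \<open>card {k. k < i}\<close> (counted from \<open>0\<close>) in the
  linear order of the index type.\<close>

definition diag_list :: "'a::zero list \<Rightarrow> 'a ^ ('n::{finite,linorder}) ^ ('n::{finite,linorder})" where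
  "diag_list ds = (\<chi> i j. if i = j \<and> card {k. k < i} < length ds then ds ! card {k. k < i} else 0)"

lemma quadratic_module_qm_gen: "quadratic_module (qm_gen G)"
  unfolding qm_gen_def quadratic_module_def by blast

lemma ring_preordering_po_gen: "ring_preordering (po_gen G)"
  unfolding po_gen_def ring_preordering_def by blast

lemma mat_quadratic_module_symmetric:
  "mat_quadratic_module {A :: 'a::comm_ring_1 ^ 'n ^ 'n. symmetric_matrix A}"
proof -
  have "transpose (A + B) = transpose A + transpose B" for A B :: "'a ^ 'n ^ 'n"
    by (simp add: transpose_def vec_eq_iff)
  moreover have "transpose (transpose A ** B ** A) = transpose A ** B ** A"
    if "transpose B = B" for A B :: "'a ^ 'n ^ 'n"
    by (simp only: matrix_transpose_mul transpose_transpose that matrix_mul_assoc)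
  ultimately show ?thesis
    by (simp add: mat_quadratic_module_def symmetric_matrix_def)
qed

lemma mat_mult_mat: "mat a ** mat b = (mat (a * b) :: 'a::comm_ring_1 ^ 'n ^ 'n)"
proof -
  have "(\<Sum>k\<in>UNIV. (if i = k then a else 0) * (if k = j then b else 0)) =
        (if i = j then a * b else 0)" for i j :: 'n
  proof -
    have "(\<Sum>k\<in>UNIV. (if i = k then a else 0) * (if k = j then b else 0)) =
          (\<Sum>k\<in>UNIV. if i = k then a * (if k = j then b else 0) else 0)"
      by (rule sum.cong) auto
    then show ?thesis by simp
  qed
  then show ?thesis
    by (simp add: matrix_matrix_mult_def mat_def vec_eq_iff)
qed

lemma mat_preordering_symmetric:
  "mat_preordering {A :: 'a::comm_ring_1 ^ 'n ^ 'n. symmetric_matrix A}"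
proof -
  have "symmetric_matrix (mat c)" for c :: 'a
    by (simp add: symmetric_matrix_def)
  then show ?thesis
    unfolding mat_preordering_def using mat_quadratic_module_symmetric
    by (fastforce simp only: mat_mult_mat mem_Collect_eq)
qed

lemma mat_quadratic_module_Inter:
  assumes "F \<noteq> {}" "\<And>M. M \<in> F \<Longrightarrow> mat_quadratic_module M"
  shows "mat_quadratic_module (\<Inter>F)"
proof -
  obtain M where "M \<in> F" using assms(1) by blast
  then have "\<Inter>F \<subseteq> {A. symmetric_matrix A}"
    using assms(2)[of M] by (auto simp: mat_quadratic_module_def)
  moreover have "mat 1 \<in> M \<and> (\<forall>A\<in>M. \<forall>B\<in>M. A + B \<in> M) \<and>
      (\<forall>A. \<forall>B\<in>M. transpose A ** B ** A \<in> M)" if "M \<in> F" for M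
    using assms(2)[OF that] by (simp add: mat_quadratic_module_def)
  ultimately show ?thesis
    unfolding mat_quadratic_module_def by (meson Inter_iff)
qed

lemma mat_preordering_Inter:
  assumes "F \<noteq> {}" "\<And>T. T \<in> F \<Longrightarrow> mat_preordering T"
  shows "mat_preordering (\<Inter>F)"
proof -
  have "mat_quadratic_module (\<Inter>F)"
    using assms by (intro mat_quadratic_module_Inter) (auto simp: mat_preordering_def)
  moreover have "A ** B \<in> \<Inter>F \<inter> range mat" if "A \<in> \<Inter>F \<inter> range mat" "B \<in> \<Inter>F \<inter> range mat" for A B
  proof -
    have "A ** B \<in> T \<inter> range mat" if "T \<in> F" for T
      using assms(2)[OF that] that \<open>A \<in> _\<close> \<open>B \<in> _\<close> unfolding mat_preordering_def by blast
    then show ?thesis using assms(1) by blast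
  qed
  ultimately show ?thesis unfolding mat_preordering_def by blast
qed

lemma mat_quadratic_module_mat_qm_gen:
  assumes "\<forall>A\<in>\<G>. symmetric_matrix A"
  shows "mat_quadratic_module (mat_qm_gen \<G>)"
proof -
  have "{M. mat_quadratic_module M \<and> \<G> \<subseteq> M} \<noteq> {}"
    using mat_quadratic_module_symmetric assms by blast
  then show ?thesis
    unfolding mat_qm_gen_def by (rule mat_quadratic_module_Inter) auto
qed

lemma mat_preordering_mat_po_gen:
  assumes "\<forall>A\<in>\<G>. symmetric_matrix A"
  shows "mat_preordering (mat_po_gen \<G>)"
proof -
  have "{T. mat_preordering T \<and> \<G> \<subseteq> T} \<noteq> {}"
    using mat_preordering_symmetric assms by blast
  then show ?thesis
    unfolding mat_po_gen_def by (rule mat_preordering_Inter) auto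
qed

end

theory Submission
  imports "HOL-Algebra.Algebraic_Closure_Type" Defs
begin

text \<open>A diagonal entry \<open>f\<close> is shown to lie in every Archimedean quadratic module \<open>M\<close> with nonnegativity
  set \<open>K\<close>. Linear interpolation at the zeros gives polynomials \<open>q\<^sub>a\<close> that vanish simultaneously
  exactly at the zeros of \<open>f\<close>, and \<open>f = \<Sum> A\<^sub>a\<^sub>b q\<^sub>a q\<^sub>b\<close> for a symmetric polynomial matrix \<open>A\<close>. By the
  positive definite Hessians, \<open>A\<close> becomes positive definite on \<open>K\<close> after adding a large multiple of
  matrices that are annihilated by \<open>q\<close>. A polynomial approximation of a continuous Cholesky factor
  then writes \<open>f\<close> as a sum of squares times polynomials that are positive on \<open>K\<close>, and these are in
  \<open>M\<close> by Putinar's theorem.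

  That \<open>T\<^sub>G\<close> is Archimedean for compact \<open>K\<^sub>G\<close> follows from the weak Positivstellensatz by
  Woermann's argument. For the Positivstellensatz, a maximal preordering of the polynomial ring is
  realized in a real closed field, which is a maximal partially ordered subring of an algebraic
  closure, and sign conditions are transferred from there to the reals by eliminating one variable
  at a time.\<close>

hide_const (open) module.smult

section \<open>Polynomials as an algebra generated by constants and variables\<close>

text \<open>At a zero in \<open>K\<close> strict positivity fails, so Putinar's theorem cannot be
  applied to \<open>f\<close> itself. It is applied to polynomials that stay positive on
  \<open>K\<close>, and these are multiplied afterwards by squares built from the
  \<open>q a\<close>. The matrix in \<open>f = \<Sum> A a b * q a * q b\<close> is not unique, and
  the identity controls it only partially: off the zeros only in the direction \<open>q x\<close>,
  at a zero \<open>p\<close> only on the image of the derivative of \<open>q\<close>, which is a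
  hyperplane because there is one more \<open>q a\<close> than there are variables. The two matrices
  added as a penalty are \<open>s s^T\<close>, where \<open>s\<close> is a linear relation between
  the \<open>q a\<close> whose values at \<open>p\<close> cut out that hyperplane, and
  \<open>|q|^2 I - q q^T\<close>, which sees every direction not parallel to \<open>q x\<close>. A
  generic linear form parametrizes the zeros, so that vanishing at all of them becomes divisibility
  by a single univariate polynomial.\<close>

definition Const :: "real \<Rightarrow> 'd rpoly" where
  "Const c = Poly_Mapping.single 0 c"

definition Var :: "'d \<Rightarrow> 'd rpoly" where
  "Var i = Poly_Mapping.single (Poly_Mapping.single i 1) 1"

lemma Const_add: "Const (a + b) = Const a + Const b"
  by (simp add: Const_def single_add)

lemma Const_mult: "Const (a * b) = Const a * Const b"
  by (simp add: Const_def mult_single)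

lemma Const_0 [simp]: "Const 0 = 0"
  by (simp add: Const_def)

lemma Const_1 [simp]: "Const 1 = 1"
  by (simp add: Const_def)

lemma Const_uminus: "Const (- a) = - Const a"
  by (simp add: Const_def single_uminus)

lemma Const_diff: "Const (a - b) = Const a - Const b"
  by (simp add: Const_def single_diff)

lemma Const_power: "Const (a ^ n) = Const a ^ n"
  by (induction n) (simp_all add: Const_mult)

lemma Const_of_nat: "Const (of_nat n) = of_nat n"
  by (induction n) (simp_all add: Const_add)

lemma Const_numeral: "Const (numeral n) = numeral n"
  using Const_of_nat[of "numeral n"] by simp

lemma Const_half: "Const (1/2) + Const (1/2) = 1"
  by (simp flip: Const_add)

lemma peval_Const [simp]: "peval (Const c) x = c"
  by (simp add: Const_def)

lemma peval_Var [simp]: "peval (Var i) x = x $ i"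
proof -
  have "peval (Var i) x = (\<Prod>j\<in>UNIV. if j = i then x $ j else 1)"
    unfolding Var_def peval_single mult_1 by (intro prod.cong) (auto simp: lookup_single when_def)
  then show ?thesis by simp
qed

lemma peval_uminus [simp]: "peval (- p) x = - peval p x"
  using peval_add[of p "- p" x] by simp

lemma peval_diff [simp]: "peval (p - q) x = peval p x - peval q x"
  using peval_add[of p "- q" x] by simp

lemma peval_power [simp]: "peval (p ^ n) x = peval p x ^ n"
  by (induction n) simp_all

lemma peval_of_nat [simp]: "peval (of_nat n) x = of_nat n"
  by (simp flip: Const_of_nat)

lemma Var_power: "Var i ^ k = Poly_Mapping.single (Poly_Mapping.single i k) 1"
  by (induction k) (simp_all add: Var_def mult_single flip: single_add)

lemma single_eq_Const_times_Vars:
  fixes m :: "'d::finite \<Rightarrow>\<^sub>0 nat"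
  shows "Poly_Mapping.single m c = Const c * (\<Prod>i\<in>UNIV. Var i ^ Poly_Mapping.lookup m i)"
proof -
  have "(\<Prod>i\<in>A. Var i ^ Poly_Mapping.lookup m i) =
      Poly_Mapping.single (\<Sum>i\<in>A. Poly_Mapping.single i (Poly_Mapping.lookup m i)) 1" if "finite A" for A
    using that by induction (simp_all add: Var_power mult_single)
  moreover have "(\<Sum>i\<in>UNIV. Poly_Mapping.single i (Poly_Mapping.lookup m i)) = m"
    by (rule poly_mapping_eqI) (simp add: lookup_sum lookup_single when_def)
  ultimately show ?thesis
    by (simp add: Const_def mult_single)
qed

lemma rpoly_expand:
  "(p :: 'd::finite rpoly) = (\<Sum>m\<in>Poly_Mapping.keys p. Const (Poly_Mapping.lookup p m) *
     (\<Prod>i\<in>UNIV. Var i ^ Poly_Mapping.lookup m i))"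
  by (subst rpoly_sum_monomials) (simp add: single_eq_Const_times_Vars)

text \<open>Generation by constants and variables reduces a claim about all polynomials to sums and
  products; evaluation homomorphisms, boundedness, derivatives and Taylor expansions are handled
  this way.\<close>

lemma rpoly_induct [case_names const var add mult]:
  fixes p :: "'d::finite rpoly"
  assumes c: "\<And>c. P (Const c)" and v: "\<And>i. P (Var i)"
    and add: "\<And>p q. P p \<Longrightarrow> P q \<Longrightarrow> P (p + q)" and mult: "\<And>p q. P p \<Longrightarrow> P q \<Longrightarrow> P (p * q)"
  shows "P p"
proof -
  have P0: "P 0" and P1: "P 1" using c[of 0] c[of 1] by simp_all
  have pow: "P (q ^ n)" if "P q" for q n
    by (induction n) (use that P1 mult in auto)
  have prod: "P (prod f A)" if "\<And>i. P (f i)" for f :: "'d \<Rightarrow> 'd rpoly" and A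
    by (induction A rule: infinite_finite_induct) (use that P1 mult in auto)
  have sum: "P (sum f A)" if "\<And>i. P (f i)" for f :: "('d \<Rightarrow>\<^sub>0 nat) \<Rightarrow> 'd rpoly" and A
    by (induction A rule: infinite_finite_induct) (use that P0 add in auto)
  show ?thesis
    by (subst rpoly_expand) (intro sum mult c prod pow v)
qed

section \<open>Quadratic modules\<close>

inductive_set sos :: "'a::comm_ring_1 set" where
  zero: "0 \<in> sos"
| add: "s \<in> sos \<Longrightarrow> c\<^sup>2 + s \<in> sos"

lemma sos_square: "c\<^sup>2 \<in> sos"
  using sos.add[OF sos.zero, of c] by simp

lemma sos_add: "s \<in> sos \<Longrightarrow> t \<in> sos \<Longrightarrow> s + t \<in> sos"
  by (induction rule: sos.induct) (simp_all add: sos.add add.assoc)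

lemma sos_square_mult: "s \<in> sos \<Longrightarrow> c\<^sup>2 * s \<in> sos"
proof (induction rule: sos.induct)
  case (add s d)
  have "c\<^sup>2 * (d\<^sup>2 + s) = (c * d)\<^sup>2 + c\<^sup>2 * s" by (simp add: algebra_simps power2_eq_square)
  then show ?case using add sos.add by metis
qed (simp add: sos.zero)

lemma quadratic_moduleD:
  assumes "quadratic_module M"
  shows "1 \<in> M" "a \<in> M \<Longrightarrow> b \<in> M \<Longrightarrow> a + b \<in> M" "a \<in> M \<Longrightarrow> c\<^sup>2 * a \<in> M" "0 \<in> M" "c\<^sup>2 \<in> M"
proof -
  show "1 \<in> M" "a \<in> M \<Longrightarrow> b \<in> M \<Longrightarrow> a + b \<in> M" "a \<in> M \<Longrightarrow> c\<^sup>2 * a \<in> M"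
    using assms unfolding quadratic_module_def by blast+
  have "\<And>c. c\<^sup>2 * 1 \<in> M" using assms unfolding quadratic_module_def by blast
  from this[of 0] this[of c] show "0 \<in> M" "c\<^sup>2 \<in> M" by simp_all
qed

lemma qm_sum:
  assumes "quadratic_module M" "\<And>i. i \<in> A \<Longrightarrow> f i \<in> M"
  shows "sum f A \<in> M"
  using assms(2) by (induction A rule: infinite_finite_induct)
    (simp_all add: quadratic_moduleD[OF assms(1)])

lemma qm_sos_mult:
  assumes "quadratic_module M" "a \<in> M" "s \<in> sos"
  shows "s * a \<in> M"
  using assms(3) by induction
    (simp_all add: quadratic_moduleD[OF assms(1)] assms(2) distrib_right)

lemma qm_sos: "quadratic_module M \<Longrightarrow> s \<in> sos \<Longrightarrow> s \<in> M"
  using qm_sos_mult[of M 1 s] by (simp add: quadratic_moduleD)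

text \<open>A quadratic module need not be closed under products, so \<open>a\<close> is multiplied
  by sums of squares only.\<close>

lemma qm_adjoin:
  assumes M: "quadratic_module M"
  shows "quadratic_module {s + a * t | s t. s \<in> M \<and> t \<in> sos}"
    and "M \<subseteq> {s + a * t | s t. s \<in> M \<and> t \<in> sos}" and "a \<in> {s + a * t | s t. s \<in> M \<and> t \<in> sos}"
proof -
  let ?N = "{s + a * t | s t. s \<in> M \<and> t \<in> sos}"
  show sub: "M \<subseteq> ?N"
    using sos.zero by force
  have "a = 0 + a * 1\<^sup>2" by simp
  then show "a \<in> ?N" using quadratic_moduleD(4)[OF M] sos_square by blast
  have "(s + a * t) + (s' + a * t') \<in> ?N" if "s \<in> M" "t \<in> sos" "s' \<in> M" "t' \<in> sos" for s t s' t'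
  proof -
    have "(s + a * t) + (s' + a * t') = (s + s') + a * (t + t')" by (simp add: algebra_simps)
    then show ?thesis using that quadratic_moduleD(2)[OF M] sos_add by blast
  qed
  moreover have "c\<^sup>2 * (s + a * t) \<in> ?N" if "s \<in> M" "t \<in> sos" for s t c
  proof -
    have "c\<^sup>2 * (s + a * t) = c\<^sup>2 * s + a * (c\<^sup>2 * t)" by (simp add: algebra_simps)
    then show ?thesis using that quadratic_moduleD(3)[OF M] sos_square_mult by blast
  qed
  ultimately show "quadratic_module ?N"
    using sub quadratic_moduleD(1)[OF M] unfolding quadratic_module_def by blast
qed

lemma qm_Const:
  assumes "quadratic_module M" "0 \<le> c" shows "Const c \<in> M"
  using quadratic_moduleD(5)[OF assms(1), of "Const (sqrt c)"] assms(2)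
  by (simp flip: Const_power)

lemma qm_Const_mult:
  assumes "quadratic_module M" "0 \<le> c" "a \<in> M" shows "Const c * a \<in> M"
  using quadratic_moduleD(3)[OF assms(1,3), of "Const (sqrt c)"] assms(2)
  by (simp flip: Const_power)

lemma qm_Const_mult_cancel:
  assumes "quadratic_module M" "0 < c" "Const c * a \<in> M" shows "a \<in> M"
proof -
  have "Const (1/c) * (Const c * a) \<in> M"
    using assms by (intro qm_Const_mult[OF assms(1) _ assms(3)]) auto
  moreover have "Const (1/c) * Const c = 1"
    using assms(2) by (simp flip: Const_mult)
  ultimately show ?thesis
    by (metis mult.assoc mult_1)
qed

lemma quadratic_module_Union_chain:
  assumes "C \<noteq> {}" "\<And>M. M \<in> C \<Longrightarrow> quadratic_module M"
    and ch: "\<And>M N. M \<in> C \<Longrightarrow> N \<in> C \<Longrightarrow> M \<subseteq> N \<or> N \<subseteq> M"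
  shows "quadratic_module (\<Union>C)"
  unfolding quadratic_module_def
proof (intro conjI ballI allI)
  show "1 \<in> \<Union>C" using assms(1,2) quadratic_moduleD(1) by blast
  show "a + b \<in> \<Union>C" if ab: "a \<in> \<Union>C" "b \<in> \<Union>C" for a b
  proof -
    obtain M N where "M \<in> C" "N \<in> C" "a \<in> M" "b \<in> N" using ab by blast
    then obtain L where "L \<in> C" "a \<in> L" "b \<in> L" using ch by blast
    then show ?thesis using assms(2) quadratic_moduleD(2) by blast
  qed
  show "c\<^sup>2 * a \<in> \<Union>C" if "a \<in> \<Union>C" for a c
    using that assms(2) quadratic_moduleD(3) by blast
qed

lemma maximal_qm:
  assumes "quadratic_module M" "-1 \<notin> M"
  obtains S where "quadratic_module S" "M \<subseteq> S" "-1 \<notin> S"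
    "\<And>N. quadratic_module N \<Longrightarrow> S \<subseteq> N \<Longrightarrow> -1 \<notin> N \<Longrightarrow> N = S"
proof -
  let ?A = "{N. quadratic_module N \<and> M \<subseteq> N \<and> -1 \<notin> N}"
  have "\<exists>S\<in>?A. \<forall>Z\<in>?A. S \<subseteq> Z \<longrightarrow> Z = S"
  proof (rule subset_Zorn_nonempty)
    show "?A \<noteq> {}" using assms by blast
    fix C assume "C \<noteq> {}" "subset.chain ?A C"
    then have C: "C \<subseteq> ?A" "\<And>M N. M \<in> C \<Longrightarrow> N \<in> C \<Longrightarrow> M \<subseteq> N \<or> N \<subseteq> M"
      unfolding subset_chain_def by blast+
    have "quadratic_module (\<Union>C)"
      using \<open>C \<noteq> {}\<close> C by (intro quadratic_module_Union_chain) auto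
    then show "\<Union>C \<in> ?A" using C(1) \<open>C \<noteq> {}\<close> by auto
  qed
  then show thesis using that by (smt (verit) mem_Collect_eq subset_trans)
qed

text \<open>If both signs are missing, both adjunctions contain \<open>-1\<close>. Multiplying the
  two certificates crosswise cancels \<open>a\<close> and puts \<open>- t\<close> into
  \<open>S\<close> along with \<open>t\<close>. With both signs of \<open>t\<close> available,
  \<open>a * t\<close> is in \<open>S\<close>, because \<open>a\<close> is the difference of the
  squares of \<open>(a + 1) / 2\<close> and \<open>(a - 1) / 2\<close>; hence
  \<open>-1 = s + a * t\<close> is in \<open>S\<close>.\<close>

lemma maximal_qm_total:
  fixes S :: "'d::finite rpoly set"
  assumes S: "quadratic_module S" and m1: "-1 \<notin> S"
    and max: "\<And>N. quadratic_module N \<Longrightarrow> S \<subseteq> N \<Longrightarrow> -1 \<notin> N \<Longrightarrow> N = S"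
  shows "a \<in> S \<or> - a \<in> S"
proof (rule ccontr)
  assume "\<not> (a \<in> S \<or> - a \<in> S)"
  then have na: "a \<notin> S" "- a \<notin> S" by auto
  have ex: "\<exists>s t. s \<in> S \<and> t \<in> sos \<and> -1 = s + b * t" if "b \<notin> S" for b
    using max[OF qm_adjoin(1,2)[OF S, of b]] qm_adjoin(3)[OF S, of b] that by blast
  obtain s t where st: "s \<in> S" "t \<in> sos" "-1 = s + a * t" using ex[OF na(1)] by blast
  obtain s' t' where st': "s' \<in> S" "t' \<in> sos" "-1 = s' + (- a) * t'" using ex[OF na(2)] by blast
  have "- (t + t') = t' * (s + a * t) + t * (s' + (- a) * t')"
    unfolding st(3)[symmetric] st'(3)[symmetric] by simp
  also have "\<dots> = t' * s + t * s'" by (simp add: algebra_simps)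
  also have "\<dots> \<in> S" using st st' S quadratic_moduleD(2) qm_sos_mult by blast
  finally have "- (t + t') + t' \<in> S" using st' S qm_sos quadratic_moduleD(2) by blast
  then have neg: "- t \<in> S" by simp
  define h :: "'d rpoly" where "h = Const (1/2)"
  have "h * 2 = 1" using Const_half unfolding h_def by (metis mult_2_right)
  have "(h * (a + 1))\<^sup>2 * t + (h * (a - 1))\<^sup>2 * (- t) = (h * 2)\<^sup>2 * (a * t)"
    by (simp add: algebra_simps power2_eq_square)
  also have "\<dots> = a * t" using \<open>h * 2 = 1\<close> by simp
  finally have "a * t \<in> S"
    using neg st S quadratic_moduleD qm_sos by metis
  then show False using st m1 S quadratic_moduleD(2) by metis
qed

section \<open>Archimedean quadratic modules and Putinar's theorem\<close>

text \<open>A bound on the square gives one on the element: \<open>2 * (n + 1 - b)\<close> equals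
  \<open>(n - b\<^sup>2) + (1 - b)\<^sup>2 + n + 1\<close>, for \<open>b\<close> equal to
  \<open>a\<close> and to \<open>- a\<close>.\<close>

lemma archimedean_bounds:
  fixes M :: "'d::finite rpoly set"
  assumes M: "quadratic_module M" and ar: "archimedean M"
  obtains k :: real where "0 < k" "Const k - a \<in> M" "Const k + a \<in> M"
proof -
  obtain n :: nat where n: "of_nat n - a\<^sup>2 \<in> M" using ar unfolding archimedean_def by blast
  have e: "2 * (Const (real n + 1) - b) = (of_nat n - b\<^sup>2) + ((1 - b)\<^sup>2 + of_nat n * 1 + 1)" for b :: "'d rpoly"
    by (simp add: Const_add Const_of_nat algebra_simps power2_eq_square)
  have "of_nat n \<in> M" using qm_Const[OF M, of "real n"] by (simp add: Const_of_nat)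
  then have *: "2 * (Const (real n + 1) - b) \<in> M" if "b\<^sup>2 = a\<^sup>2" for b
    unfolding e by (intro quadratic_moduleD[OF M]) (use n that in \<open>simp_all add: quadratic_moduleD[OF M]\<close>)
  then have "Const (real n + 1) - b \<in> M" if "b\<^sup>2 = a\<^sup>2" for b
    using qm_Const_mult_cancel[OF M, of 2] that by (simp add: Const_numeral)
  from this[of a] this[of "- a"] show thesis by (intro that[of "real n + 1"]) auto
qed

text \<open>A maximal proper quadratic module above an Archimedean one is the set of elements that are
  nonnegative at a point: \<open>a \<mapsto> Inf {r. r - a \<in> S}\<close> is a ring homomorphism to the reals.\<close>

lemma archimedean_qm_point:
  fixes M :: "'d::finite rpoly set"
  assumes M: "quadratic_module M" and ar: "archimedean M" and m1: "-1 \<notin> M"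
  shows "\<exists>x. \<forall>a\<in>M. 0 \<le> peval a x"
proof -
  obtain S where S: "quadratic_module S" "M \<subseteq> S" "-1 \<notin> S"
    and max: "\<And>N. quadratic_module N \<Longrightarrow> S \<subseteq> N \<Longrightarrow> -1 \<notin> N \<Longrightarrow> N = S"
    using maximal_qm[OF M m1] by metis
  note qS = quadratic_moduleD[OF S(1)]
  have tot: "a \<in> S \<or> - a \<in> S" for a
    using maximal_qm_total[OF S(1,3) max] by blast
  have ar': "\<exists>k>0. Const k - a \<in> S \<and> Const k + a \<in> S" for a
    using archimedean_bounds[OF M ar, of a] S(2) by (metis subsetD)
  have Cneg: "c \<ge> 0" if "Const c \<in> S" for c
  proof (rule ccontr)
    assume "\<not> 0 \<le> c"
    then have "Const (- 1 / c) * Const c \<in> S"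
      by (intro qm_Const_mult[OF S(1)] that) (simp add: field_simps)
    then have "Const (-1) \<in> S" using \<open>\<not> 0 \<le> c\<close> by (simp flip: Const_mult)
    then show False using S(3) by (simp add: Const_uminus)
  qed
  define U where "U a = {r. Const r - a \<in> S}" for a
  define \<phi> where "\<phi> a = Inf (U a)" for a
  have U_ne: "U a \<noteq> {}" for a
    using ar'[of a] unfolding U_def by blast
  have U_up: "r' \<in> U a" if "r \<in> U a" "r \<le> r'" for r r' a
  proof -
    have "(Const r - a) + Const (r' - r) \<in> S"
      using that qm_Const[OF S(1), of "r' - r"] qS(2) unfolding U_def by fastforce
    then show ?thesis unfolding U_def by (simp add: Const_diff)
  qed
  have U_lb: "- k \<le> r" if "r \<in> U a" "Const k + a \<in> S" for r k a
  proof -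
    have "(Const r - a) + (Const k + a) \<in> S" using that qS(2) unfolding U_def by blast
    then have "Const (r + k) \<in> S" by (simp add: Const_add)
    then show ?thesis using Cneg by fastforce
  qed
  have U_bdd: "bdd_below (U a)" for a
    using ar'[of a] U_lb unfolding bdd_below_def by metis
  have above: "Const r - a \<in> S" if "\<phi> a < r" for r a
  proof -
    have "\<exists>r'\<in>U a. r' < r"
      using that cInf_lessD[OF U_ne, of a r] unfolding \<phi>_def by blast
    then obtain r' where "r' \<in> U a" "r' < r" by blast
    then show ?thesis using U_up[of r' a r] unfolding U_def by auto
  qed
  have below: "a - Const r \<in> S" if "r < \<phi> a" for r a
  proof -
    have "r \<notin> U a" using that cInf_lower[OF _ U_bdd] unfolding \<phi>_def by fastforce
    then show ?thesis using tot[of "Const r - a"] unfolding U_def by simp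
  qed
  have phi_ge: "r \<le> \<phi> a" if "a - Const r \<in> S" for r a
  proof (rule ccontr)
    assume "\<not> r \<le> \<phi> a"
    then obtain r' where r': "\<phi> a < r'" "r' < r" using dense[of "\<phi> a" r] by auto
    have "(a - Const r) + (Const r' - a) \<in> S" using that above[OF r'(1)] qS(2) by blast
    then have "Const (r' - r) \<in> S" by (simp add: Const_diff)
    then show False using Cneg r' by fastforce
  qed
  have phi_le: "\<phi> a \<le> r" if "Const r - a \<in> S" for r a
    using cInf_lower[OF _ U_bdd] that unfolding \<phi>_def U_def by blast
  have phi_C: "\<phi> (Const c) = c" for c
    by (intro antisym phi_le phi_ge) (simp_all add: qS)
  have add_le: "\<phi> (a + b) \<le> \<phi> a + \<phi> b" for a b
  proof (rule field_le_epsilon)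
    fix e :: real assume "e > 0"
    have "(Const (\<phi> a + e/2) - a) + (Const (\<phi> b + e/2) - b) \<in> S"
      using above[of a "\<phi> a + e/2"] above[of b "\<phi> b + e/2"] \<open>e > 0\<close> qS(2) by fastforce
    also have "(Const (\<phi> a + e/2) - a) + (Const (\<phi> b + e/2) - b) = Const ((\<phi> a + e/2) + (\<phi> b + e/2)) - (a + b)"
      by (simp only: Const_add) (simp add: algebra_simps)
    finally show "\<phi> (a + b) \<le> \<phi> a + \<phi> b + e" using phi_le by fastforce
  qed
  have add_ge: "\<phi> (a + b) \<ge> \<phi> a + \<phi> b" for a b
  proof (rule field_le_epsilon)
    fix e :: real assume "e > 0"
    have "(a - Const (\<phi> a - e/2)) + (b - Const (\<phi> b - e/2)) \<in> S"
      using below[of "\<phi> a - e/2" a] below[of "\<phi> b - e/2" b] \<open>e > 0\<close> qS(2) by fastforce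
    also have "(a - Const (\<phi> a - e/2)) + (b - Const (\<phi> b - e/2)) = (a + b) - Const ((\<phi> a - e/2) + (\<phi> b - e/2))"
      by (simp only: Const_add) (simp add: algebra_simps)
    finally show "\<phi> a + \<phi> b \<le> \<phi> (a + b) + e" using phi_ge by fastforce
  qed
  have phi_add: "\<phi> (a + b) = \<phi> a + \<phi> b" for a b using add_le add_ge by (simp add: antisym)
  have phi_neg: "\<phi> (- a) = - \<phi> a" for a
    using phi_add[of a "- a"] phi_C[of 0] by simp
  have phi_diff: "\<phi> (a - b) = \<phi> a - \<phi> b" for a b
    using phi_add[of a "- b"] phi_neg by simp
  have phi_pos: "0 \<le> \<phi> a" if "a \<in> S" for a using phi_ge[of a 0] that by simp
  have sq0: "\<phi> (a\<^sup>2) = 0" if "\<phi> a = 0" for a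
  proof (rule antisym)
    show "\<phi> (a\<^sup>2) \<le> 0"
    proof (rule field_le_epsilon)
      fix e :: real assume "e > 0"
      define d where "d = sqrt e"
      have d: "d > 0" "d\<^sup>2 = e" using \<open>e > 0\<close> unfolding d_def by auto
      have m: "Const d - a \<in> S" "Const d + a \<in> S"
        using above[of a d] below[of "- d" a] d that by (auto simp: Const_uminus add.commute)
      have "(Const d + a)\<^sup>2 * (Const d - a) + (Const d - a)\<^sup>2 * (Const d + a)
          = Const (2 * d) * (Const (d\<^sup>2) - a\<^sup>2)"
        by (simp add: algebra_simps power2_eq_square Const_mult Const_numeral)
      then have "Const (2 * d) * (Const (d\<^sup>2) - a\<^sup>2) \<in> S" using m qS(2,3) by metis
      then have "Const (d\<^sup>2) - a\<^sup>2 \<in> S"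
        using qm_Const_mult_cancel[OF S(1), of "2 * d"] d by auto
      then show "\<phi> (a\<^sup>2) \<le> 0 + e" using phi_le d by simp
    qed
    show "0 \<le> \<phi> (a\<^sup>2)" by (intro phi_pos qS)
  qed
  have Cmult: "\<phi> (Const c * a) = c * \<phi> a" if "c > 0" for c a
  proof -
    have "Const (c * r) - Const c * a \<in> S \<longleftrightarrow> Const r - a \<in> S" for r
    proof -
      have "Const (c * r) - Const c * a = Const c * (Const r - a)" by (simp add: Const_mult algebra_simps)
      then show ?thesis using qm_Const_mult qm_Const_mult_cancel S(1) that by (metis less_eq_real_def)
    qed
    then have mem: "c * r \<in> U (Const c * a) \<longleftrightarrow> r \<in> U a" for r unfolding U_def by simp
    show ?thesis
    proof (rule antisym)
      show "c * \<phi> a \<le> \<phi> (Const c * a)" unfolding \<phi>_def[of "Const c * a"]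
      proof (rule cInf_greatest[OF U_ne])
        fix r assume "r \<in> U (Const c * a)"
        then have "r / c \<in> U a" using mem[of "r / c"] that by simp
        then have "\<phi> a \<le> r / c" unfolding \<phi>_def by (intro cInf_lower U_bdd)
        then show "c * \<phi> a \<le> r" using that by (simp add: field_simps)
      qed
      have "\<phi> (Const c * a) / c \<le> \<phi> a" unfolding \<phi>_def[of a]
      proof (rule cInf_greatest[OF U_ne])
        fix r assume "r \<in> U a"
        then have "\<phi> (Const c * a) \<le> c * r" using mem unfolding \<phi>_def by (intro cInf_lower U_bdd) auto
        then show "\<phi> (Const c * a) / c \<le> r" using that by (simp add: field_simps)
      qed
      then show "\<phi> (Const c * a) \<le> c * \<phi> a" using that by (simp add: field_simps)
    qed
  qed
  have Cmult': "\<phi> (Const c * a) = c * \<phi> a" for c a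
  proof -
    consider "c > 0" | "c = 0" | "c < 0" by linarith
    then show ?thesis
    proof cases
      case 3
      then have "\<phi> (Const (- c) * a) = - c * \<phi> a" using Cmult[of "- c"] by simp
      then show ?thesis by (simp add: Const_uminus phi_neg)
    qed (use Cmult phi_C[of 0] in auto)
  qed
  \<comment> \<open>Translation by the constant \<open>\<phi> a\<close> reduces squares to the case
    of value \<open>0\<close>; products then follow by polarization.\<close>
  have sq: "\<phi> (a\<^sup>2) = (\<phi> a)\<^sup>2" for a
  proof -
    define b where "b = a - Const (\<phi> a)"
    have "\<phi> b = 0" unfolding b_def by (simp add: phi_diff phi_C)
    have "a\<^sup>2 = b\<^sup>2 + (Const (2 * \<phi> a) * b + Const ((\<phi> a)\<^sup>2))"
      unfolding b_def by (simp add: algebra_simps power2_eq_square Const_mult Const_numeral)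
    then show ?thesis using sq0 \<open>\<phi> b = 0\<close> by (simp add: phi_add phi_C Cmult')
  qed
  have phi_mult: "\<phi> (a * b) = \<phi> a * \<phi> b" for a b
  proof -
    have "\<phi> ((a + b)\<^sup>2) = \<phi> (a\<^sup>2) + (\<phi> (b\<^sup>2) + \<phi> (Const 2 * (a * b)))"
      unfolding phi_add[symmetric] by (simp add: algebra_simps power2_eq_square Const_numeral)
    then show ?thesis unfolding sq phi_add Cmult' by (simp add: algebra_simps power2_eq_square)
  qed
  define x where "x = (\<chi> i. \<phi> (Var i))"
  have "\<phi> p = peval p x" for p
    by (induction p rule: rpoly_induct) (simp_all add: phi_C phi_add phi_mult x_def)
  then show ?thesis using phi_pos S(2) by (metis subsetD)
qed

text \<open>Putinar's theorem. If \<open>f \<notin> M\<close>, the previous lemma applied to \<open>M - f \<Sigma>\<close> shows that \<open>p f - 1 \<in> M\<close>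
  for a sum of squares \<open>p\<close>; then \<open>f + r \<in> M\<close> implies \<open>f + r - 1/k\<^sup>2 \<in> M\<close> with a fixed \<open>k\<close>.\<close>

theorem archimedean_positivstellensatz:
  fixes M :: "'d::finite rpoly set"
  assumes M: "quadratic_module M" and ar: "archimedean M"
    and pos: "\<And>x. (\<And>a. a \<in> M \<Longrightarrow> 0 \<le> peval a x) \<Longrightarrow> 0 < peval f x"
  shows "f \<in> M"
proof -
  note qM = quadratic_moduleD[OF M]
  let ?N = "{s + (- f) * t | s t. s \<in> M \<and> t \<in> sos}"
  note N = qm_adjoin[OF M, of "- f"]
  have "archimedean ?N" using ar N(2) unfolding archimedean_def by blast
  have "-1 \<in> ?N"
  proof (rule ccontr)
    assume "-1 \<notin> ?N"
    from archimedean_qm_point[OF N(1) \<open>archimedean ?N\<close> this]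
    obtain x where x: "\<forall>a\<in>?N. 0 \<le> peval a x" by blast
    have "0 \<le> peval a x" if "a \<in> M" for a
      using bspec[OF x subsetD[OF N(2) that]] .
    then have "0 < peval f x" by (rule pos)
    moreover have "0 \<le> peval (- f) x" using bspec[OF x N(3)] .
    ultimately show False by simp
  qed
  then obtain s p where sp: "s \<in> M" "p \<in> sos" "-1 = s + (- f) * p" by blast
  have "s = p * f - 1"
    using arg_cong[OF sp(3), of "\<lambda>z. z + p * f"] by (simp add: algebra_simps)
  then have pf: "p * f - 1 \<in> M" using sp(1) by simp
  obtain k1 where k1: "0 < k1" "Const k1 - (p\<^sup>2 * f + 1) \<in> M" using archimedean_bounds[OF M ar] by metis
  obtain k2 where k2: "0 < k2" "Const k2 - p \<in> M" using archimedean_bounds[OF M ar] by metis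
  define k where "k = k1 + k2"
  have k: "k > 0" using k1 k2 unfolding k_def by simp
  have "(Const k1 - (p\<^sup>2 * f + 1)) + Const (k1 + 2 * k2) \<in> M"
    using k1 k2 qM(2) qm_Const[OF M, of "k1 + 2 * k2"] by force
  then have a1: "Const (2 * k) - (p\<^sup>2 * f + 1) \<in> M" unfolding k_def by (simp add: Const_add Const_mult Const_numeral algebra_simps)
  have "(Const k2 - p) + Const (2 * k1 + k2) \<in> M"
    using k1 k2 qM(2) qm_Const[OF M, of "2 * k1 + k2"] by force
  then have a2: "Const (2 * k) - p \<in> M" unfolding k_def by (simp add: Const_add Const_mult Const_numeral algebra_simps)
  have step: "f + Const (r - 1 / k\<^sup>2) \<in> M" if r: "r \<ge> 0" "f + Const r \<in> M" for r
  proof -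
    \<comment> \<open>The cross terms \<open>- 2 * k * p * f\<close> and
      \<open>p\<^sup>2 * f\<close> of the first summand are cancelled by the certificate
      \<open>p * f - 1\<close> and by the bound on \<open>p\<^sup>2 * f + 1\<close>; the terms with
      \<open>r\<close> are cancelled by \<open>r * p * (2 * k - p)\<close>. There remains
      \<open>k\<^sup>2 * (f + r) - 1\<close>.\<close>
    have "(Const k - p)\<^sup>2 * (f + Const r) + Const (2 * k) * (p * f - 1)
        + (Const (2 * k) - (p\<^sup>2 * f + 1)) + Const r * (p * (Const (2 * k) - p)) \<in> M"
      by (intro qM qm_Const_mult[OF M] r pf a1 qm_sos_mult[OF M] a2 sp) (use k in auto)
    also have "(Const k - p)\<^sup>2 * (f + Const r) + Const (2 * k) * (p * f - 1)
        + (Const (2 * k) - (p\<^sup>2 * f + 1)) + Const r * (p * (Const (2 * k) - p))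
       = Const k ^ 2 * f + Const k ^ 2 * Const r - 1"
      by (simp add: algebra_simps power2_eq_square Const_mult Const_numeral)
    also have "\<dots> = Const (k\<^sup>2) * (f + Const (r - 1 / k\<^sup>2))"
    proof -
      have "Const (k\<^sup>2) * Const (r - 1 / k\<^sup>2) = (Const (k\<^sup>2 * r) - 1 :: 'd rpoly)"
        using k by (simp add: right_diff_distrib flip: Const_mult Const_diff Const_1)
      then show ?thesis by (simp add: distrib_left Const_power Const_mult)
    qed
    finally show ?thesis using qm_Const_mult_cancel[OF M] k by (metis zero_less_power)
  qed
  obtain r0 where r0: "r0 > 0" "Const r0 + f \<in> M" using archimedean_bounds[OF M ar, of f] by metis
  have iter: "f + Const (r0 - real j / k\<^sup>2) \<in> M" if "\<And>i. i < j \<Longrightarrow> r0 - real i / k\<^sup>2 \<ge> 0" for j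
    using that
  proof (induction j)
    case 0
    then show ?case using r0 by (simp add: add.commute)
  next
    case (Suc j)
    then have "f + Const (r0 - real j / k\<^sup>2 - 1 / k\<^sup>2) \<in> M" by (intro step) auto
    then show ?case by (simp add: algebra_simps add_divide_distrib)
  qed
  obtain n where n: "r0 * k\<^sup>2 < real n" using reals_Archimedean2 by blast
  \<comment> \<open>A step needs only the preceding constant to be nonnegative, so the first
    negative constant is still reached. Adding its negative, which is a positive constant, leaves
    \<open>f\<close>.\<close>
  define j where "j = (LEAST j. r0 - real j / k\<^sup>2 < 0)"
  have "\<exists>j. r0 - real j / k\<^sup>2 < 0" using n k by (intro exI[of _ n]) (simp add: field_simps)
  then have j: "r0 - real j / k\<^sup>2 < 0" unfolding j_def by (rule LeastI_ex)
  have "f + Const (r0 - real j / k\<^sup>2) \<in> M"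
    by (rule iter) (use not_less_Least in \<open>force simp: j_def\<close>)
  then have "(f + Const (r0 - real j / k\<^sup>2)) + Const (- (r0 - real j / k\<^sup>2)) \<in> M"
    using j qM(2) qm_Const[OF M, of "- (r0 - real j / k\<^sup>2)"] by force
  then show ?thesis by (simp add: add.assoc flip: Const_add)
qed

section \<open>Polynomials over real closed fields\<close>

text \<open>The intermediate value property is stated for power sums because the type of polynomials is
  not available inside a class specification.\<close>

class real_closed = linordered_field +
  assumes power_sum_ivt: "a < b \<Longrightarrow> (\<Sum>k\<le>n. f k * a ^ k) < 0 \<Longrightarrow> 0 < (\<Sum>k\<le>n. f k * b ^ k)
    \<Longrightarrow> \<exists>c>a. c < b \<and> (\<Sum>k\<le>n. f k * c ^ k) = 0"

lemma poly_ivt_up: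
  fixes p :: "'a::real_closed poly"
  assumes "a < b" "poly p a < 0" "0 < poly p b"
  shows "\<exists>c>a. c < b \<and> poly p c = 0"
  using power_sum_ivt[of a b "coeff p" "degree p"] assms by (simp add: poly_altdef)

instance real :: real_closed
proof
  fix a b :: real and f n
  assume *: "a < b" "(\<Sum>k\<le>n. f k * a ^ k) < 0" "0 < (\<Sum>k\<le>n. f k * b ^ k)"
  define p where "p = (\<Sum>k\<le>n. monom (f k) k)"
  have "poly p x = (\<Sum>k\<le>n. f k * x ^ k)" for x
    by (simp add: p_def poly_sum poly_monom)
  then show "\<exists>c>a. c < b \<and> (\<Sum>k\<le>n. f k * c ^ k) = 0"
    using poly_IVT_pos[of a b p] * by auto
qed

text \<open>The values are integers so that signs in two different ordered fields can be
  equated.\<close>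

definition sg :: "'a::linordered_idom \<Rightarrow> int" where
  "sg a = (if a < 0 then -1 else if a = 0 then 0 else 1)"

lemma sg_0 [simp]: "sg 0 = 0" and sg_minus: "sg (- a) = - sg a"
  by (auto simp: sg_def)

lemma sg_eq_0_iff [simp]: "sg a = 0 \<longleftrightarrow> a = 0"
  and sg_eq_1_iff: "sg a = 1 \<longleftrightarrow> a > 0" and sg_eq_m1_iff: "sg a = -1 \<longleftrightarrow> a < 0"
  by (auto simp: sg_def)

lemma sg_mult: "sg (a * b) = sg a * sg b"
  by (auto simp: sg_def mult_less_0_iff)

lemma sg_eq_iff: "sg a = sg b \<longleftrightarrow> (a < 0 \<longleftrightarrow> b < 0) \<and> (a = 0 \<longleftrightarrow> b = 0)"
  by (auto simp: sg_def)

lemma poly_ivt: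
  fixes p :: "'a::real_closed poly"
  assumes "a < b" "poly p a \<noteq> 0" "poly p b \<noteq> 0" "sg (poly p a) \<noteq> sg (poly p b)"
  shows "\<exists>c>a. c < b \<and> poly p c = 0"
proof (cases "poly p a < 0")
  case True
  then show ?thesis using assms poly_ivt_up[of a b p] by (auto simp: sg_def split: if_splits)
next
  case False
  then show ?thesis using assms poly_ivt_up[of a b "- p"] by (auto simp: sg_def split: if_splits)
qed

text \<open>An extremum need not exist without completeness, so the argument is algebraic. Let
  \<open>b'\<close> be the first root after \<open>a\<close> and split off the full powers of both
  linear factors. The cofactor \<open>q\<close> keeps its sign between them, and the essential
  factor \<open>s\<close> of the derivative has opposite signs at \<open>a\<close> and
  \<open>b'\<close>.\<close>

lemma poly_rolle:
  fixes p :: "'a::real_closed poly"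
  assumes "a < b" "poly p a = 0" "poly p b = 0"
  shows "\<exists>c>a. c < b \<and> poly (pderiv p) c = 0"
proof (cases "p = 0")
  case True
  then show ?thesis using dense[OF assms(1)] by auto
next
  case False
  define R where "R = {x. a < x \<and> x \<le> b \<and> poly p x = 0}"
  have "finite R" using poly_roots_finite[OF False] unfolding R_def by (rule finite_subset[rotated]) auto
  define b' where "b' = Min R"
  have "b \<in> R" using assms unfolding R_def by auto
  then have "b' \<in> R" and min: "\<And>x. x \<in> R \<Longrightarrow> b' \<le> x"
    using \<open>finite R\<close> Min_in[of R] Min_le[of R] unfolding b'_def by blast+
  then have b': "a < b'" "b' \<le> b" "poly p b' = 0" unfolding R_def by auto
  define m where "m = order a p"
  define n where "n = order b' p"
  obtain q0 where q0: "p = [:- a, 1:] ^ m * q0" "\<not> [:- a, 1:] dvd q0"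
    using order_decomp[OF False, of a] unfolding m_def by blast
  have "q0 \<noteq> 0" using q0 False by auto
  have n': "order b' q0 = n"
  proof -
    have "order b' ([:- a, 1:] ^ m) = 0"
      using b' by (intro order_0I) auto
    then show ?thesis unfolding n_def using False order_mult[of "[:- a, 1:] ^ m" q0 b'] q0(1) by auto
  qed
  obtain q where q: "q0 = [:- b', 1:] ^ n * q" "\<not> [:- b', 1:] dvd q"
    using order_decomp[OF \<open>q0 \<noteq> 0\<close>, of b'] n' by blast
  have mn: "m > 0" "n > 0"
    using False assms b' order_root unfolding m_def n_def by (metis gr0I)+
  have qa: "poly q a \<noteq> 0" using q0(2) q by (auto simp: poly_eq_0_iff_dvd)
  have qb: "poly q b' \<noteq> 0" using q(2) by (auto simp: poly_eq_0_iff_dvd)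
  have "poly q c \<noteq> 0" if "a < c" "c < b'" for c
    using min[of c] that b' unfolding R_def q0(1) q(1) by auto
  then have sgq: "sg (poly q a) = sg (poly q b')"
    using poly_ivt[OF b'(1) qa qb] by metis
  define A where "A = [:- a, 1:]"
  define B where "B = [:- b', 1:]"
  define s where "s = of_nat m * B * q + of_nat n * A * q + A * B * pderiv q"
  obtain m' n' where mn': "m = Suc m'" "n = Suc n'" using mn by (metis gr0_conv_Suc)
  have dA: "pderiv A = 1" "pderiv B = 1" by (simp_all add: A_def B_def pderiv_pCons)
  have sm: "smult (of_nat k) r = of_nat k * r" for k and r :: "'a poly"
    by (simp add: of_nat_poly)
  have "pderiv p = pderiv (A ^ Suc m' * (B ^ Suc n' * q))"
    using q0(1) q(1) mn' unfolding A_def B_def by simp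
  also have "\<dots> = A ^ m' * B ^ n' * s"
    unfolding s_def mn' pderiv_mult pderiv_power_Suc dA sm by (simp add: algebra_simps)
  finally have dp: "pderiv p = A ^ m' * B ^ n' * s" .
  have sa: "poly s a = of_nat m * (a - b') * poly q a" and sb: "poly s b' = of_nat n * (b' - a) * poly q b'"
    unfolding s_def A_def B_def by (simp_all add: of_nat_poly algebra_simps)
  have sgs: "sg (poly s a) = - sg (poly q a)" "sg (poly s b') = sg (poly q b')"
    unfolding sa sb sg_mult using mn b' by (simp_all add: sg_def)
  have "sg (poly s a) \<noteq> sg (poly s b')"
    unfolding sgs sgq using qb by simp
  moreover have "poly s a \<noteq> 0" "poly s b' \<noteq> 0"
    unfolding sa sb using mn b' qa qb by simp_all
  ultimately obtain c where "a < c" "c < b'" "poly s c = 0"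
    using poly_ivt[OF b'(1), of s] by blast
  then show ?thesis using dp b' by (intro exI[of _ c]) auto
qed

lemma poly_mvt:
  fixes p :: "'a::real_closed poly"
  assumes "a < b"
  shows "\<exists>c>a. c < b \<and> poly p b - poly p a = (b - a) * poly (pderiv p) c"
proof -
  define k where "k = (poly p b - poly p a) / (b - a)"
  define r where "r = p - [:poly p a - k * a, k:]"
  have "poly r a = 0" by (simp add: r_def algebra_simps)
  moreover have "k * (b - a) = poly p b - poly p a" using assms by (simp add: k_def)
  then have "poly r b = 0" by (simp add: r_def algebra_simps)
  ultimately obtain c where c: "a < c" "c < b" "poly (pderiv r) c = 0" using poly_rolle assms by blast
  then have "poly (pderiv p) c = k" by (simp add: r_def pderiv_diff pderiv_pCons)
  then show ?thesis using c assms unfolding k_def by (intro exI[of _ c]) auto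
qed

lemma sg_poly_diff:
  fixes p :: "'a::real_closed poly"
  assumes "a < b" "\<And>c. a < c \<Longrightarrow> c < b \<Longrightarrow> sg (poly (pderiv p) c) = s"
  shows "sg (poly p b - poly p a) = s"
proof -
  obtain c where c: "a < c" "c < b" "poly p b - poly p a = (b - a) * poly (pderiv p) c"
    using poly_mvt[OF assms(1)] by blast
  then show ?thesis using assms unfolding c(3) sg_mult by (simp add: sg_def[of "b - a"])
qed

lemma poly_gt_at_top:
  fixes p :: "'a::linordered_field poly"
  assumes "0 < lead_coeff p" "degree p > 0"
  shows "\<exists>M. \<forall>x\<ge>M. C < poly p x"
  using assms
proof (induction p arbitrary: C)
  case (pCons a p)
  then have "p \<noteq> 0" by auto
  then have lc: "0 < lead_coeff p" using pCons.prems by simp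
  have "\<exists>M d. 0 < d \<and> (\<forall>x\<ge>M. d \<le> poly p x)"
  proof (cases "degree p = 0")
    case True
    then obtain e where "p = [:e:]" by (rule degree_eq_zeroE)
    then show ?thesis using lc by (intro exI[of _ 0] exI[of _ e]) auto
  next
    case False
    then show ?thesis using pCons.IH[OF lc, of 1] by (meson gr0I less_imp_le zero_less_one)
  qed
  then obtain M d where M: "0 < d" "\<And>x. x \<ge> M \<Longrightarrow> d \<le> poly p x" by blast
  have "C < poly (pCons a p) x" if x: "x \<ge> Max {M, 1, (\<bar>C - a\<bar> + 1) / d}" for x
  proof -
    have x: "x \<ge> M" "x \<ge> 1" "x \<ge> (\<bar>C - a\<bar> + 1) / d" using x by auto
    have "C - a < \<bar>C - a\<bar> + 1" by (metis abs_ge_self add.commute less_add_same_cancel2 less_le_trans not_le zero_less_one add_strict_increasing)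
    also have "\<dots> \<le> x * d" using x(3) M(1) by (simp add: field_simps)
    also have "\<dots> \<le> x * poly p x" using x M by (intro mult_left_mono) auto
    finally show ?thesis by (simp add: algebra_simps)
  qed
  then show ?case by blast
qed simp

lemma sg_at_top:
  fixes p :: "'a::linordered_field poly"
  shows "\<exists>M. \<forall>x\<ge>M. sg (poly p x) = sg (lead_coeff p)"
proof (cases "degree p = 0")
  case True
  then show ?thesis by (auto elim!: degree_eq_zeroE)
next
  case False
  then have "p \<noteq> 0" by auto
  then consider "0 < lead_coeff p" | "0 < lead_coeff (- p)"
    by (metis leading_coeff_0_iff linorder_neqE lead_coeff_minus neg_0_less_iff_less)
  then show ?thesis
  proof cases
    case 1
    then have l: "sg (lead_coeff p) = 1" by (simp only: sg_eq_1_iff)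
    show ?thesis unfolding l sg_eq_1_iff using poly_gt_at_top[of p 0] False 1 by simp
  next
    case 2
    obtain M where "\<forall>x\<ge>M. 0 < poly (- p) x" using poly_gt_at_top[of "- p" 0] 2 False by auto
    moreover have l: "sg (lead_coeff p) = -1" using 2 by (simp add: sg_eq_m1_iff)
    ultimately show ?thesis unfolding l sg_eq_m1_iff by (intro exI[of _ M]) simp
  qed
qed

text \<open>Serves the unbounded gaps between roots: where an endpoint is missing, a point far out
  replaces it, and the sign there is read off from the derivative.\<close>

lemma sg_pderiv_at_top:
  fixes p :: "'a::real_closed poly"
  assumes "pderiv p \<noteq> 0"
  shows "\<exists>x>b. sg (poly p x) = sg (poly (pderiv p) x)"
proof -
  have deg: "degree p > 0" using assms by (metis pderiv_eq_0_iff gr0I)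
  have lc: "sg (lead_coeff (pderiv p)) = sg (lead_coeff p)"
    using deg by (simp add: degree_pderiv coeff_pderiv sg_mult) (simp add: sg_def)
  obtain M N where M: "\<forall>x\<ge>M. sg (poly p x) = sg (lead_coeff p)"
    "\<forall>x\<ge>N. sg (poly (pderiv p) x) = sg (lead_coeff (pderiv p))" using sg_at_top by metis
  define x where "x = Max {M, N, b + 1}"
  have "x \<ge> M" "x \<ge> N" "x \<ge> b + 1" unfolding x_def by auto
  moreover from this have "x > b" by (meson less_add_one less_le_trans)
  ultimately show ?thesis using M lc by (intro exI[of _ x]) simp
qed

lemma sg_pderiv_at_bot:
  fixes p :: "'a::real_closed poly"
  assumes "pderiv p \<noteq> 0"
  shows "\<exists>x<b. sg (poly p x) = - sg (poly (pderiv p) x)"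
proof -
  define r where "r = p \<circ>\<^sub>p [:0, -1:]"
  have r': "pderiv r = - (pderiv p \<circ>\<^sub>p [:0, -1:])"
    by (simp add: r_def pderiv_pcompose pderiv_pCons)
  have "pderiv p \<circ>\<^sub>p [:0, -1:] \<noteq> 0" using assms by (simp add: pcompose_eq_0_iff)
  then have "pderiv r \<noteq> 0" using r' by simp
  from sg_pderiv_at_top[OF this, of "- b"] obtain x where "x > - b" "sg (poly r x) = sg (poly (pderiv r) x)"
    by blast
  then show ?thesis unfolding r' by (intro exI[of _ "- x"]) (simp add: r_def poly_pcompose sg_minus)
qed

section \<open>Matching the sign tables of polynomials over two real closed fields\<close>

text \<open>The finite set cuts the line into points and open intervals. Corresponding pieces of the
  two lines are described by signs of differences, without an enumeration of
  \<open>Z\<close>.\<close>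

definition cell :: "'a::linordered_field set \<Rightarrow> ('a \<Rightarrow> 'b::linordered_field) \<Rightarrow> 'a \<Rightarrow> 'b \<Rightarrow> bool" where
  "cell Z h x y \<longleftrightarrow> (\<forall>z\<in>Z. sg (x - z) = sg (y - h z))"

lemma finite_gap:
  fixes A B :: "'a::linordered_field set"
  assumes "finite A" "finite B" "\<And>a b. a \<in> A \<Longrightarrow> b \<in> B \<Longrightarrow> a < b"
  shows "\<exists>y. (\<forall>a\<in>A. a < y) \<and> (\<forall>b\<in>B. y < b)"
proof -
  consider "A = {}" "B = {}" | "A = {}" "B \<noteq> {}" | "A \<noteq> {}" "B = {}" | "A \<noteq> {}" "B \<noteq> {}" by blast
  then show ?thesis
  proof cases
    case 2
    obtain y where "y < Min B" using lt_ex by blast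
    then show ?thesis using 2 assms by (intro exI[of _ y]) auto
  next
    case 3
    obtain y where "Max A < y" using gt_ex by blast
    then show ?thesis using 3 assms by (intro exI[of _ y]) auto
  next
    case 4
    then have "Max A < Min B" using assms by simp
    then obtain y where "Max A < y" "y < Min B" using dense by blast
    then show ?thesis using 4 assms by (intro exI[of _ y]) auto
  qed auto
qed

lemma cell_mem:
  assumes "strict_mono_on Z h" "x \<in> Z"
  shows "cell Z h x y \<longleftrightarrow> y = h x"
proof
  show "cell Z h x y \<Longrightarrow> y = h x"
    using assms(2) unfolding cell_def by (metis cancel_comm_monoid_add_class.diff_cancel right_minus_eq sg_eq_0_iff)
  have "sg (x - z) = sg (h x - h z)" if "z \<in> Z" for z
    using strict_mono_onD[OF assms(1), of x z] strict_mono_onD[OF assms(1), of z x] assms(2) that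
    by (cases x z rule: linorder_cases) (auto simp: sg_def)
  then show "y = h x \<Longrightarrow> cell Z h x y" unfolding cell_def by simp
qed

lemma cell_ex:
  fixes h :: "'a::linordered_field \<Rightarrow> 'b::linordered_field"
  assumes "finite Z" "strict_mono_on Z h"
  shows "\<exists>y. cell Z h x y"
proof (cases "x \<in> Z")
  case True
  then show ?thesis using cell_mem[OF assms(2)] by blast
next
  case False
  define A where "A = {z\<in>Z. z < x}"
  define B where "B = {z\<in>Z. x < z}"
  have "h a < h b" if "a \<in> A" "b \<in> B" for a b
    using that strict_mono_onD[OF assms(2)] unfolding A_def B_def by auto
  then have "\<exists>y. (\<forall>a\<in>h ` A. a < y) \<and> (\<forall>b\<in>h ` B. y < b)"
    using assms(1) unfolding A_def B_def by (intro finite_gap) auto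
  then obtain y where y: "\<And>a. a \<in> A \<Longrightarrow> h a < y" "\<And>b. b \<in> B \<Longrightarrow> y < h b" by blast
  have "sg (x - z) = sg (y - h z)" if "z \<in> Z" for z
    using y[of z] False that unfolding A_def B_def
    by (cases x z rule: linorder_cases) (auto simp: sg_def)
  then show ?thesis unfolding cell_def by blast
qed

lemma cell_ex':
  fixes h :: "'a::linordered_field \<Rightarrow> 'b::linordered_field"
  assumes "finite Z" "strict_mono_on Z h"
  shows "\<exists>x. cell Z h x y"
proof -
  have inj: "inj_on h Z" using assms(2) by (rule strict_mono_on_imp_inj_on)
  define g where "g = the_inv_into Z h"
  have g: "g (h z) = z" if "z \<in> Z" for z using the_inv_into_f_f[OF inj that] unfolding g_def .
  have "strict_mono_on (h ` Z) g"
  proof (rule strict_mono_onI)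
    fix r s assume "r \<in> h ` Z" "s \<in> h ` Z" "r < s"
    then show "g r < g s" using g strict_mono_onD[OF assms(2)]
      by (metis imageE linorder_neqE not_less_iff_gr_or_eq)
  qed
  then obtain x where "cell (h ` Z) g y x" using cell_ex assms(1) by blast
  then show ?thesis using g unfolding cell_def by (intro exI[of _ x]) auto
qed

lemma sg_poly_no_root_between:
  fixes q :: "'a::real_closed poly"
  assumes "\<And>w. q \<noteq> 0 \<Longrightarrow> poly q w = 0 \<Longrightarrow> sg (y - w) = sg (y' - w) \<and> y \<noteq> w"
  shows "sg (poly q y) = sg (poly q y')"
proof (rule ccontr)
  assume ne: "sg (poly q y) \<noteq> sg (poly q y')"
  then have "q \<noteq> 0" "y \<noteq> y'" by auto
  have nz: "poly q y \<noteq> 0" using assms[of y] \<open>q \<noteq> 0\<close> by blast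
  have nz': "poly q y' \<noteq> 0" using assms[of y'] \<open>q \<noteq> 0\<close> by auto
  obtain c where "poly q c = 0" "y < c \<and> c < y' \<or> y' < c \<and> c < y"
  proof (cases "y < y'")
    case True
    then show ?thesis using poly_ivt[OF True nz nz' ne] that by blast
  next
    case False
    then have "y' < y" using \<open>y \<noteq> y'\<close> by simp
    then show ?thesis using poly_ivt[OF _ nz' nz ne[symmetric]] that by blast
  qed
  then show False using assms[of c] \<open>q \<noteq> 0\<close> by (auto simp: sg_def split: if_splits)
qed

text \<open>The zero polynomial contributes no roots, which keeps the set finite.\<close>

definition rts1 :: "('a::real_closed poly \<times> 'b::real_closed poly) set \<Rightarrow> 'a set" where
  "rts1 F = {x. \<exists>p q. (p, q) \<in> F \<and> p \<noteq> 0 \<and> poly p x = 0}"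

definition rts2 :: "('a::real_closed poly \<times> 'b::real_closed poly) set \<Rightarrow> 'b set" where
  "rts2 F = {y. \<exists>p q. (p, q) \<in> F \<and> q \<noteq> 0 \<and> poly q y = 0}"

text \<open>The families of first and second components of \<open>F\<close> have the same sign table, the columns of
  the two tables being matched by \<open>h\<close>.\<close>

definition matches :: "('a::real_closed poly \<times> 'b::real_closed poly) set \<Rightarrow> ('a \<Rightarrow> 'b) \<Rightarrow> bool" where
  "matches F h \<longleftrightarrow> strict_mono_on (rts1 F) h \<and> h ` rts1 F = rts2 F \<and>
     (\<forall>x y. cell (rts1 F) h x y \<longrightarrow> (\<forall>(p, q)\<in>F. sg (poly p x) = sg (poly q y)))"

lemma matchesD:
  assumes "matches F h"
  shows "strict_mono_on (rts1 F) h" "h ` rts1 F = rts2 F"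
    "\<And>x y p q. cell (rts1 F) h x y \<Longrightarrow> (p, q) \<in> F \<Longrightarrow> sg (poly p x) = sg (poly q y)"
  using assms unfolding matches_def by blast+

lemma finite_rts1: "finite F \<Longrightarrow> finite (rts1 F)"
proof -
  assume "finite F"
  have "rts1 F = (\<Union>p\<in>fst ` F - {0}. {x. poly p x = 0})" unfolding rts1_def by force
  then show ?thesis using \<open>finite F\<close> poly_roots_finite by auto
qed

lemma poly_nonroot:
  fixes p :: "'a::real_closed poly"
  assumes "p \<noteq> 0" shows "\<exists>x. poly p x \<noteq> 0"
proof -
  have "infinite (UNIV :: 'a set)" by (rule infinite_UNIV_char_0)
  then show ?thesis using poly_roots_finite[OF assms] by (metis (mono_tags, lifting) UNIV_eq_I mem_Collect_eq)
qed

lemma matches_nonzero: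
  assumes "finite F" "matches F h" "(p, q) \<in> F"
  shows "p = 0 \<longleftrightarrow> q = 0"
proof -
  note m = matchesD[OF assms(2)]
  have "p \<noteq> 0" if "q \<noteq> 0"
    using poly_nonroot[OF that] cell_ex'[OF finite_rts1[OF assms(1)] m(1)] m(3) assms(3)
    by (metis poly_0 sg_eq_0_iff)
  moreover have "q \<noteq> 0" if "p \<noteq> 0"
    using poly_nonroot[OF that] cell_ex[OF finite_rts1[OF assms(1)] m(1)] m(3) assms(3)
    by (metis poly_0 sg_eq_0_iff)
  ultimately show ?thesis by blast
qed

lemma matches_at_root:
  assumes "matches F h" "z \<in> rts1 F" "(p, q) \<in> F"
  shows "sg (poly p z) = sg (poly q (h z))"
  using matchesD[OF assms(1)] assms(2,3) cell_mem by blast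

text \<open>Cells of the smaller family are coarser, so \<open>y\<close> need not lie in the fine
  cell that belongs to \<open>x\<close>. It is compared with a point \<open>y0\<close> of that fine
  cell: no root of \<open>q\<close> separates the two.\<close>

lemma matches_subset:
  assumes fin: "finite F'" and m': "matches F' h" and sub: "F \<subseteq> F'"
  shows "matches F h"
proof -
  note m = matchesD[OF m']
  have r1: "rts1 F \<subseteq> rts1 F'" and r2: "rts2 F \<subseteq> rts2 F'"
    using sub unfolding rts1_def rts2_def by blast+
  have mono: "strict_mono_on (rts1 F) h"
    using m(1) r1 unfolding strict_mono_on_def by blast
  have img: "h ` rts1 F = rts2 F"
  proof (intro equalityI subsetI)
    fix w assume "w \<in> h ` rts1 F"
    then obtain z p q where z: "w = h z" "(p, q) \<in> F" "p \<noteq> 0" "poly p z = 0" "z \<in> rts1 F"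
      unfolding rts1_def by blast
    then have "sg (poly q w) = 0" using matches_at_root[OF m', of z p q] r1 sub by auto
    moreover have "q \<noteq> 0" using matches_nonzero[OF fin m', of p q] z sub by blast
    ultimately show "w \<in> rts2 F" using z unfolding rts2_def by auto
  next
    fix w assume "w \<in> rts2 F"
    then obtain p q where w: "(p, q) \<in> F" "q \<noteq> 0" "poly q w = 0" "w \<in> rts2 F'"
      using r2 unfolding rts2_def by blast
    then obtain z where z: "z \<in> rts1 F'" "w = h z" using m(2) by blast
    then have "poly p z = 0" using matches_at_root[OF m', of z p q] w sub by (metis sg_eq_0_iff subsetD)
    moreover have "p \<noteq> 0" using matches_nonzero[OF fin m', of p q] w sub by blast
    ultimately show "w \<in> h ` rts1 F" using w z unfolding rts1_def by blast
  qed
  have "sg (poly p x) = sg (poly q y)" if c: "cell (rts1 F) h x y" and pq: "(p, q) \<in> F" for x y p q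
  proof (cases "x \<in> rts1 F")
    case True
    then have "y = h x" using cell_mem[OF mono] c by blast
    then show ?thesis using matches_at_root[OF m', of x p q] True r1 pq sub by blast
  next
    case False
    obtain y0 where y0: "cell (rts1 F') h x y0" using cell_ex[OF finite_rts1[OF fin] m(1)] by blast
    have "sg (poly q y) = sg (poly q y0)"
    proof (rule sg_poly_no_root_between)
      fix w assume "q \<noteq> 0" "poly q w = 0"
      then have "w \<in> h ` rts1 F" using pq unfolding img rts2_def by blast
      then obtain z where z: "z \<in> rts1 F" "w = h z" by blast
      have "sg (x - z) = sg (y - w)" using c z unfolding cell_def by simp
      moreover have "sg (x - z) = sg (y0 - w)" using y0 z r1 unfolding cell_def by auto
      moreover have "x \<noteq> z" using z False by blast
      ultimately show "sg (y - w) = sg (y0 - w) \<and> y \<noteq> w" by auto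
    qed
    then show ?thesis using m(3)[OF y0] pq sub by auto
  qed
  then show ?thesis using mono img unfolding matches_def by blast
qed

definition lower_nb :: "'a::linorder set \<Rightarrow> 'a \<Rightarrow> 'a \<Rightarrow> bool" where
  "lower_nb Z x z \<longleftrightarrow> z \<in> Z \<and> z < x \<and> (\<forall>z'\<in>Z. z' < x \<longrightarrow> z' \<le> z)"

definition upper_nb :: "'a::linorder set \<Rightarrow> 'a \<Rightarrow> 'a \<Rightarrow> bool" where
  "upper_nb Z x z \<longleftrightarrow> z \<in> Z \<and> x < z \<and> (\<forall>z'\<in>Z. x < z' \<longrightarrow> z \<le> z')"

lemma sg_diff_eq_iff:
  fixes a b :: "'a::linordered_idom" and c d :: "'b::linordered_idom"
  shows "sg (a - b) = sg (c - d) \<longleftrightarrow> (a < b \<longleftrightarrow> c < d) \<and> (a = b \<longleftrightarrow> c = d)"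
  by (auto simp: sg_def)

section \<open>A polynomial on a gap where its derivative has a constant nonzero sign\<close>

context
  fixes Z :: "'a::real_closed set" and f :: "'a poly" and x :: 'a and s :: int and J
  assumes finX: "finite Z" and x: "x \<notin> Z" and s: "s \<noteq> 0"
  defines "J \<equiv> {c. \<forall>z\<in>Z. sg (c - z) = sg (x - z)}"
  assumes f': "\<And>c. c \<in> J \<Longrightarrow> sg (poly (pderiv f) c) = s"
begin

lemma x_in_J: "x \<in> J" unfolding J_def by simp

lemma J_between:
  assumes uv: "u < c" "c < v" "u \<in> J \<or> lower_nb Z x u" "v \<in> J \<or> upper_nb Z x v"
  shows "c \<in> J"
proof -
  have "sg (c - z) = sg (x - z)" if z: "z \<in> Z" for z
  proof (cases "z < x")
    case True
    have "z \<le> u"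
      using uv(3)
    proof
      assume "u \<in> J"
      then show ?thesis using z True unfolding J_def sg_diff_eq_iff by (auto simp: not_less[symmetric])
    qed (use z True in \<open>auto simp: lower_nb_def\<close>)
    then show ?thesis using True uv(1) by (auto simp: sg_diff_eq_iff)
  next
    case False
    then have "x < z" using x z by (metis linorder_neqE)
    have "v \<le> z"
      using uv(4)
    proof
      assume "v \<in> J"
      then show ?thesis using z \<open>x < z\<close> unfolding J_def sg_diff_eq_iff by (auto intro: less_imp_le)
    qed (use z \<open>x < z\<close> in \<open>auto simp: upper_nb_def\<close>)
    then show ?thesis using \<open>x < z\<close> uv(2) by (auto simp: sg_diff_eq_iff)
  qed
  then show ?thesis unfolding J_def by blast
qed

lemma lower_less_J: "lower_nb Z x z \<Longrightarrow> c \<in> J \<Longrightarrow> z < c"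
  unfolding lower_nb_def J_def sg_diff_eq_iff
  by (metis (mono_tags, lifting) linorder_neqE mem_Collect_eq not_less_iff_gr_or_eq)

lemma upper_greater_J: "upper_nb Z x z \<Longrightarrow> c \<in> J \<Longrightarrow> c < z"
  unfolding upper_nb_def J_def sg_diff_eq_iff
  by (metis (mono_tags, lifting) mem_Collect_eq)

lemma sg_diff_J:
  assumes "u < v" "u \<in> J \<or> lower_nb Z x u" "v \<in> J \<or> upper_nb Z x v"
  shows "sg (poly f v - poly f u) = s"
  using assms by (intro sg_poly_diff f' J_between[of u _ v])

text \<open>The values move away from \<open>poly f z\<close> in the direction \<open>s\<close>, so
  they cannot reach zero unless \<open>poly f z\<close> has the opposite sign.\<close>

lemma sg_J_low:
  assumes "lower_nb Z x z" "sg (poly f z) \<noteq> - s" "c \<in> J"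
  shows "sg (poly f c) = s"
  using sg_diff_J[of z c] lower_less_J[OF assms(1,3)] assms s
  by (auto simp: sg_def split: if_splits)

lemma sg_J_high:
  assumes "upper_nb Z x z" "sg (poly f z) \<noteq> s" "c \<in> J"
  shows "sg (poly f c) = - s"
  using sg_diff_J[of c z] upper_greater_J[OF assms(1,3)] assms s
  by (auto simp: sg_def split: if_splits)

text \<open>The hypotheses are vacuous at an end where the gap is unbounded; there a point far out
  supplies the required sign.\<close>

lemma root_in_J:
  assumes L: "\<And>z. lower_nb Z x z \<Longrightarrow> sg (poly f z) = - s"
    and U: "\<And>z. upper_nb Z x z \<Longrightarrow> sg (poly f z) = s"
  shows "\<exists>r\<in>J. poly f r = 0"
proof -
  have df: "pderiv f \<noteq> 0" using f'[OF x_in_J] s by auto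
  have "\<exists>u. (u \<in> J \<or> lower_nb Z x u) \<and> sg (poly f u) = - s \<and> u < x"
  proof (cases "{z\<in>Z. z < x} = {}")
    case True
    obtain u where u: "u < x" "sg (poly f u) = - sg (poly (pderiv f) u)"
      using sg_pderiv_at_bot[OF df] by blast
    have "sg (u - z) = sg (x - z)" if "z \<in> Z" for z
    proof -
      have "x < z" using that x True by (metis (mono_tags, lifting) empty_Collect_eq linorder_neqE)
      then show ?thesis using u by (auto simp: sg_diff_eq_iff)
    qed
    then have "u \<in> J" unfolding J_def by blast
    then show ?thesis using u f' by auto
  next
    case False
    then have "lower_nb Z x (Max {z\<in>Z. z < x})"
      using Max_in[of "{z\<in>Z. z < x}"] finX unfolding lower_nb_def by auto
    then show ?thesis using L lower_nb_def by blast
  qed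
  then obtain u where u: "u \<in> J \<or> lower_nb Z x u" "sg (poly f u) = - s" "u < x" by blast
  have "\<exists>v. (v \<in> J \<or> upper_nb Z x v) \<and> sg (poly f v) = s \<and> x < v"
  proof (cases "{z\<in>Z. x < z} = {}")
    case True
    obtain v where v: "x < v" "sg (poly f v) = sg (poly (pderiv f) v)"
      using sg_pderiv_at_top[OF df] by blast
    have "sg (v - z) = sg (x - z)" if "z \<in> Z" for z
    proof -
      have "z < x" using that x True by (metis (mono_tags, lifting) empty_Collect_eq linorder_neqE)
      then show ?thesis using v by (auto simp: sg_diff_eq_iff)
    qed
    then have "v \<in> J" unfolding J_def by blast
    then show ?thesis using v f' by auto
  next
    case False
    then have "upper_nb Z x (Min {z\<in>Z. x < z})"
      using Min_in[of "{z\<in>Z. x < z}"] finX unfolding upper_nb_def by auto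
    then show ?thesis using U upper_nb_def by blast
  qed
  then obtain v where v: "v \<in> J \<or> upper_nb Z x v" "sg (poly f v) = s" "x < v" by blast
  have "\<exists>r>u. r < v \<and> poly f r = 0"
    using u v s by (intro poly_ivt) auto
  then show ?thesis using J_between u v by blast
qed

lemma sg_J_root:
  assumes "r \<in> J" "poly f r = 0" "c \<in> J"
  shows "sg (poly f c) = s * sg (c - r)"
  using sg_diff_J[of r c] sg_diff_J[of c r] assms sg_minus[of "poly f c"]
  by (cases r c rule: linorder_cases) (auto simp: sg_def[of "c - r"])

end

text \<open>As the derivative belongs to the family, \<open>f\<close> is strictly monotone on every
  gap between old roots and acquires at most one root there. Whether it does is decided by its signs
  at the ends of the gap, or near infinity by the sign of the derivative, and all of these agree
  with those of \<open>g\<close>.\<close>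

lemma matches_insert:
  fixes F :: "('a::real_closed poly \<times> 'b::real_closed poly) set"
  assumes fin: "finite F" and m0: "matches F h"
    and d: "(pderiv f, pderiv g) \<in> F" "pderiv f \<noteq> 0"
    and sgn: "\<And>z. z \<in> rts1 F \<Longrightarrow> sg (poly f z) = sg (poly g (h z))"
  shows "\<exists>h'. matches (insert (f, g) F) h'"
proof -
  define Z where "Z = rts1 F"
  define Y where "Y = rts2 F"
  have finX: "finite Z" unfolding Z_def by (rule finite_rts1[OF fin])
  note m = matchesD[OF m0, folded Z_def]
  have Y: "Y = h ` Z" using m(2) unfolding Y_def by simp
  have finY: "finite Y" using Y finX by simp
  have fg: "f \<noteq> 0" "g \<noteq> 0" using d matches_nonzero[OF fin m0 d(1)] by auto
  define J where "J x = {c. \<forall>z\<in>Z. sg (c - z) = sg (x - z)}" for x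
  define J' where "J' y = {c. \<forall>z\<in>Y. sg (c - z) = sg (y - z)}" for y
  have xJ: "x \<in> J x" "y \<in> J' y" for x y unfolding J_def J'_def by auto
  have cellJ: "cell Z h c y \<longleftrightarrow> c \<in> J x" "cell Z h x d \<longleftrightarrow> d \<in> J' y" if "cell Z h x y" for x y c d
    using that unfolding cell_def J_def J'_def Y by auto
  have notin: "x \<notin> Z \<longleftrightarrow> y \<notin> Y" if "cell Z h x y" for x y
    using that unfolding cell_def Y sg_diff_eq_iff by (auto simp: image_iff)
  have J: "\<exists>s. s \<noteq> 0 \<and> (\<forall>c\<in>J x. sg (poly (pderiv f) c) = s) \<and> (\<forall>c\<in>J' y. sg (poly (pderiv g) c) = s)"
    if c: "cell Z h x y" and x: "x \<notin> Z" for x y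
  proof (intro exI conjI ballI)
    show "sg (poly (pderiv f) x) \<noteq> 0" using x d unfolding Z_def rts1_def by auto
    have e: "sg (poly (pderiv f) x) = sg (poly (pderiv g) y)" by (rule m(3)[OF c d(1)])
    show "sg (poly (pderiv f) c) = sg (poly (pderiv f) x)" if "c \<in> J x" for c
      unfolding e using that cellJ[OF c] m(3) d(1) by blast
    show "sg (poly (pderiv g) c) = sg (poly (pderiv f) x)" if "c \<in> J' y" for c
      using that cellJ[OF c] m(3) d(1) by metis
  qed
  have lowhX: "lower_nb Y y (h z) \<longleftrightarrow> lower_nb Z x z" "upper_nb Y y (h z) \<longleftrightarrow> upper_nb Z x z"
    if c: "cell Z h x y" and z: "z \<in> Z" for x y z
  proof -
    have e: "h z' \<le> h z \<longleftrightarrow> z' \<le> z" "h z \<le> h z' \<longleftrightarrow> z \<le> z'" if "z' \<in> Z" for z'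
      using strict_mono_on_less_eq[OF m(1)] that z by blast+
    have c': "z' < x \<longleftrightarrow> h z' < y" "x < z' \<longleftrightarrow> y < h z'" if "z' \<in> Z" for z'
      using c that unfolding cell_def sg_diff_eq_iff by (auto simp: not_less_iff_gr_or_eq)
    show "lower_nb Y y (h z) \<longleftrightarrow> lower_nb Z x z" "upper_nb Y y (h z) \<longleftrightarrow> upper_nb Z x z"
      unfolding lower_nb_def upper_nb_def Y using z e c' by auto
  qed
  \<comment> \<open>In corresponding gaps either both polynomials have a root and change sign there
    in the same direction, or both keep the same nonzero sign.\<close>
  have key: "(\<exists>s r t. s \<noteq> 0 \<and> r \<in> J x \<and> t \<in> J' y \<and> poly f r = 0 \<and> poly g t = 0 \<and>
        (\<forall>c\<in>J x. sg (poly f c) = s * sg (c - r)) \<and> (\<forall>c\<in>J' y. sg (poly g c) = s * sg (c - t)))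
      \<or> (\<exists>s. s \<noteq> 0 \<and> (\<forall>c\<in>J x. sg (poly f c) = s) \<and> (\<forall>c\<in>J' y. sg (poly g c) = s))"
    if c: "cell Z h x y" and x: "x \<notin> Z" for x y
  proof -
    have y: "y \<notin> Y" using notin c x by blast
    obtain s where s: "s \<noteq> 0" "\<And>c. c \<in> J x \<Longrightarrow> sg (poly (pderiv f) c) = s"
      "\<And>c. c \<in> J' y \<Longrightarrow> sg (poly (pderiv g) c) = s"
      using J[OF c x] by blast
    consider (low) z where "z \<in> Z" "lower_nb Z x z" "sg (poly f z) \<noteq> - s"
      | (high) z where "z \<in> Z" "upper_nb Z x z" "sg (poly f z) \<noteq> s"
      | (root) "\<And>z. lower_nb Z x z \<Longrightarrow> sg (poly f z) = - s" "\<And>z. upper_nb Z x z \<Longrightarrow> sg (poly f z) = s"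
      unfolding lower_nb_def upper_nb_def by blast
    then show ?thesis
    proof cases
      case low
      then have "sg (poly g (h z)) \<noteq> - s" using sgn[of z] unfolding Z_def by simp
      then have "\<forall>c\<in>J' y. sg (poly g c) = s"
        using sg_J_low[OF finY y s(1) s(3)[unfolded J'_def], of "h z"] lowhX[OF c low(1)] low
        unfolding J'_def by blast
      moreover have "\<forall>c\<in>J x. sg (poly f c) = s"
        using sg_J_low[OF finX x s(1) s(2)[unfolded J_def], of z] low unfolding J_def by blast
      ultimately show ?thesis using s(1) by blast
    next
      case high
      then have "sg (poly g (h z)) \<noteq> s" using sgn[of z] unfolding Z_def by simp
      then have "\<forall>c\<in>J' y. sg (poly g c) = - s"
        using sg_J_high[OF finY y s(1) s(3)[unfolded J'_def], of "h z"] lowhX[OF c high(1)] high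
        unfolding J'_def by blast
      moreover have "\<forall>c\<in>J x. sg (poly f c) = - s"
        using sg_J_high[OF finX x s(1) s(2)[unfolded J_def], of z] high unfolding J_def by blast
      ultimately show ?thesis using s(1) by (metis neg_equal_0_iff_equal)
    next
      case root
      have rg: "sg (poly g w) = - s" if w: "lower_nb Y y w" for w
      proof -
        obtain z where "z \<in> Z" "w = h z" using w unfolding lower_nb_def Y by blast
        then show ?thesis using root(1)[of z] lowhX[OF c] w sgn[of z] unfolding Z_def by auto
      qed
      have rg': "sg (poly g w) = s" if w: "upper_nb Y y w" for w
      proof -
        obtain z where "z \<in> Z" "w = h z" using w unfolding upper_nb_def Y by blast
        then show ?thesis using root(2)[of z] lowhX[OF c] w sgn[of z] unfolding Z_def by auto
      qed
      obtain r where r: "r \<in> J x" "poly f r = 0"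
        using root_in_J[OF finX x s(1) s(2)[unfolded J_def] root] unfolding J_def by blast
      obtain t where t: "t \<in> J' y" "poly g t = 0"
        using root_in_J[OF finY y s(1) s(3)[unfolded J'_def] rg rg'] unfolding J'_def by blast
      have "\<forall>c\<in>J x. sg (poly f c) = s * sg (c - r)"
        using sg_J_root[OF finX x s(1) s(2)[unfolded J_def], of r] r unfolding J_def by blast
      moreover have "\<forall>c\<in>J' y. sg (poly g c) = s * sg (c - t)"
        using sg_J_root[OF finY y s(1) s(3)[unfolded J'_def], of t] t unfolding J'_def by blast
      ultimately show ?thesis using s(1) r t by blast
    qed
  qed
  have ug: "t = t'" if "cell Z h x t" "cell Z h x t'" "x \<notin> Z" "poly g t = 0" "poly g t' = 0" for x t t'
    using key[OF that(1,3)] that(2,4,5) cellJ(2)[OF that(1)] xJ(2)[of t] by (smt (verit) mult_eq_0_iff right_minus_eq sg_eq_0_iff sg_0)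
  have uf: "r = r'" if "cell Z h r y" "cell Z h r' y" "r \<notin> Z" "poly f r = 0" "poly f r' = 0" for r r' y
    using key[OF that(1,3)] that(2,4,5) cellJ(1)[OF that(1)] xJ(1)[of r] by (smt (verit) mult_eq_0_iff right_minus_eq sg_eq_0_iff sg_0)
  have exg: "\<exists>t. cell Z h r t \<and> poly g t = 0" if "r \<notin> Z" "poly f r = 0" for r
  proof -
    obtain y where y: "cell Z h r y" using cell_ex[OF finX m(1)] by blast
    show ?thesis using key[OF y that(1)] cellJ(2)[OF y] xJ(1)[of r] that(2) by (metis sg_0)
  qed
  have exf: "\<exists>r. cell Z h r t \<and> poly f r = 0" if "t \<notin> Y" "poly g t = 0" for t
  proof -
    obtain x where x: "cell Z h x t" using cell_ex'[OF finX m(1)] by blast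
    then have "x \<notin> Z" using notin that by blast
    show ?thesis using key[OF x \<open>x \<notin> Z\<close>] cellJ(1)[OF x] xJ(2)[of t] that(2) by (metis sg_0)
  qed
  \<comment> \<open>Old roots keep their partner; a new root of \<open>f\<close> is sent to the root
    of \<open>g\<close> in the corresponding gap, which is unique by \<open>ug\<close>.\<close>
  define h' where "h' x = (if x \<in> Z then h x else SOME t. cell Z h x t \<and> poly g t = 0)" for x
  have h'Z: "h' x = h x" if "x \<in> Z" for x using that by (simp add: h'_def)
  have h'r: "cell Z h r (h' r)" "poly g (h' r) = 0" if "r \<notin> Z" "poly f r = 0" for r
    using someI_ex[OF exg[OF that]] that(1) by (simp_all add: h'_def)
  define Z' where "Z' = rts1 (insert (f, g) F)"
  have Z': "Z' = Z \<union> {x. poly f x = 0}" using fg unfolding Z'_def Z_def rts1_def by auto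
  have Y': "rts2 (insert (f, g) F) = Y \<union> {x. poly g x = 0}" using fg unfolding Y_def rts2_def by auto
  have mono: "strict_mono_on Z' h'"
  proof (rule strict_mono_onI)
    fix a b assume ab: "a \<in> Z'" "b \<in> Z'" "a < b"
    have hz: "z < h' r \<longleftrightarrow> x < r" "h' r < z \<longleftrightarrow> r < x" if "r \<notin> Z" "poly f r = 0" "z = h x" "x \<in> Z" for r z x
      using h'r(1)[OF that(1,2)] that(3,4) unfolding cell_def sg_diff_eq_iff
      by (metis linorder_neqE not_less_iff_gr_or_eq)+
    consider "a \<in> Z" "b \<in> Z" | "a \<in> Z" "b \<notin> Z" | "a \<notin> Z" "b \<in> Z" | "a \<notin> Z" "b \<notin> Z" by blast
    then show "h' a < h' b"
    proof cases
      case 1 then show ?thesis using ab strict_mono_onD[OF m(1)] h'Z by auto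
    next
      case 2 then show ?thesis using ab hz[of b "h a" a] h'Z Z' by auto
    next
      case 3 then show ?thesis using ab hz[of a "h b" b] h'Z Z' by auto
    next
      case 4
      then have r: "poly f a = 0" "poly f b = 0" using ab Z' by auto
      \<comment> \<open>Two new roots cannot share a gap, so an old root separates them, and its
        image separates their images in the same order.\<close>
      have "\<not> (\<forall>z\<in>Z. sg (a - z) = sg (b - z))"
      proof
        assume e: "\<forall>z\<in>Z. sg (a - z) = sg (b - z)"
        then have "cell Z h b (h' a)" using h'r(1)[OF 4(1) r(1)] unfolding cell_def by auto
        then show False using uf[OF h'r(1)[OF 4(1) r(1)] _ 4(1) r] ab by blast
      qed
      then obtain z where z: "z \<in> Z" "sg (a - z) \<noteq> sg (b - z)" by blast
      then have "a < z" "z < b" using 4 ab by (auto simp: sg_diff_eq_iff not_less_iff_gr_or_eq intro: less_trans)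
      then show ?thesis using hz[OF 4(1) r(1) refl z(1)] hz[OF 4(2) r(2) refl z(1)] by auto
    qed
  qed
  have img: "h' ` Z' = rts2 (insert (f, g) F)"
  proof (intro equalityI subsetI)
    fix w assume "w \<in> h' ` Z'"
    then show "w \<in> rts2 (insert (f, g) F)" unfolding Y' Z' using h'Z h'r Y by auto
  next
    fix w assume "w \<in> rts2 (insert (f, g) F)"
    then consider "w \<in> Y" | "w \<notin> Y" "poly g w = 0" unfolding Y' by blast
    then show "w \<in> h' ` Z'"
    proof cases
      case 1 then show ?thesis unfolding Y Z' using h'Z by force
    next
      case 2
      then obtain r where r: "cell Z h r w" "poly f r = 0" using exf by blast
      then have "r \<notin> Z" using notin 2 by blast
      then have "h' r = w" using ug[OF h'r(1) r(1)] r h'r(2) 2 by blast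
      then show ?thesis unfolding Z' using r by blast
    qed
  qed
  have "sg (poly f x) = sg (poly g y) \<and> (\<forall>(p, q)\<in>F. sg (poly p x) = sg (poly q y))" if c': "cell Z' h' x y" for x y
  proof
    have c: "cell Z h x y" using c' h'Z unfolding cell_def Z' by auto
    show "\<forall>(p, q)\<in>F. sg (poly p x) = sg (poly q y)" using m(3)[OF c] by blast
    show "sg (poly f x) = sg (poly g y)"
    proof (cases "x \<in> Z")
      case True
      then have "y = h x" using c cell_mem[OF m(1)] by blast
      then show ?thesis using sgn True unfolding Z_def by blast
    next
      case False
      from key[OF c this] show ?thesis
      proof (elim disjE exE conjE)
        fix s r t assume *: "s \<noteq> 0" "r \<in> J x" "t \<in> J' y" "poly f r = 0" "poly g t = 0"
          "\<forall>c\<in>J x. sg (poly f c) = s * sg (c - r)" "\<forall>c\<in>J' y. sg (poly g c) = s * sg (c - t)"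
        have ry: "cell Z h r y" using cellJ(1)[OF c] * by blast
        then have "r \<notin> Z" using notin[OF ry] notin[OF c] False by blast
        have "cell Z h r t" using cellJ(2)[OF c] * ry unfolding cell_def J'_def Y by auto
        then have "h' r = t" using ug h'r[OF \<open>r \<notin> Z\<close>] * \<open>r \<notin> Z\<close> by blast
        then have "sg (x - r) = sg (y - t)" using c' *(4) unfolding cell_def Z' by blast
        then show ?thesis using * xJ by auto
      qed (use xJ in auto)
    qed
  qed
  then show ?thesis
    using mono img unfolding matches_def Z'_def by (intro exI[of _ h']) auto
qed

section \<open>Elimination of one variable\<close>

definition ringhom :: "('a::comm_ring_1 \<Rightarrow> 'b::comm_ring_1) \<Rightarrow> bool" where
  "ringhom \<phi> \<longleftrightarrow> \<phi> 1 = 1 \<and> (\<forall>a b. \<phi> (a + b) = \<phi> a + \<phi> b) \<and> (\<forall>a b. \<phi> (a * b) = \<phi> a * \<phi> b)"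

lemma ringhomD:
  assumes "ringhom \<phi>"
  shows "\<phi> 1 = 1" "\<phi> (a + b) = \<phi> a + \<phi> b" "\<phi> (a * b) = \<phi> a * \<phi> b"
    "\<phi> 0 = 0" "\<phi> (- a) = - \<phi> a" "\<phi> (a - b) = \<phi> a - \<phi> b" "\<phi> (of_nat n) = of_nat n"
    "\<phi> (a ^ n) = \<phi> a ^ n" "\<phi> (sum f A) = (\<Sum>i\<in>A. \<phi> (f i))" "\<phi> (prod f A) = (\<Prod>i\<in>A. \<phi> (f i))"
proof -
  show h: "\<phi> 1 = 1" "\<phi> (a + b) = \<phi> a + \<phi> b" "\<phi> (a * b) = \<phi> a * \<phi> b" for a b
    using assms unfolding ringhom_def by blast+
  show z: "\<phi> 0 = 0" using h(2)[of 0 0] by simp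
  show m: "\<phi> (- a) = - \<phi> a" for a using h(2)[of a "- a"] z by (simp add: eq_neg_iff_add_eq_0 add.commute)
  show "\<phi> (a - b) = \<phi> a - \<phi> b" using h(2)[of a "- b"] m by simp
  show "\<phi> (of_nat n) = of_nat n" by (induction n) (simp_all add: h z)
  show "\<phi> (a ^ n) = \<phi> a ^ n" by (induction n) (simp_all add: h)
  show "\<phi> (sum f A) = (\<Sum>i\<in>A. \<phi> (f i))"
    by (induction A rule: infinite_finite_induct) (simp_all add: h z)
  show "\<phi> (prod f A) = (\<Prod>i\<in>A. \<phi> (f i))"
    by (induction A rule: infinite_finite_induct) (simp_all add: h)
qed

text \<open>\<^const>\<open>pderiv\<close> is not available over rings with zero divisors.\<close>

definition formal_deriv :: "'a::comm_ring_1 poly \<Rightarrow> 'a poly" where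
  "formal_deriv p = (\<Sum>k<degree p. monom (of_nat (Suc k) * coeff p (Suc k)) k)"

lemma coeff_formal_deriv: "coeff (formal_deriv p) n = of_nat (Suc n) * coeff p (Suc n)"
proof -
  have "coeff (formal_deriv p) n = (\<Sum>k<degree p. if k = n then of_nat (Suc k) * coeff p (Suc k) else 0)"
    by (simp add: formal_deriv_def coeff_sum)
  also have "\<dots> = of_nat (Suc n) * coeff p (Suc n)"
    by (auto simp: coeff_eq_0)
  finally show ?thesis .
qed

lemma map_poly_ringhom:
  assumes h: "ringhom \<phi>"
  shows "map_poly \<phi> (p + q) = map_poly \<phi> p + map_poly \<phi> q"
    "map_poly \<phi> (p * q) = map_poly \<phi> p * map_poly \<phi> q"
    "map_poly \<phi> (smult c p) = smult (\<phi> c) (map_poly \<phi> p)"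
    "map_poly \<phi> (monom c n) = monom (\<phi> c) n"
    "map_poly \<phi> (formal_deriv p) = formal_deriv (map_poly \<phi> p)"
    "map_poly \<phi> (- p) = - map_poly \<phi> p"
    "map_poly \<phi> (p - q) = map_poly \<phi> p - map_poly \<phi> q"
  by (rule poly_eqI; simp add: coeff_map_poly ringhomD[OF h] coeff_mult coeff_formal_deriv)+

lemma formal_deriv_eq_pderiv:
  "formal_deriv p = pderiv (p :: 'a::{comm_ring_1,semiring_no_zero_divisors} poly)"
  by (rule poly_eqI) (simp add: coeff_formal_deriv coeff_pderiv)

lemma ringhom_poly_map_poly:
  assumes h: "ringhom \<phi>"
  shows "\<phi> (poly p a) = poly (map_poly \<phi> p) (\<phi> a)"
  by (induction p) (simp_all add: map_poly_pCons ringhomD[OF h])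

lemma matches_constants:
  assumes "\<And>p q. (p, q) \<in> F \<Longrightarrow> \<exists>a b. p = [:a:] \<and> q = [:b:] \<and> sg a = sg b"
  shows "\<exists>h. matches F h"
proof -
  have "rts1 F = {}" "rts2 F = {}"
    unfolding rts1_def rts2_def using assms by fastforce+
  then show ?thesis using assms unfolding matches_def strict_mono_on_def by fastforce
qed

lemma matches_insert_constant:
  assumes "matches F h" "sg a = sg b"
  shows "matches (insert ([:a:], [:b:]) F) h"
proof -
  have "rts1 (insert ([:a:], [:b:]) F) = rts1 F" "rts2 (insert ([:a:], [:b:]) F) = rts2 F"
    unfolding rts1_def rts2_def by auto
  then show ?thesis using assms unfolding matches_def by auto
qed

text \<open>An even power of the leading coefficient is positive wherever that coefficient is
  nonzero. At a root of \<open>g\<close> the polynomial \<open>f\<close> then has the sign of the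
  remainder.\<close>

lemma pseudo_division_even:
  fixes f g :: "'a::comm_ring_1 poly"
  assumes "g \<noteq> 0"
  shows "\<exists>k q r. smult ((lead_coeff g ^ k)\<^sup>2) f = g * q + r \<and> (r = 0 \<or> degree r < degree g)"
proof -
  obtain q r where qr: "pseudo_divmod f g = (q, r)" by (cases "pseudo_divmod f g") auto
  define k where "k = Suc (degree f) - degree g"
  have 1: "smult (lead_coeff g ^ k) f = g * q + r" "r = 0 \<or> degree r < degree g"
    using pseudo_divmod[OF assms qr] unfolding k_def by auto
  have "smult ((lead_coeff g ^ k)\<^sup>2) f = smult (lead_coeff g ^ k) (smult (lead_coeff g ^ k) f)"
    by (simp add: power2_eq_square)
  also have "\<dots> = g * smult (lead_coeff g ^ k) q + smult (lead_coeff g ^ k) r"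
    unfolding 1 by (simp add: smult_add_right)
  finally show ?thesis using 1(2) degree_smult_le[of "lead_coeff g ^ k" r]
    by (metis le_less_trans smult_0_right)
qed

section \<open>Sign tables along a filter of specializations of the coefficients\<close>

context
  fixes \<phi> :: "'x \<Rightarrow> 'c::comm_ring_1 \<Rightarrow> 'a::real_closed" and \<psi> :: "'c \<Rightarrow> 'b::real_closed"
    and \<Phi> :: "'x filter"
  assumes \<phi>: "\<And>x. ringhom (\<phi> x)" and \<psi>: "ringhom \<psi>"
    and sg_ev: "\<And>a. \<forall>\<^sub>F x in \<Phi>. sg (\<phi> x a) = sg (\<psi> a)"
begin

text \<open>The same polynomial under a varying homomorphism and under the limiting one. A sign
  table depends on finitely many signs of coefficients; the filter expresses that enough of these
  signs agree without recording which ones.\<close>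

definition img_pair :: "'x \<Rightarrow> 'c poly \<Rightarrow> 'a poly \<times> 'b poly" where
  "img_pair x f = (map_poly (\<phi> x) f, map_poly \<psi> f)"

text \<open>A leading coefficient killed by \<open>\<psi>\<close> has sign \<open>0\<close>, so it
  is eventually killed by \<open>\<phi> x\<close> too, and dropping its monomial changes neither
  image.\<close>

lemma truncate_vanishing_lead:
  "\<exists>t. degree t \<le> degree g \<and> (t = 0 \<or> \<psi> (lead_coeff t) \<noteq> 0) \<and>
    map_poly \<psi> t = map_poly \<psi> g \<and> (\<forall>\<^sub>F x in \<Phi>. img_pair x t = img_pair x g)"
proof (induction "degree g" arbitrary: g rule: less_induct)
  case less
  show ?case
  proof (cases "g = 0 \<or> \<psi> (lead_coeff g) \<noteq> 0")
    case True
    then show ?thesis by (intro exI[of _ g]) auto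
  next
    case False
    then have g: "g \<noteq> 0" "\<psi> (lead_coeff g) = 0" by auto
    define g' where "g' = g - monom (lead_coeff g) (degree g)"
    have ev: "\<forall>\<^sub>F x in \<Phi>. img_pair x g' = img_pair x g"
      using sg_ev[of "lead_coeff g"]
      by eventually_elim (simp add: img_pair_def g'_def map_poly_ringhom \<phi> \<psi> g)
    have ev': "map_poly \<psi> g' = map_poly \<psi> g"
      by (simp add: g'_def map_poly_ringhom \<psi> g)
    have "coeff g' (degree g) = 0" by (simp add: g'_def)
    moreover have "degree g' \<le> degree g"
      unfolding g'_def by (intro degree_diff_le degree_monom_le) simp
    ultimately consider "g' = 0" | "degree g' < degree g"
      by (metis leading_coeff_0_iff le_neq_implies_less)
    then show ?thesis
    proof cases
      case 1
      then show ?thesis using ev ev' by (intro exI[of _ 0]) auto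
    next
      case 2
      from less[OF 2] obtain t where t: "degree t \<le> degree g'" "t = 0 \<or> \<psi> (lead_coeff t) \<noteq> 0"
        "\<forall>\<^sub>F x in \<Phi>. img_pair x t = img_pair x g'" "map_poly \<psi> t = map_poly \<psi> g'" by blast
      have "\<forall>\<^sub>F x in \<Phi>. img_pair x t = img_pair x g"
        using t(3) ev by eventually_elim simp
      then show ?thesis using t 2 ev' by (intro exI[of _ t]) auto
    qed
  qed
qed

text \<open>Unlike the degree, it separates the zero polynomial from the nonzero constants, so that
  replacing a constant by zero counts as progress.\<close>

definition psize :: "'c poly \<Rightarrow> nat" where
  "psize f = (if f = 0 then 0 else Suc (degree f))"

text \<open>\<open>f\<close> is traded for its derivative and its remainders modulo the members of
  \<open>F1\<close>, all of smaller degree. At a root of a member, the sign of \<open>f\<close> is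
  the sign of the corresponding remainder, and this is what the insertion of \<open>f\<close> into
  the table requires.\<close>

lemma eventually_matches_step:
  assumes F: "finite F" "f \<notin> F" and lc: "\<psi> (lead_coeff f) \<noteq> 0" and deg: "degree f > 0"
    and le: "\<And>g. g \<in> F \<Longrightarrow> degree g \<le> degree f"
    and IH: "\<And>R. finite R \<Longrightarrow> (\<And>r. r \<in> R \<Longrightarrow> r = 0 \<or> degree r < degree f) \<Longrightarrow>
      \<forall>\<^sub>F x in \<Phi>. \<exists>h. matches (img_pair x ` (F \<union> R)) h"
  shows "\<forall>\<^sub>F x in \<Phi>. \<exists>h. matches (img_pair x ` insert f F) h"
proof -
  define F1 where "F1 = insert (formal_deriv f) F"
  have "\<forall>g. \<exists>t. degree t \<le> degree g \<and> (t = 0 \<or> \<psi> (lead_coeff t) \<noteq> 0) \<and> (\<forall>\<^sub>F x in \<Phi>. img_pair x t = img_pair x g)"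
    using truncate_vanishing_lead by blast
  then obtain T where T: "\<And>g. degree (T g) \<le> degree g" "\<And>g. T g = 0 \<or> \<psi> (lead_coeff (T g)) \<noteq> 0"
    "\<And>g. \<forall>\<^sub>F x in \<Phi>. img_pair x (T g) = img_pair x g" by metis
  have "\<forall>g. \<exists>k q r. g \<noteq> 0 \<longrightarrow> smult ((lead_coeff g ^ k)\<^sup>2) f = g * q + r \<and> (r = 0 \<or> degree r < degree g)"
    using pseudo_division_even by metis
  then obtain K Q R where R: "\<And>g. g \<noteq> 0 \<Longrightarrow> smult ((lead_coeff g ^ K g)\<^sup>2) f = g * Q g + R g"
    "\<And>g. g \<noteq> 0 \<Longrightarrow> R g = 0 \<or> degree (R g) < degree g" by metis
  define RS where "RS = insert (formal_deriv f) ((\<lambda>g. R (T g)) ` {g \<in> F1. T g \<noteq> 0})"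
  have finF1: "finite F1" using F unfolding F1_def by simp
  have dd: "degree (formal_deriv f) < degree f"
  proof -
    have "degree (formal_deriv f) \<le> degree f - 1"
      by (rule degree_le) (auto simp: coeff_formal_deriv coeff_eq_0)
    then show ?thesis using deg by linarith
  qed
  have leF1: "degree g \<le> degree f" if "g \<in> F1" for g
    using that le dd unfolding F1_def by auto
  have RSdeg: "r = 0 \<or> degree r < degree f" if "r \<in> RS" for r
    using that dd R(2) T(1) leF1 unfolding RS_def by (auto) (meson le_less_trans le_trans less_le_trans)+
  have sub: "F1 \<subseteq> F \<union> RS" unfolding F1_def RS_def by auto
  have "\<forall>\<^sub>F x in \<Phi>. \<exists>h. matches (img_pair x ` (F \<union> RS)) h"
    using RSdeg by (intro IH) (auto simp: RS_def finF1)
  moreover have "\<forall>\<^sub>F x in \<Phi>. \<forall>g\<in>F1. img_pair x (T g) = img_pair x g"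
    using T(3) by (intro eventually_ball_finite finF1) auto
  moreover have "\<forall>\<^sub>F x in \<Phi>. \<forall>g\<in>F1. sg (\<phi> x (lead_coeff (T g))) = sg (\<psi> (lead_coeff (T g)))"
    using sg_ev by (intro eventually_ball_finite finF1) auto
  moreover have "\<forall>\<^sub>F x in \<Phi>. sg (\<phi> x (lead_coeff f)) = sg (\<psi> (lead_coeff f))" by (rule sg_ev)
  ultimately show ?thesis
  proof eventually_elim
    case (elim x)
    then obtain h where h: "matches (img_pair x ` (F \<union> RS)) h" by blast
    have fin: "finite (img_pair x ` (F \<union> RS))" using F finF1 unfolding RS_def by simp
    \<comment> \<open>The remainders have served to give signs at the roots of \<open>F1\<close>.
      They are discarded before \<open>f\<close> is inserted, since at their own roots the sign of
      \<open>f\<close> is not determined.\<close>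
    have h1: "matches (img_pair x ` F1) h"
      by (rule matches_subset[OF fin h]) (use sub in blast)
    have pd: "img_pair x (formal_deriv f) = (pderiv (map_poly (\<phi> x) f), pderiv (map_poly \<psi> f))"
      unfolding img_pair_def by (simp add: map_poly_ringhom \<phi> \<psi> formal_deriv_eq_pderiv)
    have lcx: "\<phi> x (lead_coeff f) \<noteq> 0" using elim(4) lc by (metis sg_eq_0_iff)
    have "coeff (pderiv (map_poly (\<phi> x) f)) (degree f - 1) = of_nat (degree f) * \<phi> x (lead_coeff f)"
      using deg by (simp add: coeff_pderiv coeff_map_poly ringhomD[OF \<phi>])
    then have pnz: "pderiv (map_poly (\<phi> x) f) \<noteq> 0" using lcx deg by (metis coeff_0 mult_eq_0_iff of_nat_eq_0_iff neq0_conv)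
    have "\<exists>h'. matches (insert (map_poly (\<phi> x) f, map_poly \<psi> f) (img_pair x ` F1)) h'"
    proof (rule matches_insert[OF _ h1])
      show "finite (img_pair x ` F1)" using finF1 by simp
      show "(pderiv (map_poly (\<phi> x) f), pderiv (map_poly \<psi> f)) \<in> img_pair x ` F1"
        unfolding pd[symmetric] F1_def by blast
      show "pderiv (map_poly (\<phi> x) f) \<noteq> 0" by (rule pnz)
      fix z assume "z \<in> rts1 (img_pair x ` F1)"
      then obtain g where g: "g \<in> F1" "map_poly (\<phi> x) g \<noteq> 0" "poly (map_poly (\<phi> x) g) z = 0"
        unfolding rts1_def img_pair_def by auto
      have z: "z \<in> rts1 (img_pair x ` F1)" "z \<in> rts1 (img_pair x ` (F \<union> RS))"
        using g sub unfolding rts1_def img_pair_def by blast+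
      have gh: "poly (map_poly \<psi> g) (h z) = 0"
        using matches_at_root[OF h1 z(1), of "map_poly (\<phi> x) g" "map_poly \<psi> g"] g
        unfolding img_pair_def by auto
      have tg: "map_poly (\<phi> x) (T g) = map_poly (\<phi> x) g" "map_poly \<psi> (T g) = map_poly \<psi> g"
        using elim(2) g(1) unfolding img_pair_def by auto
      then have t0: "T g \<noteq> 0" using g(2) by auto
      define c where "c = lead_coeff (T g) ^ K (T g)"
      have lt: "\<psi> (lead_coeff (T g)) \<noteq> 0" using T(2)[of g] t0 by blast
      have c1: "\<psi> c \<noteq> 0" using lt unfolding c_def ringhomD[OF \<psi>] by simp
      have lt': "\<phi> x (lead_coeff (T g)) \<noteq> 0" using elim(3) g(1) lt by (metis sg_eq_0_iff)
      have c2: "\<phi> x c \<noteq> 0" using lt' unfolding c_def ringhomD[OF \<phi>] by simp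
      have eq: "smult (c\<^sup>2) f = T g * Q (T g) + R (T g)" using R(1)[OF t0] unfolding c_def .
      have e1: "(\<phi> x c)\<^sup>2 * poly (map_poly (\<phi> x) f) z = poly (map_poly (\<phi> x) (R (T g))) z"
        using arg_cong[OF eq, of "\<lambda>p. poly (map_poly (\<phi> x) p) z"] g(3)
        by (simp add: map_poly_ringhom \<phi> ringhomD[OF \<phi>] tg)
      have e2: "(\<psi> c)\<^sup>2 * poly (map_poly \<psi> f) (h z) = poly (map_poly \<psi> (R (T g))) (h z)"
        using arg_cong[OF eq, of "\<lambda>p. poly (map_poly \<psi> p) (h z)"] gh
        by (simp add: map_poly_ringhom \<psi> ringhomD[OF \<psi>] tg)
      have "R (T g) \<in> RS" unfolding RS_def using g(1) t0 by blast
      then have "sg (poly (map_poly (\<phi> x) (R (T g))) z) = sg (poly (map_poly \<psi> (R (T g))) (h z))"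
        using matches_at_root[OF h z(2)] unfolding img_pair_def by blast
      moreover have "sg ((\<phi> x c)\<^sup>2) = 1" "sg ((\<psi> c)\<^sup>2) = 1" using c1 c2 unfolding sg_eq_1_iff by simp_all
      ultimately show "sg (poly (map_poly (\<phi> x) f) z) = sg (poly (map_poly \<psi> f) (h z))"
        unfolding e1[symmetric] e2[symmetric] sg_mult by simp
    qed
    then obtain h' where h': "matches (img_pair x ` insert f F1) h'" by (auto simp: img_pair_def)
    have "matches (img_pair x ` insert f F) h'"
      by (rule matches_subset[OF _ h']) (use finF1 F1_def in auto)
    then show ?case by blast
  qed
qed

text \<open>A lexicographic induction, outside on the largest size and inside on the number of
  members of that size. One largest member at a time is replaced by polynomials that may be numerous
  but are all smaller.\<close>

lemma eventually_matches_psize: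
  assumes "finite F" "\<And>f. f \<in> F \<Longrightarrow> psize f \<le> n"
  shows "\<forall>\<^sub>F x in \<Phi>. \<exists>h. matches (img_pair x ` F) h"
  using assms
proof (induction n arbitrary: F)
  case 0
  then have "\<And>f. f \<in> F \<Longrightarrow> f = 0" unfolding psize_def by (metis Suc_neq_Zero le_zero_eq)
  then have "\<exists>h. matches (img_pair x ` F) h" for x
    by (intro matches_constants) (force simp: img_pair_def)
  then show ?case by simp
next
  case (Suc n)
  note outer = Suc.IH
  show ?case using Suc.prems
  proof (induction "card {f \<in> F. psize f = Suc n}" arbitrary: F)
    case 0
    then have "\<And>f. f \<in> F \<Longrightarrow> psize f \<noteq> Suc n" by auto
    then show ?case using 0 by (intro outer) (auto simp: le_Suc_eq)
  next
    case (Suc k)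
    then obtain f where f: "f \<in> F" "psize f = Suc n"
      by (metis (mono_tags, lifting) card.empty empty_Collect_eq nat.distinct(1))
    then have fn: "f \<noteq> 0" "degree f = n" unfolding psize_def by (auto split: if_splits)
    define F0 where "F0 = F - {f}"
    have F0: "finite F0" "f \<notin> F0" "F = insert f F0" "\<And>g. g \<in> F0 \<Longrightarrow> psize g \<le> Suc n"
      using f Suc.prems unfolding F0_def by auto
    have card: "card {g \<in> F0 \<union> R. psize g = Suc n} = k" if "\<And>r. r \<in> R \<Longrightarrow> psize r < Suc n" for R
    proof -
      have "{g \<in> F0 \<union> R. psize g = Suc n} = {g \<in> F. psize g = Suc n} - {f}"
        unfolding F0_def by (auto dest: that)
      then show ?thesis using Suc.hyps(2) f by simp
    qed
    have inner: "\<forall>\<^sub>F x in \<Phi>. \<exists>h. matches (img_pair x ` (F0 \<union> R)) h"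
      if "finite R" "\<And>r. r \<in> R \<Longrightarrow> psize r < Suc n" for R
    proof (rule Suc.hyps(1))
      show "k = card {g \<in> F0 \<union> R. psize g = Suc n}" using card[OF that(2)] by simp
    qed (use that F0 in \<open>auto simp: less_imp_le\<close>)
    show ?case
    proof (cases "\<psi> (lead_coeff f) = 0")
      case True
      obtain t where t: "degree t \<le> degree f" "t = 0 \<or> \<psi> (lead_coeff t) \<noteq> 0"
        "\<forall>\<^sub>F x in \<Phi>. img_pair x t = img_pair x f" "map_poly \<psi> t = map_poly \<psi> f" using truncate_vanishing_lead by blast
      have "psize t < Suc n"
      proof (cases "t = 0")
        case False
        have "degree t \<noteq> degree f"
        proof
          assume e: "degree t = degree f"
          have "coeff (map_poly \<psi> t) (degree t) = coeff (map_poly \<psi> f) (degree t)" using t(4) by simp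
          then show False using t(2) False True e by (simp add: coeff_map_poly ringhomD[OF \<psi>])
        qed
        then show ?thesis using t(1) fn False unfolding psize_def by auto
      qed (simp add: psize_def)
      then have "\<forall>\<^sub>F x in \<Phi>. \<exists>h. matches (img_pair x ` (F0 \<union> {t})) h"
        by (intro inner) auto
      with t(3) show ?thesis unfolding F0(3) by eventually_elim simp
    next
      case lc: False
      show ?thesis
      proof (cases "n = 0")
        case True
        then obtain c where c: "f = [:c:]" using fn by (auto elim: degree_eq_zeroE)
        have "\<forall>\<^sub>F x in \<Phi>. \<exists>h. matches (img_pair x ` (F0 \<union> {})) h" by (intro inner) auto
        with sg_ev[of c] show ?thesis
        proof eventually_elim
          case (elim x)
          then obtain h where "matches (img_pair x ` F0) h" by auto
          from matches_insert_constant[OF this elim(1)] show ?case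
            unfolding F0(3) c by (intro exI[of _ h]) (simp add: img_pair_def map_poly_pCons ringhomD[OF \<phi>] ringhomD[OF \<psi>])
        qed
      next
        case False
        show ?thesis unfolding F0(3)
        proof (rule eventually_matches_step[OF F0(1,2) lc])
          show "degree g \<le> degree f" if "g \<in> F0" for g
            using F0(4)[OF that] fn unfolding psize_def by (auto split: if_splits)
          show "\<forall>\<^sub>F x in \<Phi>. \<exists>h. matches (img_pair x ` (F0 \<union> R)) h"
            if "finite R" "\<And>r. r \<in> R \<Longrightarrow> r = 0 \<or> degree r < degree f" for R
            using that fn by (intro inner) (auto simp: psize_def)
        qed (use fn False in simp)
      qed
    qed
  qed
qed

theorem eventually_matches:
  assumes "finite F"
  shows "\<forall>\<^sub>F x in \<Phi>. \<exists>h. matches ((\<lambda>f. (map_poly (\<phi> x) f, map_poly \<psi> f)) ` F) h"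
proof -
  have "\<forall>\<^sub>F x in \<Phi>. \<exists>h. matches (img_pair x ` F) h"
    using assms by (intro eventually_matches_psize[of _ "Max (psize ` F)"]) auto
  then show ?thesis unfolding img_pair_def .
qed

end

section \<open>Transfer of sign conditions from a real closed field to the reals\<close>

definition heval :: "(real \<Rightarrow> 'b::comm_ring_1) \<Rightarrow> ('d::finite \<Rightarrow> 'b) \<Rightarrow> 'd rpoly \<Rightarrow> 'b" where
  "heval \<kappa> \<xi> p = (\<Sum>m\<in>Poly_Mapping.keys p. \<kappa> (Poly_Mapping.lookup p m) * (\<Prod>i\<in>UNIV. \<xi> i ^ Poly_Mapping.lookup m i))"

lemma ringhom_eq_heval:
  assumes h: "ringhom \<Psi>"
  shows "\<Psi> p = heval (\<lambda>c. \<Psi> (Const c)) (\<lambda>i. \<Psi> (Var i)) p"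
  by (subst rpoly_expand[of p]) (simp add: heval_def ringhomD[OF h])

lemma peval_eq_heval: "peval p x = heval id (\<lambda>i. x $ i) p"
  by (simp add: peval_def heval_def)

lemma heval_superset:
  assumes "ringhom \<kappa>" "finite S" "Poly_Mapping.keys p \<subseteq> S"
  shows "heval \<kappa> \<xi> p = (\<Sum>m\<in>S. \<kappa> (Poly_Mapping.lookup p m) * (\<Prod>i\<in>UNIV. \<xi> i ^ Poly_Mapping.lookup m i))"
  unfolding heval_def
  by (rule sum.mono_neutral_left) (use assms in \<open>auto simp: in_keys_iff ringhomD\<close>)

lemma heval_add:
  assumes "ringhom \<kappa>"
  shows "heval \<kappa> \<xi> (p + q) = heval \<kappa> \<xi> p + heval \<kappa> \<xi> q"
proof -
  let ?S = "Poly_Mapping.keys p \<union> Poly_Mapping.keys q"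
  have "Poly_Mapping.keys (p + q) \<subseteq> ?S" by (rule keys_add)
  then show ?thesis
    by (simp add: heval_superset[OF assms, of ?S] lookup_add distrib_right sum.distrib ringhomD[OF assms])
qed

lemma heval_sum:
  assumes "ringhom \<kappa>"
  shows "heval \<kappa> \<xi> (sum f A) = (\<Sum>a\<in>A. heval \<kappa> \<xi> (f a))"
  by (induction A rule: infinite_finite_induct) (simp_all add: heval_add[OF assms], simp_all add: heval_def)

lemma heval_single:
  assumes "ringhom \<kappa>"
  shows "heval \<kappa> \<xi> (Poly_Mapping.single m c) = \<kappa> c * (\<Prod>i\<in>UNIV. \<xi> i ^ Poly_Mapping.lookup m i)"
  by (simp add: heval_def ringhomD[OF assms])

lemma heval_Const: "ringhom \<kappa> \<Longrightarrow> heval \<kappa> \<xi> (Const c) = \<kappa> c"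
  by (simp add: Const_def heval_single)

lemma heval_Var: "ringhom \<kappa> \<Longrightarrow> heval \<kappa> \<xi> (Var i) = \<xi> i"
proof -
  assume h: "ringhom \<kappa>"
  have "(\<Prod>j\<in>UNIV. \<xi> j ^ Poly_Mapping.lookup (Poly_Mapping.single i 1) j) = (\<Prod>j\<in>UNIV. if j = i then \<xi> j else 1)"
    by (intro prod.cong) (auto simp: lookup_single when_def)
  then show ?thesis using h by (simp add: Var_def heval_single ringhomD)
qed

lemma ringhom_heval:
  assumes h: "ringhom \<kappa>"
  shows "ringhom (heval \<kappa> \<xi>)"
  unfolding ringhom_def
proof (intro conjI allI)
  show "heval \<kappa> \<xi> 1 = 1" using heval_Const[OF h, of \<xi> 1] by (simp add: ringhomD[OF h])
  show "heval \<kappa> \<xi> (p + q) = heval \<kappa> \<xi> p + heval \<kappa> \<xi> q" for p q by (rule heval_add[OF h])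
  show "heval \<kappa> \<xi> (p * q) = heval \<kappa> \<xi> p * heval \<kappa> \<xi> q" for p q
  proof -
    let ?mon = "\<lambda>m. \<Prod>i\<in>UNIV. \<xi> i ^ Poly_Mapping.lookup m i"
    have "p * q = (\<Sum>m\<in>Poly_Mapping.keys p. Poly_Mapping.single m (Poly_Mapping.lookup p m)) *
                (\<Sum>k\<in>Poly_Mapping.keys q. Poly_Mapping.single k (Poly_Mapping.lookup q k))"
      by (rule arg_cong2[of _ _ _ _ "(*)"]) (rule rpoly_sum_monomials)+
    also have "\<dots> = (\<Sum>m\<in>Poly_Mapping.keys p. \<Sum>k\<in>Poly_Mapping.keys q.
                     Poly_Mapping.single (m + k) (Poly_Mapping.lookup p m * Poly_Mapping.lookup q k))"
      by (simp add: sum_product mult_single)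
    finally have "heval \<kappa> \<xi> (p * q) = (\<Sum>m\<in>Poly_Mapping.keys p. \<Sum>k\<in>Poly_Mapping.keys q.
        \<kappa> (Poly_Mapping.lookup p m * Poly_Mapping.lookup q k) * ?mon (m + k))"
      by (simp add: heval_sum[OF h] heval_single[OF h])
    also have "\<dots> = (\<Sum>m\<in>Poly_Mapping.keys p. \<Sum>k\<in>Poly_Mapping.keys q.
        (\<kappa> (Poly_Mapping.lookup p m) * ?mon m) * (\<kappa> (Poly_Mapping.lookup q k) * ?mon k))"
      by (intro sum.cong refl) (simp add: lookup_add power_add prod.distrib mult_ac ringhomD[OF h])
    also have "\<dots> = heval \<kappa> \<xi> p * heval \<kappa> \<xi> q"
      by (simp add: heval_def sum_product)
    finally show ?thesis .
  qed
qed

text \<open>The coefficients keep the same polynomial type although the variable \<open>j\<close> no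
  longer occurs in them, so variables can be eliminated without a change of index type.\<close>

definition univ_in :: "'d::finite \<Rightarrow> 'd rpoly \<Rightarrow> 'd rpoly poly" where
  "univ_in j = heval (\<lambda>c. [:Const c:]) (\<lambda>i. if i = j then [:0, 1:] else [:Var i:])"

lemma ringhom_map_poly: "ringhom \<phi> \<Longrightarrow> ringhom (map_poly \<phi>)"
  unfolding ringhom_def[of "map_poly \<phi>"] using map_poly_ringhom(1,2)[of \<phi>]
  by (simp add: ringhomD)

lemma ringhom_const_poly: "ringhom (\<lambda>c. [:Const c:])"
  unfolding ringhom_def by (simp add: Const_add Const_mult one_pCons)

lemma poly_univ_in:
  fixes \<eta> :: "'d::finite rpoly \<Rightarrow> 'b::comm_ring_1"
  assumes \<eta>: "ringhom \<eta>"
  shows "poly (map_poly \<eta> (univ_in j p)) t =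
    heval (\<lambda>c. \<eta> (Const c)) (\<lambda>i. if i = j then t else \<eta> (Var i)) p"
proof -
  have u: "ringhom (univ_in j)"
    unfolding univ_in_def by (rule ringhom_heval[OF ringhom_const_poly])
  define \<Psi> where "\<Psi> p = poly (map_poly \<eta> (univ_in j p)) t" for p
  note m = ringhom_map_poly[OF \<eta>]
  have "ringhom \<Psi>"
    unfolding ringhom_def \<Psi>_def by (simp add: ringhomD(1-3)[OF u] ringhomD(1-3)[OF m])
  moreover have "\<Psi> (Const c) = \<eta> (Const c)" for c
    by (simp add: \<Psi>_def univ_in_def heval_Const[OF ringhom_const_poly] map_poly_pCons ringhomD[OF \<eta>])
  moreover have "\<Psi> (Var i) = (if i = j then t else \<eta> (Var i))" for i
    by (simp add: \<Psi>_def univ_in_def heval_Var[OF ringhom_const_poly] map_poly_pCons ringhomD[OF \<eta>])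
  ultimately show ?thesis using ringhom_eq_heval[of \<Psi> p] by (simp add: \<Psi>_def)
qed

text \<open>Variables outside \<open>V\<close> are set to \<open>0\<close>, and one variable is
  adjoined at a time. The sign table in the new variable is fixed by finitely many signs of
  coefficient polynomials, to which the induction hypothesis applies; hence \<open>C\<close> is
  arbitrary. The new coordinate is a real \<open>t\<close> from the cell that corresponds to that of
  \<open>\<xi> j\<close>.\<close>

lemma transfer_signs_partial:
  fixes \<kappa> :: "real \<Rightarrow> 'b::real_closed" and \<xi> :: "'d::finite \<Rightarrow> 'b"
  assumes \<kappa>: "ringhom \<kappa>" and sg_\<kappa>: "\<And>c. sg (\<kappa> c) = sg c" and "finite V" "finite C"
  shows "\<exists>x. \<forall>c\<in>C. sg (heval id (\<lambda>i. if i \<in> V then x i else 0) c) =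
    sg (heval \<kappa> (\<lambda>i. if i \<in> V then \<xi> i else 0) c)"
  using assms(3,4)
proof (induction V arbitrary: C)
  have id: "ringhom (id :: real \<Rightarrow> real)" by (simp add: ringhom_def)
  case empty
  have "heval \<kappa> (\<lambda>i. 0) c = \<kappa> (heval id (\<lambda>i. 0) c)" for c :: "'d rpoly"
    unfolding heval_def by (simp add: ringhomD[OF \<kappa>])
  then show ?case using sg_\<kappa> by (simp add: id_def)
next
  have id: "ringhom (id :: real \<Rightarrow> real)" by (simp add: ringhom_def)
  case (insert j V)
  define \<phi> where "\<phi> x = heval id (\<lambda>i. if i \<in> V then x i else 0)" for x :: "'d \<Rightarrow> real"
  define \<psi> where "\<psi> = heval \<kappa> (\<lambda>i. if i \<in> V then \<xi> i else 0)"
  \<comment> \<open>The filter generated by all the sign conditions. An eventual statement depends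
    on finitely many of them, the set \<open>D\<close> below.\<close>
  define \<Phi> where "\<Phi> = (INF c. principal {x. sg (\<phi> x c) = sg (\<psi> c)})"
  have \<phi>: "ringhom (\<phi> x)" for x unfolding \<phi>_def by (rule ringhom_heval[OF id])
  have \<psi>: "ringhom \<psi>" unfolding \<psi>_def by (rule ringhom_heval[OF \<kappa>])
  have "\<forall>\<^sub>F x in \<Phi>. sg (\<phi> x a) = sg (\<psi> a)" for a
    unfolding \<Phi>_def by (rule eventually_INF1[of a]) (auto simp: eventually_principal)
  from eventually_matches[of \<phi> \<psi>, OF \<phi> \<psi> this, of "univ_in j ` C"]
  have "\<forall>\<^sub>F x in \<Phi>. \<exists>h. matches ((\<lambda>f. (map_poly (\<phi> x) f, map_poly \<psi> f)) ` univ_in j ` C) h"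
    using insert.prems by simp
  then obtain D where D: "finite D"
    "eventually (\<lambda>x. \<exists>h. matches ((\<lambda>f. (map_poly (\<phi> x) f, map_poly \<psi> f)) ` univ_in j ` C) h)
      (INF c\<in>D. principal {x. sg (\<phi> x c) = sg (\<psi> c)})"
    unfolding \<Phi>_def eventually_INF[of _ _ UNIV] by blast
  obtain x where x: "\<forall>c\<in>D. sg (\<phi> x c) = sg (\<psi> c)"
    using insert.IH[OF D(1)] unfolding \<phi>_def \<psi>_def by blast
  have "(INF c\<in>D. principal {x. sg (\<phi> x c) = sg (\<psi> c)}) = principal (\<Inter>c\<in>D. {x. sg (\<phi> x c) = sg (\<psi> c)})"
    by (rule INF_principal_finite[OF D(1)])
  with D(2) have "\<forall>x\<in>(\<Inter>c\<in>D. {x. sg (\<phi> x c) = sg (\<psi> c)}).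
      \<exists>h. matches ((\<lambda>f. (map_poly (\<phi> x) f, map_poly \<psi> f)) ` univ_in j ` C) h"
    by (simp add: eventually_principal)
  moreover have "x \<in> (\<Inter>c\<in>D. {x. sg (\<phi> x c) = sg (\<psi> c)})" using x by blast
  ultimately obtain h where h: "matches ((\<lambda>f. (map_poly (\<phi> x) f, map_poly \<psi> f)) ` univ_in j ` C) h"
    by blast
  obtain t where t: "cell (rts1 ((\<lambda>f. (map_poly (\<phi> x) f, map_poly \<psi> f)) ` univ_in j ` C)) h t (\<xi> j)"
    using cell_ex'[OF finite_rts1 matchesD(1)[OF h]] insert.prems by auto
  have sgn: "sg (poly (map_poly (\<phi> x) (univ_in j c)) t) = sg (poly (map_poly \<psi> (univ_in j c)) (\<xi> j))" if "c \<in> C" for c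
    by (rule matchesD(3)[OF h t]) (use that in blast)
  have "heval id (\<lambda>i. if i \<in> insert j V then (x(j := t)) i else 0) c = poly (map_poly (\<phi> x) (univ_in j c)) t" for c
    unfolding poly_univ_in[OF \<phi>]
    by (rule arg_cong2[where f = "\<lambda>k x. heval (k :: real \<Rightarrow> real) x c"])
      (auto simp: fun_eq_iff \<phi>_def heval_Const[OF id] heval_Var[OF id] \<open>j \<notin> V\<close>)
  moreover have "heval \<kappa> (\<lambda>i. if i \<in> insert j V then \<xi> i else 0) c = poly (map_poly \<psi> (univ_in j c)) (\<xi> j)" for c
    unfolding poly_univ_in[OF \<psi>]
    by (rule arg_cong2[where f = "\<lambda>k x. heval (k :: real \<Rightarrow> 'b) x c"])
      (auto simp: fun_eq_iff \<psi>_def heval_Const[OF \<kappa>] heval_Var[OF \<kappa>] \<open>j \<notin> V\<close>)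
  ultimately show ?case using sgn by (intro exI[of _ "x(j := t)"]) metis
qed

theorem transfer_signs:
  fixes \<Psi> :: "'d::finite rpoly \<Rightarrow> 'b::real_closed"
  assumes \<Psi>: "ringhom \<Psi>" and c: "\<And>c. 0 \<le> c \<Longrightarrow> 0 \<le> \<Psi> (Const c)" and "finite C"
  shows "\<exists>x. \<forall>c\<in>C. sg (peval c x) = sg (\<Psi> c)"
proof -
  define \<kappa> where "\<kappa> c = \<Psi> (Const c)" for c
  have \<kappa>: "ringhom \<kappa>" unfolding ringhom_def \<kappa>_def by (simp add: Const_add Const_mult ringhomD[OF \<Psi>])
  have nz: "\<kappa> c \<noteq> 0" if "c \<noteq> 0" for c
  proof
    assume "\<kappa> c = 0"
    then have "\<kappa> (c * (1 / c)) = 0" unfolding ringhomD[OF \<kappa>] by simp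
    then show False using that ringhomD(1)[OF \<kappa>] by simp
  qed
  have pos: "0 < \<kappa> c" if "0 < c" for c
    using c[of c] nz[of c] that unfolding \<kappa>_def by auto
  have "sg (\<kappa> c) = sg c" for c
    using pos[of c] pos[of "- c"] by (cases c "0 :: real" rule: linorder_cases)
      (auto simp: sg_def ringhomD[OF \<kappa>])
  from transfer_signs_partial[OF \<kappa> this finite[of "UNIV :: 'd set"] \<open>finite C\<close>, of "\<lambda>i. \<Psi> (Var i)"]
  obtain x where x: "\<forall>c\<in>C. sg (heval id x c) = sg (heval \<kappa> (\<lambda>i. \<Psi> (Var i)) c)" by auto
  have "sg (peval c (\<chi> i. x i)) = sg (\<Psi> c)" if "c \<in> C" for c
    using x that ringhom_eq_heval[OF \<Psi>, of c] by (simp add: peval_eq_heval \<kappa>_def[abs_def])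
  then show ?thesis by blast
qed


section \<open>Maximal preorderings\<close>

lemma ring_preorderingD:
  assumes "ring_preordering T"
  shows "a \<in> T \<Longrightarrow> b \<in> T \<Longrightarrow> a + b \<in> T" "a \<in> T \<Longrightarrow> b \<in> T \<Longrightarrow> a * b \<in> T" "c\<^sup>2 \<in> T"
    "0 \<in> T" "1 \<in> T"
proof -
  show "a \<in> T \<Longrightarrow> b \<in> T \<Longrightarrow> a + b \<in> T" "a \<in> T \<Longrightarrow> b \<in> T \<Longrightarrow> a * b \<in> T"
    using assms unfolding ring_preordering_def by blast+
  have sq: "\<And>c. c\<^sup>2 \<in> T" using assms unfolding ring_preordering_def by blast
  show "c\<^sup>2 \<in> T" by (rule sq)
  show "0 \<in> T" "1 \<in> T" using sq[of 0] sq[of 1] by simp_all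
qed

lemma po_adjoin:
  assumes T: "ring_preordering T"
  shows "ring_preordering {s + a * t | s t. s \<in> T \<and> t \<in> T}"
    and "T \<subseteq> {s + a * t | s t. s \<in> T \<and> t \<in> T}" and "a \<in> {s + a * t | s t. s \<in> T \<and> t \<in> T}"
proof -
  note p = ring_preorderingD[OF T]
  let ?N = "{s + a * t | s t. s \<in> T \<and> t \<in> T}"
  have mem: "x \<in> ?N" if "s \<in> T" "t \<in> T" "x = s + a * t" for x s t
    using that by blast
  show sub: "T \<subseteq> ?N"
  proof
    show "s \<in> ?N" if "s \<in> T" for s by (rule mem[OF that p(4)]) simp
  qed
  show "a \<in> ?N" by (rule mem[OF p(4,5)]) simp
  have add: "(s + a * t) + (s' + a * t') \<in> ?N" if "s \<in> T" "t \<in> T" "s' \<in> T" "t' \<in> T" for s t s' t'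
    by (rule mem[OF p(1)[OF that(1,3)] p(1)[OF that(2,4)]]) (simp add: algebra_simps)
  have mult: "(s + a * t) * (s' + a * t') \<in> ?N" if "s \<in> T" "t \<in> T" "s' \<in> T" "t' \<in> T" for s t s' t'
  proof (rule mem[of "s * s' + a\<^sup>2 * (t * t')" "s * t' + t * s'"])
    show "s * s' + a\<^sup>2 * (t * t') \<in> T" "s * t' + t * s' \<in> T" by (intro p(1-3) that)+
  qed (simp add: algebra_simps power2_eq_square)
  show "ring_preordering ?N"
    unfolding ring_preordering_def
  proof (intro conjI ballI allI)
    fix x y assume "x \<in> ?N" "y \<in> ?N"
    then obtain s t s' t' where st: "s \<in> T" "t \<in> T" "s' \<in> T" "t' \<in> T" "x = s + a * t" "y = s' + a * t'"
      by blast
    show "x + y \<in> ?N" "x * y \<in> ?N"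
      unfolding st(5,6) by (rule add mult; use st in simp)+
  next
    show "c\<^sup>2 \<in> ?N" for c using subsetD[OF sub p(3)] .
  qed
qed

lemma maximal_po:
  assumes "ring_preordering M" "-1 \<notin> M"
  obtains S where "ring_preordering S" "M \<subseteq> S" "-1 \<notin> S"
    "\<And>N. ring_preordering N \<Longrightarrow> S \<subseteq> N \<Longrightarrow> -1 \<notin> N \<Longrightarrow> N = S"
proof -
  let ?A = "{N. ring_preordering N \<and> M \<subseteq> N \<and> -1 \<notin> N}"
  have "\<exists>S\<in>?A. \<forall>Z\<in>?A. S \<subseteq> Z \<longrightarrow> Z = S"
  proof (rule subset_Zorn_nonempty)
    show "?A \<noteq> {}" using assms by blast
    fix C assume "C \<noteq> {}" "subset.chain ?A C"
    then have C: "C \<subseteq> ?A" "\<And>M N. M \<in> C \<Longrightarrow> N \<in> C \<Longrightarrow> M \<subseteq> N \<or> N \<subseteq> M"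
      unfolding subset_chain_def by blast+
    have ex: "\<exists>L\<in>C. a \<in> L \<and> b \<in> L" if "a \<in> \<Union>C" "b \<in> \<Union>C" for a b
      using that C(2) by (meson UnionE subsetD)
    have "ring_preordering (\<Union>C)"
      unfolding ring_preordering_def
    proof (intro conjI ballI allI)
      fix a b assume "a \<in> \<Union>C" "b \<in> \<Union>C"
      from ex[OF this] obtain L where L: "L \<in> C" "a \<in> L" "b \<in> L" by blast
      then have "ring_preordering L" using C(1) by blast
      from ring_preorderingD(1,2)[OF this L(2,3)] show "a + b \<in> \<Union>C" "a * b \<in> \<Union>C"
        using L(1) by blast+
    next
      fix c
      obtain L where "L \<in> C" using \<open>C \<noteq> {}\<close> by blast
      then show "c\<^sup>2 \<in> \<Union>C" using C(1) ring_preorderingD(3) by blast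
    qed
    then show "\<Union>C \<in> ?A" using C(1) \<open>C \<noteq> {}\<close> by auto
  qed
  then show thesis using that by (smt (verit) mem_Collect_eq subset_trans)
qed

text \<open>These are the points of the real spectrum; the last condition says that the support, the
  intersection of \<open>P\<close> with its negative, is a prime ideal.\<close>

definition prime_cone :: "'a::comm_ring_1 set \<Rightarrow> bool" where
  "prime_cone P \<longleftrightarrow> ring_preordering P \<and> -1 \<notin> P \<and> (\<forall>a. a \<in> P \<or> - a \<in> P) \<and>
     (\<forall>a b. a * b \<in> P \<longrightarrow> - (a * b) \<in> P \<longrightarrow> (a \<in> P \<and> - a \<in> P) \<or> (b \<in> P \<and> - b \<in> P))"

text \<open>A maximal preordering without \<open>-1\<close> works. An element outside
  \<open>S\<close> has a certificate \<open>a * t = - (1 + s)\<close>, and multiplying two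
  certificates gives totality as well as primeness. For a product in the support, \<open>neg\<close>
  applies to all four choices of signs, which leaves one factor in the support.\<close>

lemma prime_cone_exists:
  assumes M: "ring_preordering M" "-1 \<notin> M"
  shows "\<exists>P. prime_cone P \<and> M \<subseteq> P"
proof -
  obtain S where S: "ring_preordering S" "M \<subseteq> S" "-1 \<notin> S"
    and max: "\<And>N. ring_preordering N \<Longrightarrow> S \<subseteq> N \<Longrightarrow> -1 \<notin> N \<Longrightarrow> N = S"
    using maximal_po[OF M] by metis
  note p = ring_preorderingD[OF S(1)]
  have ex: "\<exists>s t. s \<in> S \<and> t \<in> S \<and> a * t = - (1 + s)" if "a \<notin> S" for a
  proof -
    have "-1 \<in> {s + a * t | s t. s \<in> S \<and> t \<in> S}"
      using max[OF po_adjoin(1,2)[OF S(1), of a]] po_adjoin(3)[OF S(1), of a] that by blast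
    then obtain s t where st: "s \<in> S" "t \<in> S" "-1 = s + a * t" by blast
    have "a * t = - (1 + s)" using arg_cong[OF st(3), of "\<lambda>z. z - s"] by (simp add: algebra_simps)
    then show ?thesis using st by blast
  qed
  have tot: "a \<in> S \<or> - a \<in> S" for a
  proof (rule ccontr)
    assume "\<not> (a \<in> S \<or> - a \<in> S)"
    then obtain s t s' t' where st: "s \<in> S" "t \<in> S" "a * t = - (1 + s)" "s' \<in> S" "t' \<in> S" "- a * t' = - (1 + s')"
      using ex by metis
    have "(a * t) * (- a * t') = (1 + s) * (1 + s')" unfolding st by (simp add: algebra_simps)
    then have "(1 + s) * (1 + s') - (a * t) * (- a * t') = 0" by simp
    then have "1 + ((s + s' + s * s') + a\<^sup>2 * (t * t')) = 0"
      by (simp add: algebra_simps power2_eq_square)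
    then have "-1 = (s + s' + s * s') + a\<^sup>2 * (t * t')" by (rule minus_unique)
    then show False using S(3) st p by metis
  qed
  have neg: "\<not> (a \<notin> S \<and> b \<notin> S)" if "- (a * b) \<in> S" for a b
  proof
    assume "a \<notin> S \<and> b \<notin> S"
    then obtain s t s' t' where st: "s \<in> S" "t \<in> S" "a * t = - (1 + s)" "s' \<in> S" "t' \<in> S" "b * t' = - (1 + s')"
      using ex by metis
    have "(a * t) * (b * t') = (1 + s) * (1 + s')" unfolding st by (simp add: algebra_simps)
    then have "(1 + s) * (1 + s') - (a * t) * (b * t') = 0" by simp
    then have "1 + ((s + s' + s * s') + (- (a * b)) * (t * t')) = 0"
      by (simp add: algebra_simps)
    then have "-1 = (s + s' + s * s') + (- (a * b)) * (t * t')" by (rule minus_unique)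
    then show False using S(3) st p that by metis
  qed
  have "(a \<in> S \<and> - a \<in> S) \<or> (b \<in> S \<and> - b \<in> S)" if "a * b \<in> S" "- (a * b) \<in> S" for a b
    using neg[of a b] neg[of "- a" b] neg[of a "- b"] neg[of "- a" "- b"] that by auto
  then have "prime_cone S" using S tot unfolding prime_cone_def by blast
  then show ?thesis using S by blast
qed

section \<open>The residue domain of a prime cone\<close>

definition unrealizable :: "'d::finite rpoly set \<Rightarrow> bool" where
  "unrealizable G \<longleftrightarrow> finite G \<and> nonneg_set G = {} \<and> -1 \<notin> po_gen G"

text \<open>The weak Positivstellensatz says that no set is \<open>unrealizable\<close>. As a type definition cannot
  depend on a hypothetical counterexample that is fixed in a proof, the prime cone over such a
  counterexample is chosen once and for all; if there is none, the choice is immaterial.\<close>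

definition the_cone :: "'d::finite rpoly set" where
  "the_cone = (SOME P. prime_cone P \<and> ((\<exists>G :: 'd rpoly set. unrealizable G) \<longrightarrow> (\<exists>G. unrealizable G \<and> G \<subseteq> P)))"

lemma the_cone:
  "prime_cone (the_cone :: 'd::finite rpoly set)"
  "(\<exists>G :: 'd rpoly set. unrealizable G) \<Longrightarrow> (\<exists>G :: 'd rpoly set. unrealizable G \<and> G \<subseteq> the_cone)"
proof -
  have "\<exists>P :: 'd rpoly set. prime_cone P \<and> ((\<exists>G :: 'd rpoly set. unrealizable G) \<longrightarrow> (\<exists>G. unrealizable G \<and> G \<subseteq> P))"
  proof (cases "\<exists>G :: 'd rpoly set. unrealizable G")
    case True
    then obtain G :: "'d rpoly set" where G: "unrealizable G" by blast
    then obtain P where "prime_cone P" "po_gen G \<subseteq> P"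
      using prime_cone_exists[OF ring_preordering_po_gen, of G] unfolding unrealizable_def by blast
    moreover have "G \<subseteq> po_gen G" unfolding po_gen_def by blast
    ultimately show ?thesis using G by blast
  next
    case False
    \<comment> \<open>The default: the polynomials that are nonnegative at the origin.\<close>
    have "prime_cone {p :: 'd rpoly. 0 \<le> peval p 0}"
      unfolding prime_cone_def ring_preordering_def by auto
    then show ?thesis using False by blast
  qed
  from someI_ex[OF this]
  show "prime_cone (the_cone :: 'd rpoly set)"
    "(\<exists>G :: 'd rpoly set. unrealizable G) \<Longrightarrow> (\<exists>G :: 'd rpoly set. unrealizable G \<and> G \<subseteq> the_cone)"
    unfolding the_cone_def[symmetric] by blast+
qed

definition the_supp :: "'d::finite rpoly set" where
  "the_supp = {p. p \<in> the_cone \<and> - p \<in> the_cone}"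

lemma the_cone_props:
  fixes a b :: "'d::finite rpoly"
  shows "a \<in> the_cone \<Longrightarrow> b \<in> the_cone \<Longrightarrow> a + b \<in> the_cone"
    "a \<in> the_cone \<Longrightarrow> b \<in> the_cone \<Longrightarrow> a * b \<in> the_cone" "a\<^sup>2 \<in> the_cone"
    "0 \<in> (the_cone :: 'd rpoly set)" "1 \<in> (the_cone :: 'd rpoly set)" "-1 \<notin> (the_cone :: 'd rpoly set)"
    "a \<in> the_cone \<or> - a \<in> the_cone"
proof -
  have P: "ring_preordering (the_cone :: 'd rpoly set)" "-1 \<notin> (the_cone :: 'd rpoly set)"
    "\<forall>a :: 'd rpoly. a \<in> the_cone \<or> - a \<in> the_cone"
    using the_cone(1)[where 'd = 'd] unfolding prime_cone_def by blast+
  show "a \<in> the_cone \<Longrightarrow> b \<in> the_cone \<Longrightarrow> a + b \<in> the_cone"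
    "a \<in> the_cone \<Longrightarrow> b \<in> the_cone \<Longrightarrow> a * b \<in> the_cone" "a\<^sup>2 \<in> the_cone"
    "0 \<in> (the_cone :: 'd rpoly set)" "1 \<in> (the_cone :: 'd rpoly set)"
    by (fact ring_preorderingD[OF P(1)])+
  show "-1 \<notin> (the_cone :: 'd rpoly set)" by (rule P(2))
  show "a \<in> the_cone \<or> - a \<in> the_cone" by (rule P(3)[rule_format])
qed

lemma the_supp_props:
  fixes a b :: "'d::finite rpoly"
  shows "a \<in> the_supp \<Longrightarrow> b \<in> the_supp \<Longrightarrow> a + b \<in> the_supp"
    "a \<in> the_supp \<Longrightarrow> - a \<in> the_supp" "0 \<in> (the_supp :: 'd rpoly set)"
    "a \<in> the_supp \<Longrightarrow> b * a \<in> the_supp" "1 \<notin> (the_supp :: 'd rpoly set)"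
    "a * b \<in> the_supp \<Longrightarrow> a \<in> the_supp \<or> b \<in> the_supp"
proof -
  show "a \<in> the_supp \<Longrightarrow> b \<in> the_supp \<Longrightarrow> a + b \<in> the_supp"
    unfolding the_supp_def using the_cone_props(1)[of a b] the_cone_props(1)[of "- a" "- b"] by simp
  show "a \<in> the_supp \<Longrightarrow> - a \<in> the_supp" "0 \<in> (the_supp :: 'd rpoly set)" "1 \<notin> (the_supp :: 'd rpoly set)"
    unfolding the_supp_def using the_cone_props by auto
  show "a \<in> the_supp \<Longrightarrow> b * a \<in> the_supp"
    using the_cone_props(7)[of b] the_cone_props(2)[of b a] the_cone_props(2)[of b "- a"]
      the_cone_props(2)[of "- b" a] the_cone_props(2)[of "- b" "- a"]
    unfolding the_supp_def by auto
  show "a * b \<in> the_supp \<Longrightarrow> a \<in> the_supp \<or> b \<in> the_supp"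
    using the_cone(1)[where 'd = 'd] unfolding the_supp_def prime_cone_def by blast
qed

quotient_type (overloaded) 'd residue = "('d::finite) rpoly" / "\<lambda>a b. a - b \<in> the_supp"
proof (rule equivpI)
  show "reflp (\<lambda>a b :: 'd rpoly. a - b \<in> the_supp)"
    by (rule reflpI) (simp add: the_supp_props)
  show "symp (\<lambda>a b :: 'd rpoly. a - b \<in> the_supp)"
    by (rule sympI) (use the_supp_props(2) in fastforce)
  show "transp (\<lambda>a b :: 'd rpoly. a - b \<in> the_supp)"
    by (rule transpI) (use the_supp_props(1) in fastforce)
qed

instantiation residue :: (finite) idom
begin

lift_definition zero_residue :: "'a residue" is "0" .
lift_definition one_residue :: "'a residue" is "1" .
lift_definition plus_residue :: "'a residue \<Rightarrow> 'a residue \<Rightarrow> 'a residue" is "(+)"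
proof -
  fix a b c d :: "'a rpoly" assume "a - b \<in> the_supp" "c - d \<in> the_supp"
  then show "a + c - (b + d) \<in> the_supp"
    using the_supp_props(1)[of "a - b" "c - d"] by (simp add: algebra_simps)
qed
lift_definition minus_residue :: "'a residue \<Rightarrow> 'a residue \<Rightarrow> 'a residue" is "(-)"
proof -
  fix a b c d :: "'a rpoly" assume "a - b \<in> the_supp" "c - d \<in> the_supp"
  then show "a - c - (b - d) \<in> the_supp"
    using the_supp_props(1)[of "a - b" "- (c - d)"] the_supp_props(2)[of "c - d"] by (simp add: algebra_simps)
qed
lift_definition uminus_residue :: "'a residue \<Rightarrow> 'a residue" is "uminus"
proof -
  fix a b :: "'a rpoly" assume "a - b \<in> the_supp"
  then show "- a - - b \<in> the_supp" using the_supp_props(2)[of "a - b"] by (simp add: algebra_simps)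
qed
lift_definition times_residue :: "'a residue \<Rightarrow> 'a residue \<Rightarrow> 'a residue" is "(*)"
proof -
  fix a b c d :: "'a rpoly" assume "a - b \<in> the_supp" "c - d \<in> the_supp"
  then have "c * (a - b) + b * (c - d) \<in> the_supp" using the_supp_props by blast
  then show "a * c - b * d \<in> the_supp" by (simp add: algebra_simps)
qed

instance
proof
  fix a b c :: "'a residue"
  show "a + b + c = a + (b + c)" "a + b = b + a" "0 + a = a" "- a + a = 0" "a - b = a + - b"
    "a * b * c = a * (b * c)" "a * b = b * a" "1 * a = a" "(a + b) * c = a * c + b * c"
    "0 * a = 0" "a * 0 = 0" "a * (b + c) = a * b + a * c"
    by (transfer; simp add: the_supp_props algebra_simps)+
  show "(0 :: 'a residue) \<noteq> 1"
    by transfer (use the_supp_props(2)[of "-1"] the_supp_props(5) in auto)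
  show "a \<noteq> 0 \<Longrightarrow> b \<noteq> 0 \<Longrightarrow> a * b \<noteq> 0"
    by transfer (use the_supp_props(6) in auto)
qed

end

type_synonym 'd closure = "'d residue fract alg_closure"

definition to_closure :: "'d::finite rpoly \<Rightarrow> 'd closure" where
  "to_closure p = to_ac (Fract (abs_residue p) 1)"

lemma ringhom_to_closure: "ringhom (to_closure :: 'd::finite rpoly \<Rightarrow> _)"
  unfolding ringhom_def
proof (intro conjI allI)
  show "to_closure 1 = 1"
    unfolding to_closure_def one_residue.abs_eq[symmetric] One_fract_def[symmetric] by simp
  fix p q :: "'d rpoly"
  show "to_closure (p + q) = to_closure p + to_closure q"
    unfolding to_closure_def plus_residue.abs_eq[symmetric] to_ac_add[symmetric] by simp
  show "to_closure (p * q) = to_closure p * to_closure q"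
    unfolding to_closure_def times_residue.abs_eq[symmetric] to_ac_mult[symmetric] by simp
qed

lemma to_closure_eq_0: "to_closure p = 0 \<longleftrightarrow> p \<in> the_supp"
proof -
  have "to_closure p = 0 \<longleftrightarrow> Fraction_Field.Fract (abs_residue p) 1 = Fraction_Field.Fract 0 1"
    unfolding to_closure_def by (simp add: Zero_fract_def)
  also have "\<dots> \<longleftrightarrow> abs_residue p * 1 = 0 * 1"
    by (rule eq_fract(1)) simp_all
  also have "\<dots> \<longleftrightarrow> p \<in> the_supp"
    by (simp add: zero_residue.abs_eq residue.abs_eq_iff)
  finally show ?thesis .
qed

section \<open>Maximal field cones\<close>

text \<open>\<open>S\<close> is the set of nonnegative elements of a partially ordered subring \<open>S - S\<close> in which squares
  are nonnegative. A maximal such set in an algebraically closed field makes \<open>S - S\<close> a real closed field.\<close>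

definition field_cone :: "'c::field set \<Rightarrow> bool" where
  "field_cone S \<longleftrightarrow> 0 \<in> S \<and> 1 \<in> S \<and> (\<forall>a\<in>S. \<forall>b\<in>S. a + b \<in> S \<and> a * b \<in> S \<and> (a - b)\<^sup>2 \<in> S) \<and>
     (\<forall>a\<in>S. - a \<in> S \<longrightarrow> a = 0)"

definition cone_diffs :: "'c::field set \<Rightarrow> 'c set" where
  "cone_diffs S = {a - b | a b. a \<in> S \<and> b \<in> S}"

lemma field_coneD:
  assumes "field_cone S"
  shows "0 \<in> S" "1 \<in> S" "a \<in> S \<Longrightarrow> b \<in> S \<Longrightarrow> a + b \<in> S" "a \<in> S \<Longrightarrow> b \<in> S \<Longrightarrow> a * b \<in> S"
    "a \<in> S \<Longrightarrow> - a \<in> S \<Longrightarrow> a = 0" "x \<in> cone_diffs S \<Longrightarrow> x\<^sup>2 \<in> S" "a \<in> S \<Longrightarrow> a \<in> cone_diffs S"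
proof -
  show z: "0 \<in> S" "1 \<in> S" using assms unfolding field_cone_def by simp_all
  show "a \<in> S \<Longrightarrow> b \<in> S \<Longrightarrow> a + b \<in> S" "a \<in> S \<Longrightarrow> b \<in> S \<Longrightarrow> a * b \<in> S" "a \<in> S \<Longrightarrow> - a \<in> S \<Longrightarrow> a = 0"
    using assms unfolding field_cone_def by simp_all
  show "x \<in> cone_diffs S \<Longrightarrow> x\<^sup>2 \<in> S" using assms unfolding field_cone_def cone_diffs_def by auto
  show "a \<in> S \<Longrightarrow> a \<in> cone_diffs S" unfolding cone_diffs_def using z by force
qed

lemma field_coneI:
  assumes "0 \<in> S" "1 \<in> S" "\<And>a b. a \<in> S \<Longrightarrow> b \<in> S \<Longrightarrow> a + b \<in> S" "\<And>a b. a \<in> S \<Longrightarrow> b \<in> S \<Longrightarrow> a * b \<in> S"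
    "\<And>a b. a \<in> S \<Longrightarrow> b \<in> S \<Longrightarrow> (a - b)\<^sup>2 \<in> S" "\<And>a. a \<in> S \<Longrightarrow> - a \<in> S \<Longrightarrow> a = 0"
  shows "field_cone S"
  using assms unfolding field_cone_def by simp

lemma cone_diffs_closed:
  assumes S: "field_cone S" and "x \<in> cone_diffs S" "y \<in> cone_diffs S"
  shows "x + y \<in> cone_diffs S" "x - y \<in> cone_diffs S" "x * y \<in> cone_diffs S"
proof -
  note f = field_coneD[OF S]
  obtain a b c d where x: "x = a - b" "a \<in> S" "b \<in> S" and y: "y = c - d" "c \<in> S" "d \<in> S"
    using assms(2,3) unfolding cone_diffs_def by blast
  have mem: "z \<in> cone_diffs S" if "u \<in> S" "v \<in> S" "z = u - v" for z u v
    using that unfolding cone_diffs_def by blast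
  show "x + y \<in> cone_diffs S"
    by (rule mem[OF f(3)[OF x(2) y(2)] f(3)[OF x(3) y(3)]]) (simp add: x y)
  show "x - y \<in> cone_diffs S"
    by (rule mem[OF f(3)[OF x(2) y(3)] f(3)[OF x(3) y(2)]]) (simp add: x y)
  show "x * y \<in> cone_diffs S"
    by (rule mem[OF f(3)[OF f(4)[OF x(2) y(2)] f(4)[OF x(3) y(3)]] f(3)[OF f(4)[OF x(2) y(3)] f(4)[OF x(3) y(2)]]])
      (simp add: x y algebra_simps)
qed

lemma maximal_field_cone_exists:
  assumes M: "field_cone M"
  shows "\<exists>S. field_cone S \<and> M \<subseteq> S \<and> (\<forall>N. field_cone N \<longrightarrow> S \<subseteq> N \<longrightarrow> N = S)"
proof -
  let ?A = "{N. field_cone N \<and> M \<subseteq> N}"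
  have "\<exists>S\<in>?A. \<forall>N\<in>?A. S \<subseteq> N \<longrightarrow> N = S"
  proof (rule subset_Zorn_nonempty)
    show "?A \<noteq> {}" using assms by blast
    fix C assume "C \<noteq> {}" "subset.chain ?A C"
    then have C: "C \<subseteq> ?A" "\<And>M N. M \<in> C \<Longrightarrow> N \<in> C \<Longrightarrow> M \<subseteq> N \<or> N \<subseteq> M"
      unfolding subset_chain_def by blast+
    have ex: "\<exists>L. L \<in> C \<and> field_cone L \<and> a \<in> L \<and> b \<in> L"
      if ab: "a \<in> \<Union>C" "b \<in> \<Union>C" for a b
    proof -
      obtain L where "L \<in> C" "a \<in> L" "b \<in> L" using ab C(2) by (meson UnionE subsetD)
      then show ?thesis using C(1) by blast
    qed
    obtain L0 where L0: "L0 \<in> C" using \<open>C \<noteq> {}\<close> by blast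
    then have fL0: "field_cone L0" using C(1) by blast
    have "field_cone (\<Union>C)"
    proof (rule field_coneI)
      show "0 \<in> \<Union>C" "1 \<in> \<Union>C" using L0 field_coneD(1,2)[OF fL0] by blast+
      fix a b assume "a \<in> \<Union>C" "b \<in> \<Union>C"
      from ex[OF this] obtain L where L: "L \<in> C" "field_cone L" "a \<in> L" "b \<in> L" by blast
      show "a + b \<in> \<Union>C" "a * b \<in> \<Union>C" using L(1) field_coneD(3,4)[OF L(2-4)] by blast+
      have "(a - b)\<^sup>2 \<in> L" using L(3,4) by (intro field_coneD(6)[OF L(2)]) (auto simp: cone_diffs_def)
      then show "(a - b)\<^sup>2 \<in> \<Union>C" using L(1) by blast
    next
      fix a assume "a \<in> \<Union>C" "- a \<in> \<Union>C"
      from ex[OF this] obtain L where L: "field_cone L" "a \<in> L" "- a \<in> L" by blast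
      show "a = 0" using field_coneD(5)[OF L] .
    qed
    then show "\<Union>C \<in> ?A" using C(1) \<open>C \<noteq> {}\<close> by auto
  qed
  then obtain S where S: "S \<in> ?A" and S': "\<forall>N\<in>?A. S \<subseteq> N \<longrightarrow> N = S" by (rule bexE)
  show ?thesis
  proof (intro exI conjI allI impI)
    show "field_cone S" "M \<subseteq> S" using S by simp_all
    fix N assume "field_cone N" "S \<subseteq> N"
    then have "N \<in> ?A" using S by auto
    then show "N = S" using S' \<open>S \<subseteq> N\<close> by blast
  qed
qed

context
  fixes S :: "'c::field set"
  assumes S: "field_cone S" and max: "\<And>N. field_cone N \<Longrightarrow> S \<subseteq> N \<Longrightarrow> N = S"
begin

text \<open>If \<open>b\<close> cannot be adjoined to \<open>S\<close>, the only axiom that can fail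
  for the enlarged set is that opposite elements vanish, whence \<open>b * t = - s\<close> with
  \<open>t \<noteq> 0\<close>. Such relations for both \<open>a\<close> and \<open>- a\<close> give
  two opposite elements of \<open>S\<close>, which must be zero.\<close>

lemma maximal_field_cone_total:
  assumes a: "a \<in> cone_diffs S"
  shows "a \<in> S \<or> - a \<in> S"
proof -
  note f = field_coneD[OF S]
  have ex: "\<exists>s t. s \<in> S \<and> t \<in> S \<and> t \<noteq> 0 \<and> b * t = - s" if b: "b \<in> cone_diffs S" "b \<notin> S" for b
  proof (rule ccontr)
    assume no: "\<not> ?thesis"
    let ?N = "{s + b * t | s t. s \<in> S \<and> t \<in> S}"
    have mem: "z \<in> ?N" if "s \<in> S" "t \<in> S" "z = s + b * t" for z s t using that by blast
    have sub: "S \<subseteq> ?N"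
    proof
      show "s \<in> ?N" if "s \<in> S" for s by (rule mem[OF that f(1)]) simp
    qed
    have b2: "b\<^sup>2 \<in> S" using f(6) b by blast
    have "field_cone ?N"
    proof (rule field_coneI)
      show "0 \<in> ?N" "1 \<in> ?N" using sub f(1,2) by blast+
      fix x y assume "x \<in> ?N" "y \<in> ?N"
      then obtain s t s' t' where st: "s \<in> S" "t \<in> S" "s' \<in> S" "t' \<in> S" and xy: "x = s + b * t" "y = s' + b * t'"
        by blast
      show "x + y \<in> ?N"
        by (rule mem[OF f(3)[OF st(1,3)] f(3)[OF st(2,4)]]) (simp add: xy algebra_simps)
      show "x * y \<in> ?N"
      proof (rule mem[of "s * s' + b\<^sup>2 * (t * t')" "s * t' + t * s'"])
        show "s * s' + b\<^sup>2 * (t * t') \<in> S" "s * t' + t * s' \<in> S" by (intro f(3,4) st b2)+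
      qed (simp add: xy algebra_simps power2_eq_square)
      have "x \<in> cone_diffs S" "y \<in> cone_diffs S" unfolding xy by (intro cone_diffs_closed[OF S] f(7) st b)+
      then show "(x - y)\<^sup>2 \<in> ?N" using sub f(6) cone_diffs_closed[OF S] by blast
    next
      fix x assume x: "x \<in> ?N" "- x \<in> ?N"
      then obtain s t s' t' where st: "s \<in> S" "t \<in> S" "s' \<in> S" "t' \<in> S" and xy: "x = s + b * t" "- x = s' + b * t'"
        by blast
      have "b * (t + t') = - (s + s')"
        using xy by (simp add: algebra_simps eq_neg_iff_add_eq_0)
      then have "t + t' = 0" using no f(3) st by blast
      then have "t' = - t" by (simp add: eq_neg_iff_add_eq_0 add.commute)
      then have "t = 0" using f(5)[OF st(2)] st(4) by simp
      then show "x = 0" using xy st f(5)[of s] \<open>t' = - t\<close> by simp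
    qed
    then have "?N = S" using max sub by blast
    moreover have "b \<in> ?N" by (rule mem[OF f(1,2)]) simp
    ultimately show False using b by blast
  qed
  show ?thesis
  proof (rule ccontr)
    assume n: "\<not> ?thesis"
    have "- a \<in> cone_diffs S" using cone_diffs_closed(2)[OF S f(7)[OF f(1)] a] by simp
    then obtain s t s' t' where st: "s \<in> S" "t \<in> S" "t \<noteq> 0" "a * t = - s"
      "s' \<in> S" "t' \<in> S" "t' \<noteq> 0" "- a * t' = - s'" using ex[of a] ex[of "- a"] a n by metis
    have "- (s * t') = s' * t"
      using arg_cong[OF st(4), of "\<lambda>z. z * t'"] arg_cong[OF st(8), of "\<lambda>z. z * t"] by (simp add: algebra_simps)
    then have "s * t' = 0" using f(4,5) st by metis
    then have "a * t = 0" using st by simp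
    then show False using st n f(1) by simp
  qed
qed

text \<open>Fractions with square denominators form a larger field cone, so they already belong to
  \<open>S\<close>. In particular \<open>S\<close> contains \<open>1 / a\<^sup>2\<close>, and
  \<open>a\<close> times it is the inverse.\<close>

lemma maximal_field_cone_inverse:
  assumes "a \<in> cone_diffs S"
  shows "inverse a \<in> cone_diffs S"
proof (cases "a = 0")
  case True
  then show ?thesis using assms by simp
next
  case False
  note f = field_coneD[OF S]
  let ?N = "{s / t\<^sup>2 | s t. s \<in> S \<and> t \<in> cone_diffs S \<and> t \<noteq> 0}"
  have mem: "z \<in> ?N" if "s \<in> S" "t \<in> cone_diffs S" "t \<noteq> 0" "z = s / t\<^sup>2" for z s t using that by blast
  have one: "1 \<in> cone_diffs S" using f(2,7) by blast
  have sub: "S \<subseteq> ?N"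
  proof
    show "s \<in> ?N" if "s \<in> S" for s by (rule mem[OF that one]) simp_all
  qed
  have "field_cone ?N"
  proof (rule field_coneI)
    show "0 \<in> ?N" "1 \<in> ?N" using sub f(1,2) by blast+
    fix x y assume "x \<in> ?N" "y \<in> ?N"
    then obtain s t s' t' where st: "s \<in> S" "t \<in> cone_diffs S" "t \<noteq> 0" "s' \<in> S" "t' \<in> cone_diffs S" "t' \<noteq> 0"
      and xy: "x = s / t\<^sup>2" "y = s' / t'\<^sup>2"
      by blast
    have tt: "t * t' \<in> cone_diffs S" "t * t' \<noteq> 0" using cone_diffs_closed(3)[OF S] st by simp_all
    have tt2: "(t * t')\<^sup>2 \<in> cone_diffs S" "(t * t')\<^sup>2 \<noteq> 0" using tt f(6,7) by auto
    have m: "s * t'\<^sup>2 \<in> S" "s' * t\<^sup>2 \<in> S" by (intro f(4) f(6) st)+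
    show "x + y \<in> ?N"
      by (rule mem[OF f(3)[OF m] tt]) (use st in \<open>simp add: xy field_simps\<close>)
    show "x * y \<in> ?N"
      by (rule mem[OF f(4)[OF st(1,4)] tt]) (use st in \<open>simp add: xy field_simps\<close>)
    show "(x - y)\<^sup>2 \<in> ?N"
    proof (rule mem[OF _ tt2])
      show "(s * t'\<^sup>2 - s' * t\<^sup>2)\<^sup>2 \<in> S" using m by (intro f(6)) (auto simp: cone_diffs_def)
      have "x - y = (s * t'\<^sup>2 - s' * t\<^sup>2) / (t * t')\<^sup>2"
        using st by (simp add: xy field_simps)
      then show "(x - y)\<^sup>2 = (s * t'\<^sup>2 - s' * t\<^sup>2)\<^sup>2 / ((t * t')\<^sup>2)\<^sup>2"
        by (simp add: power_divide)
    qed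
  next
    fix x assume x: "x \<in> ?N" "- x \<in> ?N"
    obtain s t where st: "s \<in> S" "t \<in> cone_diffs S" "t \<noteq> 0" "x = s / t\<^sup>2" using x(1) by blast
    obtain s' t' where st': "s' \<in> S" "t' \<in> cone_diffs S" "t' \<noteq> 0" "- x = s' / t'\<^sup>2" using x(2) by blast
    have "- (s / t\<^sup>2) = s' / t'\<^sup>2" using st(4) st'(4) by simp
    then have "- (s * t'\<^sup>2) = s' * t\<^sup>2" using st(3) st'(3) by (simp add: field_simps)
    moreover have "s * t'\<^sup>2 \<in> S" "s' * t\<^sup>2 \<in> S" by (intro f(4) f(6) st st')+
    ultimately have "s * t'\<^sup>2 = 0" using f(5) by metis
    then show "x = 0" using st st' by simp
  qed
  then have "?N = S" using max sub by blast
  moreover have "1 / a\<^sup>2 \<in> ?N" by (rule mem[OF f(2) assms False]) simp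
  ultimately have "1 / a\<^sup>2 \<in> cone_diffs S" using f(7) by blast
  then have "a * (1 / a\<^sup>2) \<in> cone_diffs S" by (intro cone_diffs_closed[OF S] assms)
  then show ?thesis using False by (simp add: field_simps power2_eq_square)
qed

end



section \<open>A real closed field over the residue domain\<close>

definition max_cone :: "'d::finite closure set" where
  "max_cone = (SOME S. field_cone S \<and> to_closure ` (the_cone :: 'd rpoly set) \<subseteq> S \<and>
     (\<forall>N. field_cone N \<longrightarrow> S \<subseteq> N \<longrightarrow> N = S))"

lemma field_cone_image: "field_cone (to_closure ` (the_cone :: 'd::finite rpoly set))"
proof (rule field_coneI)
  note h = ringhomD[OF ringhom_to_closure[where 'd = 'd]]
  let ?S = "to_closure ` (the_cone :: 'd rpoly set)"
  show "0 \<in> ?S" using the_cone_props(4) h(4) by (metis image_eqI)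
  show "1 \<in> ?S" using the_cone_props(5) h(1) by (metis image_eqI)
  fix a b assume "a \<in> ?S" "b \<in> ?S"
  then obtain p q :: "'d rpoly" where pq: "p \<in> the_cone" "q \<in> the_cone" and ab: "a = to_closure p" "b = to_closure q" by blast
  show "a + b \<in> ?S" unfolding ab h(2)[symmetric] by (intro imageI the_cone_props pq)
  show "a * b \<in> ?S" unfolding ab h(3)[symmetric] by (intro imageI the_cone_props pq)
  show "(a - b)\<^sup>2 \<in> ?S" unfolding ab h(6)[symmetric] h(8)[symmetric] by (intro imageI the_cone_props pq)
next
  note h = ringhomD[OF ringhom_to_closure[where 'd = 'd]]
  let ?S = "to_closure ` (the_cone :: 'd rpoly set)"
  fix a assume "a \<in> ?S" "- a \<in> ?S"
  then obtain p q :: "'d rpoly" where pq: "p \<in> the_cone" "q \<in> the_cone" and ab: "a = to_closure p" "- a = to_closure q" by blast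
  have "to_closure (p + q) = 0" unfolding h(2) ab(1)[symmetric] ab(2)[symmetric] by simp
  then have "p + q \<in> the_supp" unfolding to_closure_eq_0 .
  then have "- (p + q) \<in> the_cone" unfolding the_supp_def by simp
  then have "- (p + q) + q \<in> the_cone" by (intro the_cone_props pq)
  then have "p \<in> the_supp" using pq unfolding the_supp_def by simp
  then show "a = 0" unfolding ab to_closure_eq_0 .
qed

lemma max_cone:
  "field_cone (max_cone :: 'd::finite closure set)"
  "to_closure ` (the_cone :: 'd rpoly set) \<subseteq> max_cone"
  "\<And>N. field_cone N \<Longrightarrow> (max_cone :: 'd closure set) \<subseteq> N \<Longrightarrow> N = max_cone"
  using someI_ex[OF maximal_field_cone_exists[OF field_cone_image[where 'd = 'd]], folded max_cone_def]
  by blast+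

typedef (overloaded) 'd rcl = "cone_diffs (max_cone :: 'd::finite closure set)"
  using field_coneD(1,7)[OF max_cone(1)] by blast

setup_lifting type_definition_rcl

instantiation rcl :: (finite) field
begin


lift_definition zero_rcl :: "'a rcl" is 0 using field_coneD(1,7)[OF max_cone(1)] by blast
lift_definition one_rcl :: "'a rcl" is 1 using field_coneD(2,7)[OF max_cone(1)] by blast
lift_definition plus_rcl :: "'a rcl \<Rightarrow> 'a rcl \<Rightarrow> 'a rcl" is "(+)" by (rule cone_diffs_closed[OF max_cone(1)])
lift_definition minus_rcl :: "'a rcl \<Rightarrow> 'a rcl \<Rightarrow> 'a rcl" is "(-)" by (rule cone_diffs_closed[OF max_cone(1)])
lift_definition uminus_rcl :: "'a rcl \<Rightarrow> 'a rcl" is "uminus"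
  using cone_diffs_closed(2)[OF max_cone(1) field_coneD(7)[OF max_cone(1) field_coneD(1)[OF max_cone(1)]]] by fastforce
lift_definition times_rcl :: "'a rcl \<Rightarrow> 'a rcl \<Rightarrow> 'a rcl" is "(*)" by (rule cone_diffs_closed[OF max_cone(1)])
lift_definition inverse_rcl :: "'a rcl \<Rightarrow> 'a rcl" is "inverse"
  by (rule maximal_field_cone_inverse[OF max_cone(1,3)])
lift_definition divide_rcl :: "'a rcl \<Rightarrow> 'a rcl \<Rightarrow> 'a rcl" is "(/)"
  unfolding divide_inverse
  by (intro cone_diffs_closed(3)[OF max_cone(1)] maximal_field_cone_inverse[OF max_cone(1,3)])
instance
  by standard (transfer; simp add: algebra_simps divide_inverse)+

end

instantiation rcl :: (finite) linordered_field
begin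

lift_definition less_eq_rcl :: "'a rcl \<Rightarrow> 'a rcl \<Rightarrow> bool" is "\<lambda>a b. b - a \<in> max_cone" .
definition less_rcl :: "'a rcl \<Rightarrow> 'a rcl \<Rightarrow> bool" where "less_rcl a b \<longleftrightarrow> a \<le> b \<and> a \<noteq> b"
definition abs_rcl :: "'a rcl \<Rightarrow> 'a rcl" where "abs_rcl a = (if a < 0 then - a else a)"
definition sgn_rcl :: "'a rcl \<Rightarrow> 'a rcl" where "sgn_rcl a = (if a = 0 then 0 else if 0 < a then 1 else - 1)"

instance
proof
  note f = field_coneD[OF max_cone(1)[where 'd = 'a]]
  fix a b c :: "'a rcl"
  have antisym: "a = b" if "a \<le> b" "b \<le> a" for a b :: "'a rcl"
    using that
  proof transfer
    fix a b :: "'a closure" assume "b - a \<in> max_cone" "a - b \<in> max_cone"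
    then show "a = b" using f(5)[of "a - b"] by simp
  qed
  show "a \<le> a" by transfer (simp add: f(1))
  show "a \<le> b \<Longrightarrow> b \<le> c \<Longrightarrow> a \<le> c"
  proof transfer
    fix a b c :: "'a closure" assume "b - a \<in> max_cone" "c - b \<in> max_cone"
    from f(3)[OF this] show "c - a \<in> max_cone" by simp
  qed
  show "a \<le> b \<Longrightarrow> b \<le> a \<Longrightarrow> a = b" by (rule antisym)
  show "a < b \<longleftrightarrow> a \<le> b \<and> \<not> b \<le> a" unfolding less_rcl_def using antisym by blast
  show "a \<le> b \<or> b \<le> a"
  proof transfer
    fix a b :: "'a closure" assume "a \<in> cone_diffs max_cone" "b \<in> cone_diffs max_cone"
    from maximal_field_cone_total[OF max_cone(1,3) cone_diffs_closed(2)[OF max_cone(1) this]]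
    show "b - a \<in> max_cone \<or> a - b \<in> max_cone" by auto
  qed
  show "a \<le> b \<Longrightarrow> c + a \<le> c + b" by transfer simp
  have le0: "0 \<le> b - a \<longleftrightarrow> a \<le> b" for a b :: "'a rcl" by transfer simp
  show "a < b \<Longrightarrow> 0 < c \<Longrightarrow> c * a < c * b"
  proof -
    assume ab: "a < b" "0 < c"
    then have "0 \<le> b - a" "0 \<le> c" unfolding less_rcl_def le0 by blast+
    then have "0 \<le> c * (b - a)" by transfer (use f(4) in simp)
    then have le: "c * a \<le> c * b" by transfer (simp add: algebra_simps)
    have "c * a \<noteq> c * b"
      using ab unfolding less_rcl_def by transfer auto
    then show "c * a < c * b" using le unfolding less_rcl_def by blast
  qed
  show "\<bar>a\<bar> = (if a < 0 then - a else a)" by (rule abs_rcl_def)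
  show "sgn a = (if a = 0 then 0 else if 0 < a then 1 else - 1)" by (rule sgn_rcl_def)
qed

end

lemma rcl_le_iff: "0 \<le> a \<longleftrightarrow> Rep_rcl a \<in> max_cone"
  by transfer simp

lemma ringhom_Rep_rcl: "ringhom Rep_rcl"
  unfolding ringhom_def by (simp add: one_rcl.rep_eq plus_rcl.rep_eq times_rcl.rep_eq)

lemma Rep_rcl_eq_0: "Rep_rcl a = 0 \<longleftrightarrow> a = 0"
  using ringhomD(4)[OF ringhom_Rep_rcl] Rep_rcl_inject by metis

text \<open>Nonnegative weights are allowed because nonnegative scalars are not known to be squares
  as long as the field is not known to be real closed.\<close>

inductive_set wsos :: "'a::linordered_field poly set" where
  zero: "0 \<in> wsos"
| add: "w \<in> wsos \<Longrightarrow> 0 \<le> s \<Longrightarrow> smult s (g\<^sup>2) + w \<in> wsos"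

lemma wsos_term: "0 \<le> s \<Longrightarrow> smult s (g\<^sup>2) \<in> wsos"
  using wsos.add[OF wsos.zero] by simp

lemma wsos_add: "v \<in> wsos \<Longrightarrow> w \<in> wsos \<Longrightarrow> v + w \<in> wsos"
  by (induction rule: wsos.induct) (simp_all add: wsos.add add.assoc)

lemma wsos_term_mult: "w \<in> wsos \<Longrightarrow> 0 \<le> s \<Longrightarrow> smult s (g\<^sup>2) * w \<in> wsos"
proof (induction rule: wsos.induct)
  case (add w t h)
  have "smult s (g\<^sup>2) * (smult t (h\<^sup>2) + w) = smult (s * t) ((g * h)\<^sup>2) + smult s (g\<^sup>2) * w"
    by (simp add: algebra_simps power_mult_distrib)
  then show ?case using add wsos.add[of "smult s (g\<^sup>2) * w" "s * t" "g * h"] by simp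
qed (simp add: wsos.zero)

lemma wsos_mult: "v \<in> wsos \<Longrightarrow> w \<in> wsos \<Longrightarrow> v * w \<in> wsos"
proof (induction rule: wsos.induct)
  case (add v s g)
  then show ?case unfolding distrib_right by (intro wsos_add wsos_term_mult) auto
qed (simp add: wsos.zero)

lemma wsos_poly_nonneg: "w \<in> wsos \<Longrightarrow> 0 \<le> poly w x"
  by (induction rule: wsos.induct) auto

text \<open>Nonnegative summands with sum zero all vanish, so each square of nonzero weight has the
  linear factor twice.\<close>

lemma wsos_divide_root:
  assumes "w \<in> wsos" "poly w c = 0"
  shows "\<exists>v\<in>wsos. w = [:- c, 1:]\<^sup>2 * v"
  using assms
proof (induction rule: wsos.induct)
  case (add w s g)
  have "0 \<le> s * (poly g c)\<^sup>2" "0 \<le> poly w c" using add.hyps wsos_poly_nonneg by auto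
  moreover have "s * (poly g c)\<^sup>2 + poly w c = 0" using add.prems by simp
  ultimately have z: "s * (poly g c)\<^sup>2 = 0" "poly w c = 0" by (simp_all add: add_nonneg_eq_0_iff)
  obtain v where v: "v \<in> wsos" "w = [:- c, 1:]\<^sup>2 * v" using add.IH z by blast
  show ?case
  proof (cases "s = 0")
    case True
    then show ?thesis using v by (intro bexI[of _ v]) auto
  next
    case False
    then have "[:- c, 1:] dvd g" using z by (simp add: poly_eq_0_iff_dvd)
    then obtain h where "g = [:- c, 1:] * h" by (rule dvdE)
    then have "smult s (g\<^sup>2) + w = [:- c, 1:]\<^sup>2 * (smult s (h\<^sup>2) + v)"
      unfolding v(2) by (simp only: power_mult_distrib mult_smult_right distrib_left)
    then show ?thesis using wsos.add[OF v(1) add.hyps(2)] by blast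
  qed
qed (auto intro: wsos.zero)

text \<open>Each \<open>g\<close> is replaced by its remainder modulo \<open>f\<close>, which brings
  the sum below the degree bound of the next lemma.\<close>

lemma wsos_reduce:
  fixes f :: "'a::linordered_field poly"
  assumes "w \<in> wsos" "0 < degree f"
  shows "\<exists>v\<in>wsos. f dvd w - v \<and> degree v \<le> 2 * (degree f - 1)"
  using assms(1)
proof induction
  case zero
  then show ?case by (intro bexI[of _ 0]) (auto intro: wsos.zero)
next
  case (add w s g)
  then obtain v where v: "v \<in> wsos" "f dvd w - v" "degree v \<le> 2 * (degree f - 1)" by blast
  define r where "r = g mod f"
  have dr: "degree r \<le> degree f - 1"
  proof (cases "g mod f = 0")
    case False
    moreover have "f \<noteq> 0" using assms(2) by auto
    ultimately have "degree (g mod f) < degree f" by (rule degree_mod_less'[rotated])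
    then show ?thesis unfolding r_def by linarith
  qed (simp add: r_def)
  have "f dvd g - r" unfolding r_def by (simp add: minus_mod_eq_mult_div)
  then have "f dvd smult s ((g - r) * (g + r))" by (intro dvd_smult dvd_mult2)
  then have "f dvd smult s ((g - r) * (g + r)) + (w - v)" using v by (intro dvd_add)
  also have "smult s ((g - r) * (g + r)) + (w - v) = (smult s (g\<^sup>2) + w) - (smult s (r\<^sup>2) + v)"
    by (simp add: algebra_simps power2_eq_square smult_diff_right smult_add_right)
  finally have "f dvd (smult s (g\<^sup>2) + w) - (smult s (r\<^sup>2) + v)" .
  moreover have "degree (smult s (r\<^sup>2) + v) \<le> 2 * (degree f - 1)"
  proof (rule degree_add_le)
    have "degree (smult s (r\<^sup>2)) \<le> degree r * 2"
      using degree_smult_le degree_power_le order_trans by blast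
    then show "degree (smult s (r\<^sup>2)) \<le> 2 * (degree f - 1)" using dr by linarith
  qed (rule v)
  ultimately show ?case using wsos.add[OF v(1) add.hyps(2)] by blast
qed

text \<open>The heart of the proof that \<open>rcl\<close> is real closed: a polynomial of minimal degree that violates
  the intermediate value property divides no nonzero sum of weighted squares of small degree, because
  the cofactor would have lower degree and change sign as well.\<close>

lemma wsos_multiple_zero:
  fixes f :: "'a::linordered_field poly"
  assumes ab: "a < b" "poly f a < 0" "0 < poly f b"
    and min: "\<And>g. degree g < degree f \<Longrightarrow> poly g a < 0 \<Longrightarrow> 0 < poly g b \<Longrightarrow> \<exists>c>a. c < b \<and> poly g c = 0"
    and noroot: "\<And>c. 1 < degree f \<Longrightarrow> poly f c \<noteq> 0"
    and w: "w \<in> wsos" "f dvd w" "degree w \<le> 2 * (degree f - 1)"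
  shows "w = 0"
  using w
proof (induction "degree w" arbitrary: w rule: less_induct)
  case less
  show ?case
  proof (rule ccontr)
    assume w0: "w \<noteq> 0"
    obtain h where h: "w = f * h" using less.prems(2) by (rule dvdE)
    have fh: "f \<noteq> 0" "h \<noteq> 0" using w0 h by auto
    have dw: "degree w = degree f + degree h" unfolding h using fh by (rule degree_mult_eq)
    have df: "1 < degree f"
    proof (rule ccontr)
      assume "\<not> 1 < degree f"
      then have "degree f = 0" using dw less.prems(3) by linarith
      then show False using ab by (auto elim!: degree_eq_zeroE)
    qed
    have "0 \<le> poly f a * poly h a" "0 \<le> poly f b * poly h b"
      using wsos_poly_nonneg[OF less.prems(1)] h by (metis poly_mult)+
    then have hab: "poly h a \<le> 0" "0 \<le> poly h b"
      using ab by (auto simp: zero_le_mult_iff)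
    have dh: "degree h < degree f" using dw less.prems(3) df by linarith
    have "\<exists>c. poly h c = 0"
    proof (cases "poly h a = 0 \<or> poly h b = 0")
      case False
      then have "poly h a < 0" "0 < poly h b" using hab by auto
      then show ?thesis using min[of h] dh by blast
    qed blast
    then obtain c where c: "poly h c = 0" by blast
    then have "poly w c = 0" using h by simp
    then obtain v where v: "v \<in> wsos" "w = [:- c, 1:]\<^sup>2 * v" using wsos_divide_root less.prems(1) by blast
    obtain h1 where h1: "h = [:- c, 1:] * h1" using c by (auto simp: poly_eq_0_iff_dvd elim: dvdE)
    have "[:- c, 1:] * ([:- c, 1:] * v) = [:- c, 1:] * (f * h1)"
      using v(2) h h1 by (metis mult.left_commute mult.assoc power2_eq_square)
    then have e1: "[:- c, 1:] * v = f * h1" by (rule mult_left_cancel[THEN iffD1, rotated]) simp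
    \<comment> \<open>Since \<open>c\<close> is no root of \<open>f\<close>, the second linear
      factor is split off from the cofactor as well, and \<open>f\<close> divides the smaller
      weighted sum \<open>v\<close>.\<close>
    have "poly f c * poly h1 c = 0" using arg_cong[OF e1, of "\<lambda>p. poly p c"] by simp
    then have "poly h1 c = 0" using noroot[OF df] by simp
    then obtain h2 where h2: "h1 = [:- c, 1:] * h2" by (auto simp: poly_eq_0_iff_dvd elim: dvdE)
    have "[:- c, 1:] * v = [:- c, 1:] * (f * h2)" using e1 h2 by (metis mult.left_commute)
    then have "v = f * h2" by (rule mult_left_cancel[THEN iffD1, rotated]) simp
    then have "f dvd v" by simp
    have "v \<noteq> 0" using w0 v by auto
    then have "degree w = degree ([:- c, 1:]\<^sup>2) + degree v" unfolding v(2) by (intro degree_mult_eq) auto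
    then have "degree v < degree w" by (simp add: degree_power_eq)
    then have "v = 0" using less.hyps[OF _ v(1) \<open>f dvd v\<close>] less.prems(3) by linarith
    then show False using \<open>v \<noteq> 0\<close> by blast
  qed
qed

text \<open>A counterexample \<open>f\<close> of least degree would be, up to a constant, the
  minimal polynomial of a root \<open>\<alpha>\<close> in the algebraic closure. The values at
  \<open>\<alpha>\<close> of weighted sums of squares form a field cone above
  \<open>max_cone\<close>, so maximality puts \<open>\<alpha>\<close> itself into the field, in
  which \<open>f\<close> has no root.\<close>

theorem rcl_ivt:
  fixes f :: "'d::finite rcl poly"
  assumes "a < b" "poly f a < 0" "0 < poly f b"
  shows "\<exists>c>a. c < b \<and> poly f c = 0"
  using assms
proof (induction "degree f" arbitrary: f a b rule: less_induct)
  case less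
  show ?case
  proof (rule ccontr)
    assume nr: "\<not> ?thesis"
    have IH: "\<exists>c>a. c < b \<and> poly g c = 0"
      if "degree g < degree f" "poly g a < 0 \<and> 0 < poly g b \<or> 0 < poly g a \<and> poly g b < 0" for g
      using less.hyps[of g a b] less.hyps[of "- g" a b] that less.prems(1) by auto
    \<comment> \<open>One of the factors would change sign between \<open>a\<close> and
      \<open>b\<close> and, being of lower degree, have a root there.\<close>
    have irr: False if g: "f = g * h" "degree g < degree f" "degree h < degree f" for g h
    proof -
      have n: "\<not> (poly g a < 0 \<and> 0 < poly g b \<or> 0 < poly g a \<and> poly g b < 0)"
        "\<not> (poly h a < 0 \<and> 0 < poly h b \<or> 0 < poly h a \<and> poly h b < 0)"
        using IH[of g] IH[of h] nr g by auto
      have "poly g a * poly h a < 0" "0 < poly g b * poly h b" using less.prems g(1) by simp_all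
      then show False using n by (auto simp: mult_less_0_iff zero_less_mult_iff)
    qed
    have f0: "f \<noteq> 0" using less.prems by auto
    have df: "0 < degree f"
    proof (rule gr0I)
      assume "degree f = 0"
      then obtain e where "f = [:e:]" by (rule degree_eq_zeroE)
      then show False using less.prems by simp
    qed
    have root1: "degree f = 1" if c: "poly f c = 0" for c
    proof (rule ccontr)
      assume d: "degree f \<noteq> 1"
      obtain g where g: "f = [:- c, 1:] * g" using c by (auto simp: poly_eq_0_iff_dvd elim: dvdE)
      then have "degree f = 1 + degree g" using f0 by (subst g, subst degree_mult_eq) auto
      then show False using irr[OF g] d df by simp
    qed
    have noroot: "poly f c \<noteq> 0" for c
    proof
      assume c: "poly f c = 0"
      then have d: "degree f = 1" by (rule root1)
      obtain g where g: "f = [:- c, 1:] * g" using c by (auto simp: poly_eq_0_iff_dvd elim: dvdE)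
      then have "degree f = 1 + degree g" using f0 by (subst g, subst degree_mult_eq) auto
      then obtain e where e: "g = [:e:]" using d by (auto elim: degree_eq_zeroE)
      have "(a - c) * e < 0" "0 < (b - c) * e" using less.prems unfolding g e by (simp_all add: algebra_simps)
      then have "a < c \<and> c < b" using less.prems(1) by (auto simp: mult_less_0_iff zero_less_mult_iff)
      then show False using nr c by blast
    qed
    have mp: "ringhom (map_poly (Rep_rcl :: 'd rcl \<Rightarrow> _))" by (rule ringhom_map_poly[OF ringhom_Rep_rcl])
    have "degree (map_poly Rep_rcl f) = degree f"
      by (rule degree_map_poly) (simp add: Rep_rcl_eq_0)
    then obtain \<alpha> where \<alpha>: "poly (map_poly Rep_rcl f) \<alpha> = 0"
      using alg_closed_imp_poly_has_root[of "map_poly Rep_rcl f"] df by auto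
    define E where "E p = poly (map_poly Rep_rcl p) \<alpha>" for p :: "'d rcl poly"
    have E: "ringhom E" unfolding ringhom_def E_def by (simp add: ringhomD(1-3)[OF mp])
    have EC: "E [:c:] = Rep_rcl c" for c
      by (simp add: E_def map_poly_pCons ringhomD[OF ringhom_Rep_rcl])
    have Esm: "E (smult c p) = Rep_rcl c * E p" for c p
      using ringhomD(3)[OF E, of "[:c:]" p] by (simp add: EC)
    have "\<exists>m. m \<noteq> 0 \<and> E m = 0" using \<alpha> f0 unfolding E_def by blast
    then obtain m where m: "m \<noteq> 0" "E m = 0" and mmin: "\<And>p. p \<noteq> 0 \<Longrightarrow> E p = 0 \<Longrightarrow> degree m \<le> degree p"
      using exists_least_iff[of "\<lambda>n. \<exists>m. m \<noteq> 0 \<and> E m = 0 \<and> degree m = n"] by (metis linorder_not_less)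
    have mdvd: "m dvd p" if "E p = 0" for p
    proof -
      have "E (p mod m) = 0"
        using that m ringhomD(6,3)[OF E] by (metis minus_mult_div_eq_mod mult_zero_left diff_zero)
      then have "p mod m = 0" using mmin[of "p mod m"] degree_mod_less'[OF m(1)] by (metis linorder_not_less)
      then show ?thesis by (simp add: dvd_eq_mod_eq_0)
    qed
    have dm: "0 < degree m"
    proof (rule gr0I)
      assume "degree m = 0"
      then obtain e where e: "m = [:e:]" by (rule degree_eq_zeroE)
      then show False using m EC Rep_rcl_eq_0 by auto
    qed
    have Ef: "E f = 0" using \<alpha> unfolding E_def .
    obtain q where q: "f = m * q" using mdvd[OF Ef] by (rule dvdE)
    have dq: "degree f = degree m + degree q" using f0 q by (metis degree_mult_eq mult_eq_0_iff)
    have "degree q = 0"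
    proof (rule ccontr)
      assume "degree q \<noteq> 0"
      then show False using irr[OF q] dq dm by simp
    qed
    then obtain e where e: "q = [:e:]" by (rule degree_eq_zeroE)
    have fdvd: "f dvd p" if "E p = 0" for p
    proof -
      have "e \<noteq> 0" using f0 q e by auto
      then have "m = f * [:1/e:]" unfolding q e by simp
      then have "f dvd m" by (metis dvd_triv_left)
      then show ?thesis using mdvd[OF that] by (rule dvd_trans)
    qed
    let ?N = "E ` wsos"
    have "field_cone ?N"
    proof (rule field_coneI)
      have "(1 :: 'd rcl poly) \<in> wsos" using wsos_term[of 1 1] by (metis power_one smult_1_left zero_le_one)
      then show "1 \<in> ?N" "0 \<in> ?N" using wsos.zero ringhomD(1,4)[OF E] by (metis image_eqI)+
      fix x y assume "x \<in> ?N" "y \<in> ?N"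
      then obtain v w where vw: "v \<in> wsos" "w \<in> wsos" "x = E v" "y = E w" by blast
      show "x + y \<in> ?N" unfolding vw ringhomD(2)[OF E, symmetric] by (intro imageI wsos_add vw)
      show "x * y \<in> ?N" unfolding vw ringhomD(3)[OF E, symmetric] by (intro imageI wsos_mult vw)
      have "(v - w)\<^sup>2 \<in> wsos" using wsos_term[of 1 "v - w"] by simp
      then show "(x - y)\<^sup>2 \<in> ?N" unfolding vw ringhomD(6,8)[OF E, symmetric] by (rule imageI)
    next
      fix x assume "x \<in> ?N" "- x \<in> ?N"
      then obtain v w where vw: "v \<in> wsos" "w \<in> wsos" "x = E v" "- x = E w" by blast
      obtain v' w' where v': "v' \<in> wsos" "f dvd v - v'" "degree v' \<le> 2 * (degree f - 1)"
        and w': "w' \<in> wsos" "f dvd w - w'" "degree w' \<le> 2 * (degree f - 1)"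
        using wsos_reduce[OF vw(1) df] wsos_reduce[OF vw(2) df] by blast
      have E0: "E p = 0" if "f dvd p" for p using that Ef ringhomD(3)[OF E] by (auto elim!: dvdE)
      have Evw: "E v = E v'" "E w = E w'" using E0[OF v'(2)] E0[OF w'(2)] ringhomD(6)[OF E] by auto
      have "E (v' + w') = 0" unfolding ringhomD(2)[OF E] Evw[symmetric] vw(3,4)[symmetric] by simp
      \<comment> \<open>The sum of the reduced forms is a multiple of \<open>f\<close> of degree at
        most \<open>2 * (degree f - 1)\<close>. Once it is zero, the two summands vanish pointwise
        because both are nonnegative.\<close>
      then have "v' + w' = 0"
        using v' w' noroot IH
        by (intro wsos_multiple_zero[OF less.prems _ _ wsos_add fdvd degree_add_le]) auto
      have "v' = 0"
      proof (rule ccontr)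
        assume "v' \<noteq> 0"
        have "poly v' z = 0" for z
        proof -
          have "poly v' z + poly w' z = 0" using \<open>v' + w' = 0\<close> by (metis poly_0 poly_add)
          then show ?thesis using wsos_poly_nonneg[OF v'(1), of z] wsos_poly_nonneg[OF w'(1), of z]
            by (simp add: add_nonneg_eq_0_iff)
        qed
        then have "finite (UNIV :: 'd rcl set)" using poly_roots_finite[OF \<open>v' \<noteq> 0\<close>] by simp
        then show False using infinite_UNIV_char_0 by blast
      qed
      then show "x = 0" using vw Evw ringhomD(4)[OF E] by simp
    qed
    moreover have "max_cone \<subseteq> ?N"
    proof
      fix c :: "'d closure" assume c: "c \<in> max_cone"
      then have "c \<in> cone_diffs max_cone" by (rule field_coneD(7)[OF max_cone(1)])
      then obtain l where l: "c = Rep_rcl l" by (metis Rep_rcl_cases)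
      then have "0 \<le> l" using c rcl_le_iff by blast
      then have "smult l (1\<^sup>2) \<in> wsos" by (rule wsos_term)
      then have "E (smult l (1\<^sup>2)) \<in> ?N" by (rule imageI)
      then show "c \<in> ?N" unfolding Esm l by (simp add: ringhomD(1)[OF E])
    qed
    ultimately have N: "?N = max_cone" by (rule max_cone(3))
    \<comment> \<open>\<open>\<alpha>\<close> is the difference of the squares of
      \<open>(\<alpha> + 1) / 2\<close> and \<open>(\<alpha> - 1) / 2\<close>.\<close>
    define h :: "'d rcl poly" where "h = [:1/2:]"
    have "smult 1 ((h * ([:0, 1:] + 1))\<^sup>2) \<in> wsos" "smult 1 ((h * ([:0, 1:] - 1))\<^sup>2) \<in> wsos"
      by (intro wsos_term; simp)+
    then have "E (smult 1 ((h * ([:0, 1:] + 1))\<^sup>2)) - E (smult 1 ((h * ([:0, 1:] - 1))\<^sup>2)) \<in> cone_diffs max_cone"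
      using N unfolding cone_diffs_def by blast
    also have "E (smult 1 ((h * ([:0, 1:] + 1))\<^sup>2)) - E (smult 1 ((h * ([:0, 1:] - 1))\<^sup>2)) = E [:0, 1:]"
    proof -
      have "smult 1 ((h * ([:0, 1:] + 1))\<^sup>2) - smult 1 ((h * ([:0, 1:] - 1))\<^sup>2) = [:0, 1:]"
        by (simp add: h_def power2_eq_square one_pCons)
      then show ?thesis unfolding ringhomD(6)[OF E, symmetric] by simp
    qed
    also have "E [:0, 1:] = \<alpha>"
      by (simp add: E_def map_poly_pCons ringhomD[OF ringhom_Rep_rcl])
    finally obtain l where l: "\<alpha> = Rep_rcl l" by (metis Rep_rcl_cases)
    have "Rep_rcl (poly f l) = 0"
      using \<alpha> unfolding l ringhom_poly_map_poly[OF ringhom_Rep_rcl, symmetric] .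
    then show False using noroot Rep_rcl_eq_0 by blast
  qed
qed

instance rcl :: (finite) real_closed
proof
  fix a b :: "'a rcl" and f n
  assume *: "a < b" "(\<Sum>k\<le>n. f k * a ^ k) < 0" "0 < (\<Sum>k\<le>n. f k * b ^ k)"
  define p where "p = (\<Sum>k\<le>n. monom (f k) k)"
  have "poly p x = (\<Sum>k\<le>n. f k * x ^ k)" for x
    by (simp add: p_def poly_sum poly_monom)
  then show "\<exists>c>a. c < b \<and> (\<Sum>k\<le>n. f k * c ^ k) = 0"
    using rcl_ivt[of a b p] * by auto
qed

section \<open>The weak Positivstellensatz\<close>

theorem weak_positivstellensatz:
  fixes G :: "'d::finite rpoly set"
  assumes "finite G" "nonneg_set G = {}"
  shows "-1 \<in> po_gen G"
proof (rule ccontr)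
  assume "-1 \<notin> po_gen G"
  then have "\<exists>G :: 'd rpoly set. unrealizable G" using assms unfolding unrealizable_def by blast
  \<comment> \<open>The chosen cone need not contain \<open>G\<close>; it contains some
    counterexample \<open>H\<close>, and \<open>H\<close> is refuted instead.\<close>
  from the_cone(2)[OF this] obtain H :: "'d rpoly set" where H: "unrealizable H" "H \<subseteq> the_cone" by blast
  define \<Psi> where "\<Psi> p = Abs_rcl (to_closure p)" for p :: "'d rpoly"
  have mem: "to_closure p \<in> cone_diffs max_cone" for p :: "'d rpoly"
  proof -
    have "p \<in> the_cone \<or> - p \<in> the_cone" by (rule the_cone_props)
    then show ?thesis
    proof
      assume "p \<in> the_cone"
      then show ?thesis using max_cone(2) field_coneD(7)[OF max_cone(1)] by blast
    next
      assume "- p \<in> the_cone"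
      then have "to_closure (- p) \<in> cone_diffs max_cone" using max_cone(2) field_coneD(7)[OF max_cone(1)] by blast
      from cone_diffs_closed(2)[OF max_cone(1) field_coneD(7)[OF max_cone(1) field_coneD(1)[OF max_cone(1)]] this]
      show ?thesis by (simp add: ringhomD(5)[OF ringhom_to_closure])
    qed
  qed
  have rep: "Rep_rcl (\<Psi> p) = to_closure p" for p using mem unfolding \<Psi>_def by (rule Abs_rcl_inverse)
  have "ringhom \<Psi>"
    unfolding ringhom_def Rep_rcl_inject[symmetric]
    by (simp add: rep one_rcl.rep_eq plus_rcl.rep_eq times_rcl.rep_eq ringhomD(1-3)[OF ringhom_to_closure])
  have pos: "0 \<le> \<Psi> p" if "p \<in> the_cone" for p
    unfolding rcl_le_iff rep using that max_cone(2) by blast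
  have "0 \<le> \<Psi> (Const c)" if "0 \<le> c" for c
    using that the_cone_props(3)[of "Const (sqrt c)"] by (intro pos) (simp flip: Const_power)
  from transfer_signs[OF \<open>ringhom \<Psi>\<close> this, of H]
  obtain x where x: "\<forall>c\<in>H. sg (peval c x) = sg (\<Psi> c)" using H(1) unfolding unrealizable_def by blast
  have "0 \<le> peval c x" if c: "c \<in> H" for c
  proof -
    have "0 \<le> \<Psi> c" using pos c H(2) by blast
    then show ?thesis using bspec[OF x c] unfolding sg_eq_iff by (metis linorder_not_less)
  qed
  then have "x \<in> nonneg_set H" unfolding nonneg_set_def by blast
  then show False using H(1) unfolding unrealizable_def by blast
qed

section \<open>Compact basic closed sets have Archimedean preorderings\<close>

lemma ring_preordering_quadratic_module:
  "ring_preordering T \<Longrightarrow> quadratic_module T"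
  unfolding quadratic_module_def by (intro conjI ballI allI ring_preorderingD)

text \<open>The elements bounded in both directions by constants form a subring that contains the
  constants, and also each variable, because its square is bounded once the other squares are
  added.\<close>

lemma archimedean_of_ball:
  fixes T :: "'d::finite rpoly set"
  assumes T: "ring_preordering T" and N: "Const N - (\<Sum>i\<in>UNIV. (Var i)\<^sup>2) \<in> T"
  shows "archimedean T"
proof -
  note q = ring_preorderingD[OF T]
  have M: "quadratic_module T" using T by (rule ring_preordering_quadratic_module)
  have bounded: "\<exists>k\<ge>0. Const k - a \<in> T \<and> Const k + a \<in> T" for a
  proof (induction a rule: rpoly_induct)
    case (const c)
    show ?case
    proof (intro exI[of _ "\<bar>c\<bar>"] conjI)
      show "Const \<bar>c\<bar> - Const c \<in> T" "Const \<bar>c\<bar> + Const c \<in> T"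
        unfolding Const_add[symmetric] Const_diff[symmetric] by (intro qm_Const[OF M]; simp)+
    qed simp
  next
    case (var i)
    have "(\<Sum>j\<in>UNIV - {i}. (Var j)\<^sup>2) \<in> T" by (intro qm_sum[OF M] q)
    from q(1)[OF N this] have N': "Const N - (Var i)\<^sup>2 \<in> T"
      by (simp add: sum.remove[of UNIV i] algebra_simps)
    have *: "Const ((\<bar>N\<bar> + 1) / 2) - b \<in> T" if b: "Const N - b\<^sup>2 \<in> T" for b
    proof (rule qm_Const_mult_cancel[OF M, of 2])
      have "Const 2 * (Const ((\<bar>N\<bar> + 1) / 2) - b) = (1 - b)\<^sup>2 + ((Const N - b\<^sup>2) + Const (\<bar>N\<bar> - N))"
        by (simp add: Const_diff Const_add Const_numeral algebra_simps power2_eq_square flip: Const_mult)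
          (simp add: Const_add flip: Const_numeral Const_mult)
      also have "\<dots> \<in> T" by (intro q b qm_Const[OF M]) simp
      finally show "Const 2 * (Const ((\<bar>N\<bar> + 1) / 2) - b) \<in> T" .
    qed simp
    show ?case using *[of "Var i"] *[of "- Var i"] N' by (intro exI[of _ "(\<bar>N\<bar> + 1) / 2"]) simp
  next
    case (add a b)
    then obtain k l where k: "k \<ge> 0" "Const k - a \<in> T" "Const k + a \<in> T" "l \<ge> 0" "Const l - b \<in> T" "Const l + b \<in> T"
      by blast
    from q(1)[OF k(2,5)] q(1)[OF k(3,6)] k(1,4) show ?case
      by (intro exI[of _ "k + l"]) (simp add: Const_add algebra_simps)
  next
    case (mult a b)
    then obtain k l where k: "k \<ge> 0" "Const k - a \<in> T" "Const k + a \<in> T" "l \<ge> 0" "Const l - b \<in> T" "Const l + b \<in> T"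
      by blast
    \<comment> \<open>Products of the four bounds are available in a preordering; in each
      combination the mixed terms cancel.\<close>
    have "Const 2 * (Const (k * l) - a * b) = (Const k - a) * (Const l + b) + (Const k + a) * (Const l - b)"
      "Const 2 * (Const (k * l) + a * b) = (Const k - a) * (Const l - b) + (Const k + a) * (Const l + b)"
      by (simp_all add: Const_mult Const_numeral algebra_simps)
    then have "Const 2 * (Const (k * l) - a * b) \<in> T" "Const 2 * (Const (k * l) + a * b) \<in> T"
      using q(1)[OF q(2)[OF k(2,6)] q(2)[OF k(3,5)]] q(1)[OF q(2)[OF k(2,5)] q(2)[OF k(3,6)]] by simp_all
    then have "Const (k * l) - a * b \<in> T" "Const (k * l) + a * b \<in> T"
      using qm_Const_mult_cancel[OF M, of 2] by simp_all
    then show ?case using k by (intro exI[of _ "k * l"]) simp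
  qed
  show ?thesis
    unfolding archimedean_def
  proof
    fix a
    obtain k where k: "Const k - a\<^sup>2 \<in> T" using bounded by blast
    obtain n :: nat where n: "k \<le> real n" using real_arch_simple by blast
    have "(Const k - a\<^sup>2) + Const (real n - k) \<in> T" using n by (intro q k qm_Const[OF M]) simp
    then show "\<exists>k. of_nat k - a\<^sup>2 \<in> T" by (intro exI[of _ n]) (simp add: Const_diff Const_of_nat)
  qed
qed

text \<open>Woermann's argument: the Positivstellensatz gives \<open>(R - \<Sum>x\<^sub>i\<^sup>2) t = 1 + s\<close> with \<open>s, t \<in> T\<close>, and
  \<open>T + (R - \<Sum>x\<^sub>i\<^sup>2) T\<close> is Archimedean. Multiplying by \<open>1 + s\<close> moves bounds from there to \<open>T\<close>.\<close>

theorem compact_po_gen_archimedean: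
  fixes G :: "'d::finite rpoly set"
  assumes fin: "finite G" and comp: "compact (nonneg_set G)"
  shows "archimedean (po_gen G)"
proof -
  define T where "T = po_gen G"
  have T: "ring_preordering T" unfolding T_def by (rule ring_preordering_po_gen)
  have GT: "G \<subseteq> T" unfolding T_def po_gen_def by blast
  note q = ring_preorderingD[OF T]
  have M: "quadratic_module T" using T by (rule ring_preordering_quadratic_module)
  obtain B where B: "\<And>x. x \<in> nonneg_set G \<Longrightarrow> norm x \<le> B" using compact_imp_bounded[OF comp] bounded_iff by blast
  define x2 where "x2 = (\<Sum>i\<in>UNIV. (Var i)\<^sup>2 :: 'd rpoly)"
  have x2T: "x2 \<in> T" unfolding x2_def by (intro qm_sum[OF M] q)
  \<comment> \<open>The additional \<open>1\<close> makes \<open>p\<close> strictly positive on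
    \<open>nonneg_set G\<close>, so that requiring \<open>- p\<close> to be nonnegative leaves no
    point.\<close>
  define R where "R = B\<^sup>2 + 1"
  define p where "p = Const R - x2"
  have px: "peval p x = R - (norm x)\<^sup>2" for x
    unfolding p_def x2_def by (simp add: norm_vec_def L2_set_def sum_nonneg)
  have "nonneg_set (insert (- p) G) = {}"
  proof (rule ccontr)
    assume "nonneg_set (insert (- p) G) \<noteq> {}"
    then obtain x where x: "0 \<le> peval (- p) x" "x \<in> nonneg_set G" unfolding nonneg_set_def by auto
    have "(norm x)\<^sup>2 \<le> B\<^sup>2" using B[OF x(2)] by (intro power_mono) auto
    then show False using x(1) by (simp add: px R_def)
  qed
  then have "-1 \<in> po_gen (insert (- p) G)" using fin by (intro weak_positivstellensatz) auto
  moreover have "po_gen (insert (- p) G) \<subseteq> {s + (- p) * t | s t. s \<in> T \<and> t \<in> T}"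
    unfolding po_gen_def using po_adjoin[OF T, of "- p"] GT by (intro Inter_lower) blast
  ultimately obtain s t where st: "s \<in> T" "t \<in> T" "-1 = s + (- p) * t" by blast
  have pt: "p * t = 1 + s" using arg_cong[OF st(3), of "\<lambda>z. z + p * t + 1"] by (simp add: algebra_simps)
  have arch: "archimedean {s + p * t | s t. s \<in> T \<and> t \<in> T}"
  proof (rule archimedean_of_ball[OF po_adjoin(1)[OF T]])
    show "Const R - (\<Sum>i\<in>UNIV. (Var i)\<^sup>2) \<in> {s + p * t | s t. s \<in> T \<and> t \<in> T}"
      using po_adjoin(3)[OF T, of p] unfolding p_def x2_def .
  qed
  obtain k where k: "0 < k" "Const k - s \<in> {s + p * t | s t. s \<in> T \<and> t \<in> T}"
    "Const k + s \<in> {s + p * t | s t. s \<in> T \<and> t \<in> T}"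
    by (rule archimedean_bounds[OF ring_preordering_quadratic_module[OF po_adjoin(1)[OF T]] arch])
  from k(2) obtain s1 t1 where st1: "s1 \<in> T" "t1 \<in> T" "Const k - s = s1 + p * t1" by blast
  \<comment> \<open>In \<open>(1 + s) * p * t1\<close> the first factor is \<open>p * t\<close>,
    which turns the unwanted \<open>p\<close> into the square \<open>p\<^sup>2\<close>.\<close>
  have "(1 + s) * (Const k - s) = (1 + s) * s1 + p\<^sup>2 * (t * t1)"
    unfolding st1(3) by (simp add: algebra_simps power2_eq_square flip: pt)
  also have "\<dots> \<in> T" by (intro q st st1)
  \<comment> \<open>The added square cancels \<open>- s\<^sup>2\<close> and the linear term
    \<open>k * s\<close>, so \<open>s\<close> is bounded above within \<open>T\<close>.\<close>
  finally have "(1 + s) * (Const k - s) + (Const (k / 2) - s)\<^sup>2 \<in> T" by (rule q(1)) (rule q(3))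
  also have "(1 + s) * (Const k - s) + (Const (k / 2) - s)\<^sup>2 = Const (k + k\<^sup>2 / 4) - s"
  proof -
    have e: "Const k = Const (k / 2) + (Const (k / 2) :: 'd rpoly)" by (simp flip: Const_add)
    have e': "Const (k + k\<^sup>2 / 4) = Const (k / 2) + Const (k / 2) + Const (k / 2) * (Const (k / 2) :: 'd rpoly)"
      by (simp add: power2_eq_square flip: Const_add Const_mult)
    show ?thesis unfolding e e' by (simp add: algebra_simps power2_eq_square)
  qed
  finally have sN: "Const (k + k\<^sup>2 / 4) - s \<in> T" .
  define N where "N = k + k\<^sup>2 / 4"
  have R0: "0 \<le> R" unfolding R_def by simp
  \<comment> \<open>Here \<open>p\<^sup>2 * t = p + s * p\<close>, and
    \<open>s * p + s * x2 = R * s\<close>, which the bound on \<open>s\<close> absorbs.\<close>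
  have "p\<^sup>2 * t + s * x2 + Const R * (Const N - s) \<in> T"
    using sN x2T R0 unfolding N_def by (intro q st qm_Const[OF M])
  also have "p\<^sup>2 * t + s * x2 + Const R * (Const N - s) = Const (R * (1 + N)) - x2"
  proof -
    have "p\<^sup>2 * t = p * (1 + s)" unfolding pt[symmetric] by (simp add: power2_eq_square algebra_simps)
    then show ?thesis unfolding p_def by (simp add: algebra_simps Const_add Const_mult)
  qed
  finally show ?thesis
    using archimedean_of_ball[OF T] unfolding x2_def T_def by blast
qed

section \<open>Polynomials as functions\<close>

lemma continuous_on_peval [continuous_intros]:
  "continuous_on S g \<Longrightarrow> continuous_on S (\<lambda>x. peval p (g x))"
  unfolding peval_def by (intro continuous_intros)

lemma peval_has_derivative_ex:
  fixes f :: "'d::finite rpoly"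
  shows "\<exists>D. \<forall>x. (peval f has_derivative (\<lambda>w. \<Sum>j\<in>UNIV. w $ j * peval (D j) x)) (at x)"
proof (induction f rule: rpoly_induct)
  case (const c)
  show ?case by (rule exI[of _ "\<lambda>_. 0"]) (simp add: peval_Const[abs_def])
next
  case (var i)
  have "((\<lambda>x. x $ i) has_derivative (\<lambda>w. \<Sum>j\<in>UNIV. w $ j * peval (if j = i then 1 else 0) x)) (at x)" for x :: "real ^ 'd"
  proof -
    have "(\<Sum>j\<in>UNIV. w $ j * peval (if j = i then 1 else 0) x) = w $ i" for w :: "real ^ 'd"
      by (simp add: if_distrib[of "\<lambda>p. peval p x"] mult_delta_right cong: if_cong)
    then show ?thesis using bounded_linear_imp_has_derivative[OF bounded_linear_vec_nth[of i]] by simp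
  qed
  then show ?case unfolding peval_Var[abs_def] by (intro exI[of _ "\<lambda>j. if j = i then 1 else 0"]) blast
next
  case (add p q)
  then obtain D E where
    D: "\<And>x. (peval p has_derivative (\<lambda>w. \<Sum>j\<in>UNIV. w $ j * peval (D j) x)) (at x)" and
    E: "\<And>x. (peval q has_derivative (\<lambda>w. \<Sum>j\<in>UNIV. w $ j * peval (E j) x)) (at x)" by blast
  have "(peval (p + q) has_derivative (\<lambda>w. \<Sum>j\<in>UNIV. w $ j * peval (D j + E j) x)) (at x)" for x
    using has_derivative_add[OF D[of x] E[of x]]
    by (simp add: peval_add[abs_def] sum.distrib distrib_left)
  then show ?case by (intro exI[of _ "\<lambda>j. D j + E j"]) blast
next
  case (mult p q)
  then obtain D E where
    D: "\<And>x. (peval p has_derivative (\<lambda>w. \<Sum>j\<in>UNIV. w $ j * peval (D j) x)) (at x)" and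
    E: "\<And>x. (peval q has_derivative (\<lambda>w. \<Sum>j\<in>UNIV. w $ j * peval (E j) x)) (at x)" by blast
  have "(peval (p * q) has_derivative (\<lambda>w. \<Sum>j\<in>UNIV. w $ j * peval (p * E j + D j * q) x)) (at x)" for x
    using has_derivative_mult[OF D[of x] E[of x]]
    by (simp add: peval_mult[abs_def] sum.distrib distrib_left sum_distrib_left sum_distrib_right mult_ac)
  then show ?case by (intro exI[of _ "\<lambda>j. p * E j + D j * q"]) blast
qed

text \<open>Any family of polynomials that represents the derivative will do: only its values are
  used, and these are determined by the function.\<close>

definition pdiff :: "'d::finite rpoly \<Rightarrow> 'd \<Rightarrow> 'd rpoly" where
  "pdiff f = (SOME D. \<forall>x. (peval f has_derivative (\<lambda>w. \<Sum>j\<in>UNIV. w $ j * peval (D j) x)) (at x))"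

lemma peval_has_derivative:
  "(peval f has_derivative (\<lambda>w. \<Sum>j\<in>UNIV. w $ j * peval (pdiff f j) x)) (at x)"
  using someI_ex[OF peval_has_derivative_ex[of f]] unfolding pdiff_def by blast

lemma peval_line_derivative:
  "((\<lambda>t. peval f (x + t *\<^sub>R w)) has_real_derivative
     (\<Sum>j\<in>UNIV. w $ j * peval (pdiff f j) (x + t *\<^sub>R w))) (at t)"
proof -
  have "((\<lambda>t. x + t *\<^sub>R w) has_derivative (\<lambda>s. s *\<^sub>R w)) (at t)"
    by (auto intro!: derivative_eq_intros)
  from has_derivative_compose[OF this peval_has_derivative, of f]
  have "((\<lambda>t. peval f (x + t *\<^sub>R w)) has_derivative
      (\<lambda>s. \<Sum>j\<in>UNIV. (s *\<^sub>R w) $ j * peval (pdiff f j) (x + t *\<^sub>R w))) (at t)" .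
  also have "(\<lambda>s. \<Sum>j\<in>UNIV. (s *\<^sub>R w) $ j * peval (pdiff f j) (x + t *\<^sub>R w))
      = (*) (\<Sum>j\<in>UNIV. w $ j * peval (pdiff f j) (x + t *\<^sub>R w))"
    by (rule ext) (simp add: sum_distrib_left mult_ac)
  finally show ?thesis unfolding has_field_derivative_def .
qed

lemma partial_peval: "partial j (peval f) = peval (pdiff f j)"
proof
  fix x
  have "((\<lambda>t. peval f (x + t *\<^sub>R axis j 1)) has_real_derivative (\<Sum>i\<in>UNIV. axis j 1 $ i * peval (pdiff f i) x)) (at 0)"
    using peval_line_derivative[of f x "axis j 1" 0] by simp
  also have "(\<Sum>i\<in>UNIV. axis j 1 $ i * peval (pdiff f i) x) = peval (pdiff f j) x"
    by (simp add: axis_def mult_delta_left)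
  finally show "partial j (peval f) x = peval (pdiff f j) x"
    unfolding partial_def by (rule DERIV_imp_deriv)
qed

lemma hessian_peval: "hessian (peval f) p = (\<chi> i j. peval (pdiff (pdiff f j) i) p)"
  by (simp add: hessian_def partial_peval)

lemma hessian_form:
  "w \<bullet> (hessian (peval f) p *v w) = (\<Sum>j\<in>UNIV. w $ j * (\<Sum>i\<in>UNIV. w $ i * peval (pdiff (pdiff f j) i) p))"
proof -
  have "w \<bullet> (hessian (peval f) p *v w) = (\<Sum>i\<in>UNIV. \<Sum>j\<in>UNIV. w $ i * (peval (pdiff (pdiff f j) i) p * w $ j))"
    by (simp add: inner_vec_def matrix_vector_mult_def hessian_peval sum_distrib_left)
  also have "\<dots> = (\<Sum>j\<in>UNIV. \<Sum>i\<in>UNIV. w $ i * (peval (pdiff (pdiff f j) i) p * w $ j))" by (rule sum.swap)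
  finally show ?thesis by (simp add: sum_distrib_left mult_ac)
qed

text \<open>One use of l'Hospital's rule suffices, since the limit of \<open>g' t / t\<close> is the
  derivative of \<open>g'\<close> at \<open>0\<close> by definition.\<close>

lemma peval_second_order:
  assumes f0: "peval f p = 0" and f1: "\<And>j. peval (pdiff f j) p = 0"
  shows "((\<lambda>t. peval f (p + t *\<^sub>R w) / t\<^sup>2) \<longlongrightarrow> (w \<bullet> (hessian (peval f) p *v w)) / 2) (at 0)"
proof -
  define g where "g t = peval f (p + t *\<^sub>R w)" for t
  define g' where "g' t = (\<Sum>j\<in>UNIV. w $ j * peval (pdiff f j) (p + t *\<^sub>R w))" for t
  have g: "(g has_real_derivative g' t) (at t)" for t
    unfolding g_def g'_def by (rule peval_line_derivative)
  have "(g' has_real_derivative (\<Sum>j\<in>UNIV. w $ j * (\<Sum>i\<in>UNIV. w $ i * peval (pdiff (pdiff f j) i) (p + 0 *\<^sub>R w)))) (at 0)"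
    unfolding g'_def by (intro DERIV_sum DERIV_cmult peval_line_derivative)
  then have "(g' has_real_derivative (w \<bullet> (hessian (peval f) p *v w))) (at 0)"
    unfolding hessian_form by simp
  moreover have "g' 0 = 0" unfolding g'_def by (simp add: f1)
  ultimately have "((\<lambda>t. g' t / t) \<longlongrightarrow> w \<bullet> (hessian (peval f) p *v w)) (at 0)"
    unfolding has_field_derivative_iff by simp
  from tendsto_divide[OF this tendsto_const[of 2]]
  have lim: "((\<lambda>t. g' t / (2 * t)) \<longlongrightarrow> (w \<bullet> (hessian (peval f) p *v w)) / 2) (at 0)"
    by (simp add: mult.commute)
  have "((\<lambda>t. g t / t\<^sup>2) \<longlongrightarrow> (w \<bullet> (hessian (peval f) p *v w)) / 2) (at 0)"
  proof (rule lhopital[OF _ _ _ _ _ _ lim])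
    have "(g \<longlongrightarrow> g 0) (at 0)" using DERIV_isCont[OF g] by (simp add: isCont_def)
    then show "(g \<longlongrightarrow> 0) (at 0)" by (simp add: g_def f0)
    show "((\<lambda>t. t\<^sup>2) \<longlongrightarrow> 0) (at (0::real))" by (auto intro!: tendsto_eq_intros)
    show "\<forall>\<^sub>F t in at (0::real). t\<^sup>2 \<noteq> 0" "\<forall>\<^sub>F t in at (0::real). 2 * t \<noteq> 0"
      by (simp_all add: eventually_at_filter)
    show "\<forall>\<^sub>F t in at 0. (g has_real_derivative g' t) (at t)" using g by simp
    show "\<forall>\<^sub>F t in at (0::real). ((\<lambda>t. t\<^sup>2) has_real_derivative 2 * t) (at t)"
      by (intro always_eventually allI) (auto intro!: derivative_eq_intros)
  qed
  then show ?thesis unfolding g_def .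
qed

lemma real_polynomial_function_peval:
  assumes "real_polynomial_function g"
  shows "\<exists>p. \<forall>x :: real ^ 'd::finite. g x = peval p x"
  using assms
proof induction
  case (linear f)
  have "f x = peval (\<Sum>i\<in>UNIV. Const (f (axis i 1)) * Var i) x" for x
  proof -
    have "f x = f (\<Sum>i\<in>UNIV. x $ i *\<^sub>R axis i 1)"
      using basis_expansion[of x] by (simp add: scalar_mult_eq_scaleR)
    also have "\<dots> = (\<Sum>i\<in>UNIV. x $ i * f (axis i 1))"
      by (simp add: linear.hyps linear_sum[OF bounded_linear.linear[OF linear.hyps]] linear_cmul[OF bounded_linear.linear[OF linear.hyps]])
    finally show ?thesis by (simp add: mult.commute)
  qed
  then show ?case by blast
next
  case (const c)
  show ?case by (rule exI[of _ "Const c"]) simp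
next
  case (add f g)
  then obtain p q where "\<And>x. f x = peval p x" "\<And>x. g x = peval q x" by blast
  then show ?case by (intro exI[of _ "p + q"]) simp
next
  case (mult f g)
  then obtain p q where "\<And>x. f x = peval p x" "\<And>x. g x = peval q x" by blast
  then show ?case by (intro exI[of _ "p * q"]) simp
qed

lemma peval_approx:
  fixes g :: "real ^ 'd::finite \<Rightarrow> real"
  assumes "compact K" "continuous_on K g" "0 < e"
  shows "\<exists>p. \<forall>x\<in>K. \<bar>g x - peval p x\<bar> < e"
proof -
  obtain h where h: "real_polynomial_function h" "\<And>x. x \<in> K \<Longrightarrow> \<bar>g x - h x\<bar> < e"
    using Stone_Weierstrass_real_polynomial_function[OF assms] by blast
  obtain p where p: "\<And>x. h x = peval p x" using real_polynomial_function_peval[OF h(1)] by blast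
  show ?thesis using h(2) unfolding p by blast
qed

section \<open>Positive definite polynomial matrices\<close>

text \<open>One pivot \<open>a p p\<close> is split off at a time. It is positive on
  \<open>K\<close>, so dividing by its root preserves continuity, and the Schur complement
  \<open>a'\<close> is again positive definite.\<close>

lemma continuous_cholesky:
  fixes a :: "'n \<Rightarrow> 'n \<Rightarrow> 'x::topological_space \<Rightarrow> real"
  assumes "finite S" "\<And>i j x. a i j x = a j i x" "\<And>i j. continuous_on K (a i j)"
    and "\<And>x v. x \<in> K \<Longrightarrow> \<exists>i\<in>S. v i \<noteq> 0 \<Longrightarrow> 0 < (\<Sum>i\<in>S. \<Sum>j\<in>S. a i j x * v i * v j)"
  shows "\<exists>b. (\<forall>k i. continuous_on K (b k i)) \<and> (\<forall>x\<in>K. \<forall>i\<in>S. \<forall>j\<in>S. a i j x = (\<Sum>k\<in>S. b k i x * b k j x))"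
  using assms
proof (induction S arbitrary: a)
  case empty
  show ?case by (rule exI[of _ "\<lambda>_ _ _. 0"]) simp
next
  case (insert p S)
  note sym = insert.prems(1) and cont = insert.prems(2) and pd = insert.prems(3)
  have pp: "0 < a p p x" if "x \<in> K" for x
  proof -
    have "(\<Sum>i\<in>insert p S. \<Sum>j\<in>insert p S. a i j x * (if i = p then 1 else 0) * (if j = p then 1 else 0)) = a p p x"
      using insert.hyps by (simp add: mult_delta_right mult_delta_left)
    then show ?thesis using pd[OF that, of "\<lambda>i. if i = p then 1 else 0"] by simp
  qed
  define d where "d i x = a p i x / sqrt (a p p x)" for i x
  have cd: "continuous_on K (d i)" for i
    unfolding d_def using pp by (intro continuous_intros cont) (force simp: less_imp_neq)
  define a' where "a' i j x = a i j x - d i x * d j x" for i j x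
  have "\<exists>b. (\<forall>k i. continuous_on K (b k i)) \<and> (\<forall>x\<in>K. \<forall>i\<in>S. \<forall>j\<in>S. a' i j x = (\<Sum>k\<in>S. b k i x * b k j x))"
  proof (rule insert.IH)
    show "a' i j x = a' j i x" for i j x unfolding a'_def using sym by (simp add: mult.commute)
    show "continuous_on K (a' i j)" for i j unfolding a'_def by (intro continuous_intros cont cd)
    fix x and v :: "'n \<Rightarrow> real" assume x: "x \<in> K" and v: "\<exists>i\<in>S. v i \<noteq> 0"
    define r where "r = sqrt (a p p x)"
    have r: "0 < r" "r * r = a p p x" using pp[OF x] unfolding r_def by simp_all
    define L where "L = (\<Sum>i\<in>S. d i x * v i)"
    \<comment> \<open>The value at \<open>p\<close> minimizes the form in that coordinate; the
      minimum is the form of the Schur complement at \<open>v\<close>.\<close>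
    define v' where "v' i = (if i = p then - L / r else v i)" for i
    have v'S: "v' i = v i" if "i \<in> S" for i using that insert.hyps unfolding v'_def by auto
    have api: "a p i x = r * d i x" for i using r unfolding d_def r_def[symmetric] by simp
    have vp: "v' p = - L / r" by (simp add: v'_def)
    have "0 < (\<Sum>i\<in>insert p S. \<Sum>j\<in>insert p S. a i j x * v' i * v' j)"
      using v v'S by (intro pd[OF x]) auto
    also have "\<dots> = a p p x * v' p * v' p + (\<Sum>j\<in>S. a p j x * v' p * v j)
        + ((\<Sum>i\<in>S. a i p x * v i * v' p) + (\<Sum>i\<in>S. \<Sum>j\<in>S. a i j x * v i * v j))"
      using insert.hyps by (simp add: v'S sum.distrib)
    also have "(\<Sum>j\<in>S. a p j x * v' p * v j) = r * v' p * L"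
      unfolding L_def sum_distrib_left api by (intro sum.cong) auto
    also have "(\<Sum>i\<in>S. a i p x * v i * v' p) = r * v' p * L"
      unfolding L_def sum_distrib_left sym[of _ p] api by (intro sum.cong) auto
    also have "a p p x * v' p * v' p + r * v' p * L + (r * v' p * L + (\<Sum>i\<in>S. \<Sum>j\<in>S. a i j x * v i * v j))
        = (\<Sum>i\<in>S. \<Sum>j\<in>S. a i j x * v i * v j) - L * L"
      unfolding r(2)[symmetric] vp using r(1) by (simp add: field_simps)
    also have "L * L = (\<Sum>i\<in>S. \<Sum>j\<in>S. d i x * d j x * v i * v j)"
      unfolding L_def sum_product by (intro sum.cong) auto
    finally show "0 < (\<Sum>i\<in>S. \<Sum>j\<in>S. a' i j x * v i * v j)"
      by (simp add: a'_def algebra_simps sum_subtractf)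
  qed
  then obtain b where b: "\<And>k i. continuous_on K (b k i)"
    "\<And>x i j. x \<in> K \<Longrightarrow> i \<in> S \<Longrightarrow> j \<in> S \<Longrightarrow> a' i j x = (\<Sum>k\<in>S. b k i x * b k j x)" by blast
  define c where "c k i = (if k = p then (if i = p then (\<lambda>x. sqrt (a p p x)) else d i) else if i = p then (\<lambda>x. 0) else b k i)" for k i
  have "continuous_on K (c k i)" for k i
    unfolding c_def by (auto intro!: continuous_intros cont cd b)
  moreover have "a i j x = (\<Sum>k\<in>insert p S. c k i x * c k j x)"
    if x: "x \<in> K" and ij: "i \<in> insert p S" "j \<in> insert p S" for x i j
  proof -
    have S: "(\<Sum>k\<in>S. c k i x * c k j x) = (\<Sum>k\<in>S. if i = p \<or> j = p then 0 else b k i x * b k j x)"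
      using insert.hyps by (intro sum.cong) (auto simp: c_def)
    have r: "sqrt (a p p x) * d i x = a p i x" for i using pp[OF x] unfolding d_def by simp
    have "(\<Sum>k\<in>insert p S. c k i x * c k j x) = c p i x * c p j x + (\<Sum>k\<in>S. c k i x * c k j x)"
      using insert.hyps by simp
    also have "\<dots> = a i j x"
    proof (cases "i = p")
      case True
      then show ?thesis using pp[OF x] r[of j] unfolding S by (cases "j = p") (simp_all add: c_def)
    next
      case i: False
      show ?thesis
      proof (cases "j = p")
        case True
        then show ?thesis using i r[of i] sym[of i p x] unfolding S by (simp add: c_def mult.commute)
      next
        case False
        then have "a' i j x = (\<Sum>k\<in>S. b k i x * b k j x)" using b(2)[OF x] i ij by simp
        then show ?thesis using i False unfolding S by (simp add: c_def a'_def)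
      qed
    qed
    finally show ?thesis by simp
  qed
  ultimately show ?case by blast
qed

text \<open>With a small \<open>e\<close> subtracted from the diagonal the form is still positive
  definite, hence a Gram matrix of continuous functions. Polynomial approximations \<open>B\<close>
  of these leave an error matrix \<open>E\<close> that is small on \<open>K\<close>, and the
  reserved \<open>e\<close> times the sum of the squares of the \<open>q i\<close> pays for
  it.\<close>

lemma pd_form_in_qm:
  fixes M :: "'d::finite rpoly set" and A :: "'n::finite \<Rightarrow> 'n \<Rightarrow> 'd rpoly"
  assumes M: "quadratic_module M" and ar: "archimedean M"
    and K: "K = {x. \<forall>a\<in>M. 0 \<le> peval a x}" "compact K"
    and sym: "\<And>i j. A i j = A j i"
    and pd: "\<And>x v. x \<in> K \<Longrightarrow> norm v = 1 \<Longrightarrow> 0 < (\<Sum>i\<in>UNIV. \<Sum>j\<in>UNIV. peval (A i j) x * v $ i * v $ j)"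
  shows "(\<Sum>i\<in>UNIV. \<Sum>j\<in>UNIV. A i j * q i * q j) \<in> M"
proof -
  define F where "F z = (\<Sum>i\<in>UNIV. \<Sum>j\<in>UNIV. peval (A i j) (fst z) * snd z $ i * snd z $ j)" for z :: "(real ^ 'd) \<times> (real ^ 'n)"
  have contF: "continuous_on U F" for U unfolding F_def by (intro continuous_intros)
  have "\<exists>e>0. \<forall>x\<in>K. \<forall>v. norm v = 1 \<longrightarrow> e < F (x, v)"
  proof (cases "\<exists>x (v :: real ^ 'n). x \<in> K \<and> norm v = 1")
    case False
    then show ?thesis by (intro exI[of _ 1] conjI ballI allI impI) (simp, blast)
  next
    case True
    then have ne: "K \<times> sphere (0 :: real ^ 'n) 1 \<noteq> {}" by (simp, blast)
    have "compact (K \<times> sphere (0 :: real ^ 'n) 1)" using K(2) by (intro compact_Times) auto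
    from continuous_attains_inf[OF this ne contF] obtain z0 where
      z0: "z0 \<in> K \<times> sphere (0 :: real ^ 'n) 1" "\<And>z. z \<in> K \<times> sphere (0 :: real ^ 'n) 1 \<Longrightarrow> F z0 \<le> F z" by blast
    obtain x0 v0 where z: "z0 = (x0, v0)" by (cases z0)
    have 0: "x0 \<in> K" "norm v0 = 1" using z0(1) unfolding z by simp_all
    have 1: "F (x0, v0) \<le> F (x, v)" if "x \<in> K" "norm v = 1" for x v
      using z0(2)[of "(x, v)"] that unfolding z by simp
    have "0 < F (x0, v0)" using pd[OF 0] unfolding F_def by simp
    then have "F (x0, v0) / 2 < F (x0, v0)" by simp
    show ?thesis
    proof (intro exI[of _ "F (x0, v0) / 2"] conjI ballI allI impI)
      show "0 < F (x0, v0) / 2" using \<open>0 < F (x0, v0)\<close> by simp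
      show "F (x0, v0) / 2 < F (x, v)" if "x \<in> K" "norm v = 1" for x v
        using 1[OF that] \<open>F (x0, v0) / 2 < F (x0, v0)\<close> by linarith
    qed
  qed
  then obtain e where e: "0 < e" "\<And>x v. x \<in> K \<Longrightarrow> norm v = 1 \<Longrightarrow> e < F (x, v)" by blast
  define a where "a i j x = peval (A i j) x - (if i = j then e else 0)" for i j x
  have "\<exists>b. (\<forall>k i. continuous_on K (b k i)) \<and> (\<forall>x\<in>K. \<forall>i\<in>UNIV. \<forall>j\<in>UNIV. a i j x = (\<Sum>k\<in>(UNIV :: 'n set). b k i x * b k j x))"
  proof (rule continuous_cholesky)
    show "a i j x = a j i x" for i j x unfolding a_def by (simp add: sym[of i j])
    show "continuous_on K (a i j)" for i j unfolding a_def by (intro continuous_intros)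
    fix x and v :: "'n \<Rightarrow> real" assume x: "x \<in> K" and v: "\<exists>i\<in>UNIV. v i \<noteq> 0"
    define u where "u = (\<chi> i. v i)"
    have "u \<noteq> 0" using v unfolding u_def by (auto simp: vec_eq_iff)
    define w where "w = (1 / norm u) *\<^sub>R u"
    have w: "norm w = 1" using \<open>u \<noteq> 0\<close> unfolding w_def by simp
    have Fu: "F (x, u) = (norm u)\<^sup>2 * F (x, w)"
      using \<open>u \<noteq> 0\<close> unfolding F_def w_def by (simp add: sum_distrib_left field_simps power2_eq_square)
    have "(norm u)\<^sup>2 * e < F (x, u)"
      unfolding Fu using e(2)[OF x w] \<open>u \<noteq> 0\<close> by simp
    moreover have "(norm u)\<^sup>2 = (\<Sum>i\<in>UNIV. v i * v i)"
      unfolding u_def norm_vec_def L2_set_def by (simp add: sum_nonneg power2_eq_square)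
    moreover have "(\<Sum>i\<in>UNIV. \<Sum>j\<in>UNIV. a i j x * v i * v j) = F (x, u) - e * (\<Sum>i\<in>UNIV. v i * v i)"
    proof -
      have "a i j x * v i * v j = peval (A i j) x * v i * v j - (if i = j then e * (v i * v j) else 0)" for i j
        unfolding a_def by (simp add: algebra_simps)
      then show ?thesis
        unfolding F_def u_def by (simp add: sum_subtractf sum_distrib_left)
    qed
    ultimately show "0 < (\<Sum>i\<in>UNIV. \<Sum>j\<in>UNIV. a i j x * v i * v j)" by (simp add: mult.commute)
  qed simp
  then obtain b where b: "\<And>k i. continuous_on K (b k i)" "\<And>x i j. x \<in> K \<Longrightarrow> a i j x = (\<Sum>k\<in>(UNIV :: 'n set). b k i x * b k j x)"
    by blast
  have "\<exists>C. \<forall>x\<in>K. \<bar>b k i x\<bar> \<le> C" for k i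
    using compact_imp_bounded[OF compact_continuous_image[OF b(1) K(2)], of k i] unfolding bounded_iff by auto
  then obtain C0 where C0: "\<And>k i x. x \<in> K \<Longrightarrow> \<bar>b k i x\<bar> \<le> C0 k i" by metis
  define C where "C = (\<Sum>k\<in>UNIV. \<Sum>i\<in>UNIV. \<bar>C0 k i\<bar>)"
  have C: "\<bar>b k i x\<bar> \<le> C" if "x \<in> K" for k i x
  proof -
    have "C0 k i \<le> \<bar>C0 k i\<bar>" by simp
    also have "\<dots> \<le> (\<Sum>i\<in>UNIV. \<bar>C0 k i\<bar>)" by (rule member_le_sum) auto
    also have "\<dots> \<le> C" unfolding C_def by (rule member_le_sum[of k UNIV "\<lambda>k. \<Sum>i\<in>UNIV. \<bar>C0 k i\<bar>"]) (auto intro: sum_nonneg)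
    finally show ?thesis using C0[OF that, of k i] by linarith
  qed
  have C_nonneg: "0 \<le> C" unfolding C_def by (intro sum_nonneg) auto
  define N where "N = real CARD('n)"
  have N: "0 < N" unfolding N_def by simp
  define \<eta> where "\<eta> = e / N"
  have \<eta>: "0 < \<eta>" "N * \<eta> = e" using N e(1) unfolding \<eta>_def by auto
  \<comment> \<open>If each factor changes by less than \<open>\<delta>\<close>, a product of two
    entries changes by at most \<open>\<delta> * (2 * C + 1)\<close>, and \<open>N\<close> products
    are summed. The factor \<open>2\<close> makes the resulting bound strict, and the minimum with
    \<open>1\<close> keeps the approximations below \<open>C + 1\<close>.\<close>
  define \<delta> where "\<delta> = min 1 (\<eta> / (2 * N * (2 * C + 1)))"
  have \<delta>: "0 < \<delta>" "\<delta> \<le> 1" "N * (\<delta> * (2 * C + 1)) < \<eta>"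
  proof -
    show "0 < \<delta>" "\<delta> \<le> 1" using \<eta> N C_nonneg unfolding \<delta>_def by auto
    have pos: "0 < 2 * N * (2 * C + 1)" using N C_nonneg by simp
    have "\<delta> \<le> \<eta> / (2 * N * (2 * C + 1))" unfolding \<delta>_def by simp
    then have "\<delta> * (2 * N * (2 * C + 1)) \<le> \<eta>" using pos by (simp add: pos_le_divide_eq)
    then show "N * (\<delta> * (2 * C + 1)) < \<eta>" using \<eta>(1) by (simp add: algebra_simps)
  qed
  have "\<exists>p. \<forall>x\<in>K. \<bar>b k i x - peval p x\<bar> < \<delta>" for k i
    using peval_approx[OF K(2) b(1) \<delta>(1)] .
  then obtain B where B: "\<And>k i x. x \<in> K \<Longrightarrow> \<bar>b k i x - peval (B k i) x\<bar> < \<delta>" by metis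
  define E where "E i j = A i j - (if i = j then Const e else 0) - (\<Sum>k\<in>UNIV. B k i * B k j)" for i j
  have E: "\<bar>peval (E i j) x\<bar> < \<eta>" if x: "x \<in> K" for i j x
  proof -
    have "peval (E i j) x = (\<Sum>k\<in>UNIV. b k i x * b k j x - peval (B k i) x * peval (B k j) x)"
      using b(2)[OF x, of i j] unfolding E_def a_def by (cases "i = j") (simp_all add: sum_subtractf)
    also have "\<bar>\<dots>\<bar> \<le> (\<Sum>k\<in>(UNIV :: 'n set). \<delta> * (2 * C + 1))"
    proof (rule order_trans[OF sum_abs], rule sum_mono)
      fix k
      have "b k i x * b k j x - peval (B k i) x * peval (B k j) x
          = (b k i x - peval (B k i) x) * peval (B k j) x + b k i x * (b k j x - peval (B k j) x)"
        by (simp add: algebra_simps)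
      also have "\<bar>\<dots>\<bar> \<le> \<bar>b k i x - peval (B k i) x\<bar> * \<bar>peval (B k j) x\<bar> + \<bar>b k i x\<bar> * \<bar>b k j x - peval (B k j) x\<bar>"
        by (metis abs_mult abs_triangle_ineq)
      also have "\<dots> \<le> \<delta> * (C + 1) + C * \<delta>"
      proof (intro add_mono mult_mono)
        show "\<bar>peval (B k j) x\<bar> \<le> C + 1" using B[OF x, of k j] C[OF x, of k j] \<delta>(2) by linarith
      qed (use B[OF x, of k i] B[OF x, of k j] C[OF x] \<delta>(1) C_nonneg in \<open>auto simp: less_imp_le\<close>)
      finally show "\<bar>b k i x * b k j x - peval (B k i) x * peval (B k j) x\<bar> \<le> \<delta> * (2 * C + 1)"
        by (simp add: algebra_simps)
    qed
    also have "\<dots> = N * (\<delta> * (2 * C + 1))" unfolding N_def by simp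
    finally show ?thesis using \<delta>(3) by linarith
  qed
  have Epos: "Const \<eta> + E i j \<in> M" "Const \<eta> - E i j \<in> M" for i j
  proof -
    have Kx: "x \<in> K" if "\<And>a. a \<in> M \<Longrightarrow> 0 \<le> peval a x" for x using that unfolding K(1) by blast
    show "Const \<eta> + E i j \<in> M" "Const \<eta> - E i j \<in> M"
      by (rule archimedean_positivstellensatz[OF M ar]; drule Kx; use E[of _ i j] in \<open>fastforce simp: abs_less_iff\<close>)+
  qed
  define S1 where "S1 = (\<Sum>k\<in>UNIV. (\<Sum>i\<in>UNIV. B k i * q i)\<^sup>2)"
  \<comment> \<open>Each summand equals \<open>E i j * q i * q j + \<eta> / 2 * ((q i)\<^sup>2 + (q
    j)\<^sup>2)\<close>, now with multipliers that are positive on \<open>K\<close>. In the double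
    sum every square occurs \<open>2 * N\<close> times, which adds up to exactly
    \<open>e = N * \<eta>\<close>.\<close>
  define S2 where "S2 = (\<Sum>i\<in>UNIV. \<Sum>j\<in>UNIV. Const (1/4) * ((q i + q j)\<^sup>2 * (Const \<eta> + E i j))
      + Const (1/4) * ((q i - q j)\<^sup>2 * (Const \<eta> - E i j)))"
  note qM = quadratic_moduleD[OF M]
  have "S1 + S2 \<in> M"
    unfolding S1_def S2_def by (intro qM(2,3,5) qm_sum[OF M] qm_Const_mult[OF M] Epos) auto
  also have "S1 + S2 = (\<Sum>i\<in>UNIV. \<Sum>j\<in>UNIV. A i j * q i * q j)"
  proof -
    have quarter: "Const (1/4) * (c + c + c + c) = c" for c :: "'d rpoly"
    proof -
      have "Const (1/4) * (c + c + c + c) = (Const (1/4) + Const (1/4) + Const (1/4) + Const (1/4)) * c"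
        by (simp add: algebra_simps)
      then show ?thesis by (simp flip: Const_add)
    qed
    have half: "Const (1/4) * (c + c) = Const (1/2) * c" for c :: "'d rpoly"
    proof -
      have "Const (1/4) * (c + c) = (Const (1/4) + Const (1/4)) * c" by (simp add: algebra_simps)
      then show ?thesis by (simp flip: Const_add)
    qed
    have summand: "Const (1/4) * ((q i + q j)\<^sup>2 * (Const \<eta> + E i j)) + Const (1/4) * ((q i - q j)\<^sup>2 * (Const \<eta> - E i j))
        = E i j * q i * q j + Const (\<eta> / 2) * (q i)\<^sup>2 + Const (\<eta> / 2) * (q j)\<^sup>2" for i j
    proof -
      have "Const (1/4) * ((q i + q j)\<^sup>2 * (Const \<eta> + E i j)) + Const (1/4) * ((q i - q j)\<^sup>2 * (Const \<eta> - E i j))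
        = Const (1/4) * (E i j * q i * q j + E i j * q i * q j + E i j * q i * q j + E i j * q i * q j)
         + Const (1/4) * (Const \<eta> * (q i)\<^sup>2 + Const \<eta> * (q i)\<^sup>2) + Const (1/4) * (Const \<eta> * (q j)\<^sup>2 + Const \<eta> * (q j)\<^sup>2)"
        by (simp add: algebra_simps power2_eq_square)
      then show ?thesis unfolding quarter half by (simp add: mult.assoc[symmetric] Const_mult[symmetric])
    qed
    have card: "(\<Sum>j\<in>(UNIV::'n set). Const (\<eta> / 2) * c) = Const (e / 2) * c" for c :: "'d rpoly"
      using \<eta>(2) unfolding N_def
      by (simp add: Const_of_nat[symmetric] mult.assoc[symmetric] Const_mult[symmetric])
    have "(\<Sum>i\<in>UNIV. \<Sum>j\<in>(UNIV::'n set). Const (\<eta> / 2) * (q i)\<^sup>2) = (\<Sum>i\<in>UNIV. Const (e / 2) * (q i)\<^sup>2)"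
      by (simp only: card)
    moreover have "(\<Sum>i\<in>(UNIV::'n set). \<Sum>j\<in>UNIV. Const (\<eta> / 2) * (q j)\<^sup>2) = (\<Sum>i\<in>UNIV. Const (e / 2) * (q i)\<^sup>2)"
      by (subst sum.swap) (simp only: card)
    moreover have "(\<Sum>i\<in>UNIV. Const (e / 2) * (q i)\<^sup>2) + (\<Sum>i\<in>UNIV. Const (e / 2) * (q i)\<^sup>2) = (\<Sum>i\<in>UNIV. Const e * (q i)\<^sup>2)"
      unfolding sum.distrib[symmetric] distrib_right[symmetric] Const_add[symmetric] by simp
    ultimately have S2: "S2 = (\<Sum>i\<in>UNIV. \<Sum>j\<in>UNIV. E i j * q i * q j) + (\<Sum>i\<in>UNIV. Const e * (q i)\<^sup>2)"
      unfolding S2_def summand sum.distrib by (simp add: add.assoc)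
    have S1: "S1 = (\<Sum>i\<in>UNIV. \<Sum>j\<in>UNIV. (\<Sum>k\<in>UNIV. B k i * B k j) * q i * q j)"
    proof -
      have "S1 = (\<Sum>k\<in>UNIV. \<Sum>i\<in>UNIV. \<Sum>j\<in>UNIV. B k i * B k j * q i * q j)"
        unfolding S1_def power2_eq_square sum_product by (intro sum.cong refl) (simp add: mult_ac)
      also have "\<dots> = (\<Sum>i\<in>UNIV. \<Sum>k\<in>UNIV. \<Sum>j\<in>UNIV. B k i * B k j * q i * q j)" by (rule sum.swap)
      also have "\<dots> = (\<Sum>i\<in>UNIV. \<Sum>j\<in>UNIV. \<Sum>k\<in>UNIV. B k i * B k j * q i * q j)"
        by (intro sum.cong refl sum.swap)
      finally show ?thesis by (simp add: sum_distrib_right)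
    qed
    have D: "(\<Sum>i\<in>UNIV. \<Sum>j\<in>UNIV. (if i = j then Const e else 0) * q i * q j) = (\<Sum>i\<in>UNIV. Const e * (q i)\<^sup>2)"
      by (simp add: mult_delta_left power2_eq_square mult.assoc)
    have "(\<Sum>i\<in>UNIV. \<Sum>j\<in>UNIV. A i j * q i * q j) = (\<Sum>i\<in>UNIV. \<Sum>j\<in>UNIV. (\<Sum>k\<in>UNIV. B k i * B k j) * q i * q j)
        + ((\<Sum>i\<in>UNIV. \<Sum>j\<in>UNIV. E i j * q i * q j) + (\<Sum>i\<in>UNIV. \<Sum>j\<in>UNIV. (if i = j then Const e else 0) * q i * q j))"
      unfolding sum.distrib[symmetric] distrib_right[symmetric] E_def by (intro sum.cong refl) simp
    then show ?thesis unfolding S1 S2 D by simp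
  qed
  finally show ?thesis .
qed

section \<open>Nonnegative polynomials with nondegenerate interior zeros\<close>

definition upoly :: "'d::finite rpoly \<Rightarrow> real poly \<Rightarrow> 'd rpoly" where
  "upoly U P = poly (map_poly Const P) U"

lemma ringhom_Const: "ringhom (Const :: real \<Rightarrow> 'd::finite rpoly)"
  by (simp add: ringhom_def Const_add Const_mult)

lemma ringhom_upoly: "ringhom (upoly U)"
  by (simp add: ringhom_def upoly_def ringhomD(1-3)[OF ringhom_map_poly[OF ringhom_Const]])

lemma upoly_pCons: "upoly U (pCons a p) = Const a + U * upoly U p"
  by (simp add: upoly_def map_poly_pCons)

lemma upoly_0 [simp]: "upoly U 0 = 0"
  by (simp add: upoly_def)

lemma peval_upoly [simp]: "peval (upoly U P) x = poly P (peval U x)"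
  by (induction P) (simp_all add: upoly_pCons)

lemma peval_pdiff_unique:
  assumes "(peval f has_derivative (\<lambda>w. \<Sum>j\<in>UNIV. w $ j * c j)) (at x)"
  shows "peval (pdiff f j) x = c j"
proof -
  have "(\<lambda>w. \<Sum>j\<in>UNIV. w $ j * peval (pdiff f j) x) = (\<lambda>w. \<Sum>j\<in>UNIV. w $ j * c j)"
    by (rule has_derivative_unique[OF peval_has_derivative assms])
  from fun_cong[OF this, of "axis j 1"] show ?thesis
    by (simp add: axis_def mult_delta_left)
qed

lemma peval_pdiff_Const: "peval (pdiff (Const c) j) x = 0"
  by (rule peval_pdiff_unique) (simp add: peval_Const[abs_def])

lemma peval_pdiff_Var: "peval (pdiff (Var i) j) x = (if j = i then 1 else 0)"
proof (rule peval_pdiff_unique)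
  have "(\<lambda>w :: real ^ 'a. \<Sum>j\<in>UNIV. w $ j * (if j = i then 1 else 0)) = (\<lambda>w. w $ i)"
    by (simp add: mult_delta_right)
  then show "(peval (Var i) has_derivative (\<lambda>w. \<Sum>j\<in>UNIV. w $ j * (if j = i then 1 else 0))) (at x)"
    unfolding peval_Var[abs_def]
    using bounded_linear_imp_has_derivative[OF bounded_linear_vec_nth[of i]] by simp
qed

lemma peval_pdiff_add: "peval (pdiff (p + q) j) x = peval (pdiff p j) x + peval (pdiff q j) x"
  using has_derivative_add[OF peval_has_derivative[of p x] peval_has_derivative[of q x]]
  by (intro peval_pdiff_unique) (simp add: peval_add[abs_def] sum.distrib distrib_left)

lemma peval_pdiff_mult:
  "peval (pdiff (p * q) j) x = peval p x * peval (pdiff q j) x + peval (pdiff p j) x * peval q x"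
  using has_derivative_mult[OF peval_has_derivative[of p x] peval_has_derivative[of q x]]
  by (intro peval_pdiff_unique)
    (simp add: peval_mult[abs_def] sum.distrib distrib_left sum_distrib_left sum_distrib_right mult_ac)

text \<open>A first order Taylor expansion with remainder, not at one point but at the point with
  parameter \<open>U\<close> of the curve with coordinates \<open>L i\<close>. A curve through all
  zeros of \<open>f\<close> thus gives an expansion at all of them at once, and \<open>F\<close> and
  \<open>C\<close> are univariate.\<close>

lemma taylor_decomposition:
  fixes f U :: "'d::finite rpoly" and L :: "'d \<Rightarrow> real poly"
  defines "q \<equiv> \<lambda>i. Var i - upoly U (L i)"
  shows "\<exists>F C B. f = upoly U F + (\<Sum>i\<in>UNIV. upoly U (C i) * q i) + (\<Sum>i\<in>UNIV. \<Sum>j\<in>UNIV. B i j * q i * q j) \<and>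
    (\<forall>s. poly F s = peval f (\<chi> i. poly (L i) s)) \<and>
    (\<forall>s i. poly (C i) s = peval (pdiff f i) (\<chi> i. poly (L i) s))"
proof (induction f rule: rpoly_induct)
  case (const c)
  show ?case
    by (rule exI[of _ "[:c:]"], rule exI[of _ "\<lambda>_. 0"], rule exI[of _ "\<lambda>_ _. 0"])
      (simp add: upoly_pCons peval_pdiff_Const)
next
  case (var k)
  have "(\<Sum>i\<in>UNIV. upoly U (if i = k then 1 else 0) * q i) = q k"
    by (simp add: if_distrib[of "upoly U"] ringhomD(1)[OF ringhom_upoly] mult_delta_left cong: if_cong)
  then show ?case
    by (intro exI[of _ "L k"] exI[of _ "\<lambda>i. if i = k then 1 else 0"] exI[of _ "\<lambda>_ _. 0"])
      (simp add: peval_pdiff_Var q_def)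
next
  case (add f g)
  obtain F C B where f: "f = upoly U F + (\<Sum>i\<in>UNIV. upoly U (C i) * q i) + (\<Sum>i\<in>UNIV. \<Sum>j\<in>UNIV. B i j * q i * q j)"
    "\<And>s. poly F s = peval f (\<chi> i. poly (L i) s)" "\<And>s i. poly (C i) s = peval (pdiff f i) (\<chi> i. poly (L i) s)"
    using add.IH(1) by blast
  obtain F' C' B' where g: "g = upoly U F' + (\<Sum>i\<in>UNIV. upoly U (C' i) * q i) + (\<Sum>i\<in>UNIV. \<Sum>j\<in>UNIV. B' i j * q i * q j)"
    "\<And>s. poly F' s = peval g (\<chi> i. poly (L i) s)" "\<And>s i. poly (C' i) s = peval (pdiff g i) (\<chi> i. poly (L i) s)"
    using add.IH(2) by blast
  have "f + g = upoly U (F + F') + (\<Sum>i\<in>UNIV. upoly U (C i + C' i) * q i)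
      + (\<Sum>i\<in>UNIV. \<Sum>j\<in>UNIV. (B i j + B' i j) * q i * q j)"
    by (subst f(1), subst g(1)) (simp add: ringhomD(2)[OF ringhom_upoly] distrib_right sum.distrib algebra_simps)
  moreover have "poly (F + F') s = peval (f + g) (\<chi> i. poly (L i) s)"
    "poly (C i + C' i) s = peval (pdiff (f + g) i) (\<chi> i. poly (L i) s)" for s i
    by (simp_all add: f(2,3) g(2,3) peval_pdiff_add)
  ultimately show ?case
    by - (rule exI[of _ "F + F'"], rule exI[of _ "\<lambda>i. C i + C' i"], rule exI[of _ "\<lambda>i j. B i j + B' i j"], blast)
next
  case (mult f g)
  obtain F C B where f: "f = upoly U F + (\<Sum>i\<in>UNIV. upoly U (C i) * q i) + (\<Sum>i\<in>UNIV. \<Sum>j\<in>UNIV. B i j * q i * q j)"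
    "\<And>s. poly F s = peval f (\<chi> i. poly (L i) s)" "\<And>s i. poly (C i) s = peval (pdiff f i) (\<chi> i. poly (L i) s)"
    using mult.IH(1) by blast
  obtain F' C' B' where g: "g = upoly U F' + (\<Sum>i\<in>UNIV. upoly U (C' i) * q i) + (\<Sum>i\<in>UNIV. \<Sum>j\<in>UNIV. B' i j * q i * q j)"
    "\<And>s. poly F' s = peval g (\<chi> i. poly (L i) s)" "\<And>s i. poly (C' i) s = peval (pdiff g i) (\<chi> i. poly (L i) s)"
    using mult.IH(2) by blast
  define P1 where "P1 = (\<Sum>i\<in>UNIV. upoly U (C i) * q i)"
  define P2 where "P2 = (\<Sum>i\<in>UNIV. upoly U (C' i) * q i)"
  define Q1 where "Q1 = (\<Sum>i\<in>UNIV. \<Sum>j\<in>UNIV. B i j * q i * q j)"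
  define Q2 where "Q2 = (\<Sum>i\<in>UNIV. \<Sum>j\<in>UNIV. B' i j * q i * q j)"
  define D where "D i j = upoly U F * B' i j + upoly U F' * B i j + upoly U (C i) * upoly U (C' j)
      + (P2 + Q2) * B i j + P1 * B' i j" for i j
  have "(\<Sum>i\<in>UNIV. upoly U (F * C' i + F' * C i) * q i) = upoly U F * P2 + upoly U F' * P1"
    unfolding P1_def P2_def
    by (simp add: ringhomD(2,3)[OF ringhom_upoly] distrib_right sum.distrib sum_distrib_left mult.assoc)
  moreover have "(\<Sum>i\<in>UNIV. \<Sum>j\<in>UNIV. D i j * q i * q j) = upoly U F * Q2 + upoly U F' * Q1 + P1 * P2 + (P2 + Q2) * Q1 + P1 * Q2"
  proof -
    have "P1 * P2 = (\<Sum>i\<in>UNIV. \<Sum>j\<in>UNIV. upoly U (C i) * upoly U (C' j) * q i * q j)"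
      unfolding P1_def P2_def sum_product by (intro sum.cong refl) (simp add: mult_ac)
    moreover have "z * Q1 = (\<Sum>i\<in>UNIV. \<Sum>j\<in>UNIV. z * B i j * q i * q j)"
      "z * Q2 = (\<Sum>i\<in>UNIV. \<Sum>j\<in>UNIV. z * B' i j * q i * q j)" for z
      unfolding Q1_def Q2_def sum_distrib_left by (simp_all add: mult.assoc)
    ultimately show ?thesis unfolding D_def by (simp only: distrib_right sum.distrib)
  qed
  moreover have "f * g = (upoly U F + P1 + Q1) * (upoly U F' + P2 + Q2)"
    unfolding P1_def P2_def Q1_def Q2_def using f(1) g(1) by simp
  ultimately have "f * g = upoly U (F * F') + (\<Sum>i\<in>UNIV. upoly U (F * C' i + F' * C i) * q i)
      + (\<Sum>i\<in>UNIV. \<Sum>j\<in>UNIV. D i j * q i * q j)"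
    by (simp add: ringhomD(3)[OF ringhom_upoly] algebra_simps)
  moreover have "poly (F * F') s = peval (f * g) (\<chi> i. poly (L i) s)"
    "poly (F * C' i + F' * C i) s = peval (pdiff (f * g) i) (\<chi> i. poly (L i) s)" for s i
    by (simp_all add: f(2,3) g(2,3) peval_pdiff_mult)
  ultimately show ?case
    by - (rule exI[of _ "F * F'"], rule exI[of _ "\<lambda>i. F * C' i + F' * C i"], rule exI[of _ D], blast)
qed

section \<open>Separating the zeros, interpolating through them, and penalization\<close>

text \<open>A generic \<open>c\<close> will do: the vectors to be avoided form a finite union of
  hyperplanes, which is negligible.\<close>

lemma separating_functional:
  fixes Z :: "(real ^ 'd::finite) set"
  assumes "finite Z"
  shows "\<exists>c. inj_on (\<lambda>x. c \<bullet> x) Z"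
proof -
  let ?N = "\<Union>z\<in>(\<lambda>(x, y). x - y) ` (Z \<times> Z) - {0}. {c. z \<bullet> c = 0}"
  have "negligible ?N"
    using assms by (intro negligible_Union) (auto intro!: negligible_hyperplane)
  then have "?N \<noteq> UNIV" using non_negligible_UNIV by metis
  then obtain c where c: "c \<notin> ?N" by blast
  have "x = y" if "x \<in> Z" "y \<in> Z" "c \<bullet> x = c \<bullet> y" for x y
  proof (rule ccontr)
    assume "x \<noteq> y"
    then have "x - y \<in> (\<lambda>(x, y). x - y) ` (Z \<times> Z) - {0}" using that by auto
    moreover have "(x - y) \<bullet> c = 0" using that by (simp add: inner_commute[of _ c] inner_diff_right)
    ultimately show False using c by blast
  qed
  then show ?thesis unfolding inj_on_def by blast
qed

lemma pderiv_setsum: "pderiv (\<Sum>i\<in>A. g i) = (\<Sum>i\<in>A. pderiv (g i))"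
  by (induction A rule: infinite_finite_induct) (simp_all add: pderiv_add)

lemma linear_factor_prod_dvd:
  fixes P :: "real poly"
  assumes "finite A" "\<And>a. a \<in> A \<Longrightarrow> poly P a = 0"
  shows "(\<Prod>a\<in>A. [:- a, 1:]) dvd P"
  using assms
proof (induction A)
  case (insert b A)
  then obtain G where G: "P = (\<Prod>a\<in>A. [:- a, 1:]) * G" by (auto elim: dvdE)
  have "poly (\<Prod>a\<in>A. [:- a, 1:]) b \<noteq> 0"
    using insert.hyps by (auto simp: poly_prod)
  then have "poly G b = 0" using insert.prems[of b] G by simp
  then obtain H where "G = [:- b, 1:] * H" by (auto simp: poly_eq_0_iff_dvd elim: dvdE)
  then have "P = (\<Prod>a\<in>insert b A. [:- a, 1:]) * H"
    unfolding prod.insert[OF insert.hyps] using G by (simp only: mult_ac)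
  then show ?case by simp
qed simp

lemma poly_interpolation:
  fixes g :: "real \<Rightarrow> real"
  assumes "finite A"
  shows "\<exists>P. \<forall>a\<in>A. poly P a = g a"
  using assms
proof (induction A)
  case (insert b A)
  then obtain P where P: "\<And>a. a \<in> A \<Longrightarrow> poly P a = g a" by blast
  define W where "W = (\<Prod>a\<in>A. [:- a, 1:])"
  have W: "poly W b \<noteq> 0" "\<And>a. a \<in> A \<Longrightarrow> poly W a = 0"
    using insert.hyps unfolding W_def by (auto simp: poly_prod)
  show ?case
    using P W by (intro exI[of _ "P + smult ((g b - poly P b) / poly W b) W"]) auto
qed simp

text \<open>On the compact set where \<open>F\<close> is not positive, \<open>P\<close> has a
  positive minimum. A multiple of it outweighs the minimum of \<open>F\<close>, and elsewhere a
  nonnegative multiple of \<open>P\<close> does no harm.\<close>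

lemma penalty:
  fixes F P :: "'z::metric_space \<Rightarrow> real"
  assumes "compact C" "continuous_on C F" "continuous_on C P"
    and P: "\<And>z. z \<in> C \<Longrightarrow> 0 \<le> P z" and F: "\<And>z. z \<in> C \<Longrightarrow> P z = 0 \<Longrightarrow> 0 < F z"
  shows "\<exists>l. \<forall>z\<in>C. 0 < F z + l * P z"
proof (cases "C = {}")
  case False
  define D where "D = {z \<in> C. F z \<le> 0}"
  have "compact D"
  proof -
    have "closedin (top_of_set C) (C \<inter> F -` {..0})"
      using assms(2) by (intro continuous_closedin_preimage) auto
    moreover have "D = C \<inter> F -` {..0}" unfolding D_def by auto
    ultimately show ?thesis using assms(1) closedin_compact by metis
  qed
  obtain z0 where z0: "z0 \<in> C" "\<And>z. z \<in> C \<Longrightarrow> F z0 \<le> F z"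
    using continuous_attains_inf[OF assms(1) False assms(2)] by blast
  show ?thesis
  proof (cases "D = {}")
    case True
    then have "\<forall>z\<in>C. 0 < F z + 0 * P z" unfolding D_def by auto
    then show ?thesis by blast
  next
    case ne: False
    have "continuous_on D P" using assms(3) by (rule continuous_on_subset) (auto simp: D_def)
    then obtain z1 where z1: "z1 \<in> D" "\<And>z. z \<in> D \<Longrightarrow> P z1 \<le> P z"
      using continuous_attains_inf[OF \<open>compact D\<close> ne] by blast
    have P1: "0 < P z1"
      using P[of z1] F[of z1] z1(1) unfolding D_def by force
    define l where "l = (\<bar>F z0\<bar> + 1) / P z1"
    have l: "0 \<le> l" "l * P z1 = \<bar>F z0\<bar> + 1" using P1 unfolding l_def by auto
    have "0 < F z + l * P z" if z: "z \<in> C" for z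
    proof (cases "z \<in> D")
      case True
      have "l * P z1 \<le> l * P z" using z1(2)[OF True] l(1) by (rule mult_left_mono)
      then show ?thesis using l(2) z0(2)[OF z] by linarith
    next
      case False
      then have "0 < F z" using z unfolding D_def by auto
      then show ?thesis using l(1) P[OF z] by (simp add: add_pos_nonneg)
    qed
    then show ?thesis by blast
  qed
qed simp

lemma sum_UNIV_option: "(\<Sum>a\<in>UNIV. g a) = g None + (\<Sum>i\<in>UNIV. g (Some (i :: 'd::finite)))"
  by (simp add: UNIV_option_conv sum.reindex)

lemma archimedean_compact:
  fixes M :: "'d::finite rpoly set"
  assumes "archimedean M"
  shows "compact {x. \<forall>a\<in>M. 0 \<le> peval a x}"
proof -
  have "\<exists>k. of_nat k - (Var i)\<^sup>2 \<in> M" for i using assms unfolding archimedean_def by blast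
  then obtain k where k: "\<And>i. of_nat (k i) - (Var i)\<^sup>2 \<in> M" by metis
  have "norm x \<le> sqrt (\<Sum>i\<in>UNIV. real (k i))" if "\<forall>a\<in>M. 0 \<le> peval a x" for x
  proof -
    have "(x $ i)\<^sup>2 \<le> real (k i)" for i using bspec[OF that k[of i]] by simp
    then show ?thesis unfolding norm_vec_def L2_set_def by (simp add: sum_mono)
  qed
  then have "bounded {x. \<forall>a\<in>M. 0 \<le> peval a x}" unfolding bounded_iff by blast
  moreover have "closed {x. \<forall>a\<in>M. 0 \<le> peval a x}"
  proof -
    have "closed {x. 0 \<le> peval a x}" for a by (intro closed_Collect_le continuous_intros)
    then have "closed (\<Inter>a\<in>M. {x. 0 \<le> peval a x})" by blast
    then show ?thesis by (simp add: Collect_ball_eq)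
  qed
  ultimately show ?thesis by (simp add: compact_eq_bounded_closed)
qed

theorem nonneg_nondegenerate_in_qm:
  fixes M :: "'d::finite rpoly set"
  assumes M: "quadratic_module M" and ar: "archimedean M"
    and K: "K = {x. \<forall>a\<in>M. 0 \<le> peval a x}"
    and pos: "\<And>x. x \<in> K \<Longrightarrow> 0 \<le> peval f x"
    and fin: "finite {p \<in> K. peval f p = 0}"
    and int: "{p \<in> K. peval f p = 0} \<subseteq> interior K"
    and hess: "\<And>p. p \<in> K \<Longrightarrow> peval f p = 0 \<Longrightarrow> pos_def (hessian (peval f) p)"
  shows "f \<in> M"
proof -
  have comp: "compact K" unfolding K by (rule archimedean_compact[OF ar])
  define Z where "Z = {p \<in> K. peval f p = 0}"
  have finZ: "finite Z" using fin unfolding Z_def .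
  obtain c where inj: "inj_on (\<lambda>x. c \<bullet> x) Z" using separating_functional[OF finZ] by blast
  define \<A> where "\<A> = (\<lambda>x. c \<bullet> x) ` Z"
  have finA: "finite \<A>" unfolding \<A>_def using finZ by simp
  have "\<exists>L. \<forall>p\<in>Z. poly L (c \<bullet> p) = p $ i" for i
  proof -
    obtain L where L: "\<forall>a\<in>\<A>. poly L a = the_inv_into Z (\<lambda>x. c \<bullet> x) a $ i"
      using poly_interpolation[OF finA, of "\<lambda>a. the_inv_into Z (\<lambda>x. c \<bullet> x) a $ i"] by blast
    then have "poly L (c \<bullet> p) = p $ i" if "p \<in> Z" for p
      using the_inv_into_f_f[OF inj that] that unfolding \<A>_def by simp
    then show ?thesis by blast
  qed
  then obtain L where L: "\<And>i p. p \<in> Z \<Longrightarrow> poly (L i) (c \<bullet> p) = p $ i" by metis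
  have Lp: "(\<chi> i. poly (L i) (c \<bullet> p)) = p" if "p \<in> Z" for p using L[OF that] by (simp add: vec_eq_iff)
  define U where "U = (\<Sum>i\<in>UNIV. Const (c $ i) * Var i)"
  have U: "peval U x = c \<bullet> x" for x unfolding U_def by (simp add: inner_vec_def)
  \<comment> \<open>All roots are simple, so \<open>Q\<close> detects the parameters of the zeros
    and its derivative does not vanish there.\<close>
  define Q where "Q = (\<Prod>a\<in>\<A>. [:- a, 1:])"
  have Q0: "poly Q a = 0 \<longleftrightarrow> a \<in> \<A>" for a
    unfolding Q_def using finA by (auto simp: poly_prod)
  have Q': "poly (pderiv Q) a \<noteq> 0" if a: "a \<in> \<A>" for a
  proof -
    have Qa: "Q = [:- a, 1:] * (\<Prod>b\<in>\<A> - {a}. [:- b, 1:])"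
      unfolding Q_def using finA a by (rule prod.remove)
    have "poly (pderiv Q) a = poly (\<Prod>b\<in>\<A> - {a}. [:- b, 1:]) a"
      unfolding Qa pderiv_mult by (simp add: pderiv_pCons)
    then show ?thesis using finA by (auto simp: poly_prod)
  qed
  \<comment> \<open>The components \<open>Some i\<close> say that the point lies on the curve, the
    component \<open>None\<close> that its parameter belongs to a zero; their common zeros are
    exactly \<open>Z\<close>.\<close>
  define q where "q a = (case a of None \<Rightarrow> upoly U Q | Some i \<Rightarrow> Var i - upoly U (L i))" for a
  have qN: "q None = upoly U Q" and qS: "q (Some i) = Var i - upoly U (L i)" for i
    by (simp_all add: q_def)
  obtain F C B where f: "f = upoly U F + (\<Sum>i\<in>UNIV. upoly U (C i) * q (Some i)) + (\<Sum>i\<in>UNIV. \<Sum>j\<in>UNIV. B i j * q (Some i) * q (Some j))"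
    and F: "\<And>s. poly F s = peval f (\<chi> i. poly (L i) s)"
    and C: "\<And>s i. poly (C i) s = peval (pdiff f i) (\<chi> i. poly (L i) s)"
    using taylor_decomposition[of f U L] unfolding qS by blast
  have Zint: "p \<in> interior K" if "p \<in> Z" for p using that int unfolding Z_def by blast
  have grad: "peval (pdiff f j) p = 0" if p: "p \<in> Z" for p j
  proof -
    have "\<forall>y\<in>interior K. peval f p \<le> peval f y"
      using p pos interior_subset unfolding Z_def by fastforce
    then have "(\<lambda>w. \<Sum>j\<in>UNIV. w $ j * peval (pdiff f j) p) = (\<lambda>v. 0)"
      by (intro differential_zero_maxmin[OF Zint[OF p] open_interior peval_has_derivative]) simp
    from fun_cong[OF this, of "axis j 1"] show ?thesis by (simp add: axis_def mult_delta_left)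
  qed
  \<comment> \<open>Near the parameter \<open>a\<close> the curve stays in the interior of
    \<open>K\<close>, so \<open>F\<close> has a local minimum with value \<open>0\<close> there.
    Hence \<open>F\<close> is divisible by \<open>Q\<close> twice, and each \<open>C i\<close> once
    because the gradient vanishes.\<close>
  have FA: "poly F a = 0" "poly (pderiv F) a = 0" and CA: "poly (C i) a = 0" if a: "a \<in> \<A>" for a i
  proof -
    obtain p where p: "p \<in> Z" "a = c \<bullet> p" using a unfolding \<A>_def by blast
    show Fa: "poly F a = 0" unfolding F p(2) Lp[OF p(1)] using p(1) unfolding Z_def by simp
    show "poly (C i) a = 0" unfolding C p(2) Lp[OF p(1)] by (rule grad[OF p(1)])
    have "continuous (at a) (\<lambda>s. \<chi> i. poly (L i) s)"
      unfolding continuous_at by (intro tendsto_vec_lambda) (simp add: isCont_def[symmetric])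
    moreover have "(\<chi> i. poly (L i) a) \<in> interior K" unfolding p(2) Lp[OF p(1)] by (rule Zint[OF p(1)])
    ultimately have "\<forall>\<^sub>F s in at a. (\<chi> i. poly (L i) s) \<in> interior K"
      unfolding continuous_at by (rule topological_tendstoD[OF _ open_interior])
    then obtain d where d: "d > 0" "\<And>s. s \<noteq> a \<Longrightarrow> dist s a < d \<Longrightarrow> (\<chi> i. poly (L i) s) \<in> interior K"
      unfolding eventually_at by blast
    show "poly (pderiv F) a = 0"
    proof (rule DERIV_local_min[OF poly_DERIV d(1)], intro allI impI)
      fix y assume "\<bar>a - y\<bar> < d"
      show "poly F a \<le> poly F y"
      proof (cases "y = a")
        case False
        have "dist y a < d" using \<open>\<bar>a - y\<bar> < d\<close> by (simp add: dist_real_def abs_minus_commute)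
        then have "(\<chi> i. poly (L i) y) \<in> K" using d(2)[OF False] interior_subset by blast
        then show ?thesis using pos Fa unfolding F by simp
      qed simp
    qed
  qed
  obtain G1 where G1: "F = Q * G1"
    using linear_factor_prod_dvd[OF finA, of F] FA(1) unfolding Q_def by (auto elim: dvdE)
  have "poly G1 a = 0" if a: "a \<in> \<A>" for a
  proof -
    have "poly (pderiv Q) a * poly G1 a = 0"
      using FA(2)[OF a] Q0[of a] a unfolding G1 pderiv_mult by (simp add: mult.commute)
    then show ?thesis using Q'[OF a] by simp
  qed
  then obtain G where "G1 = Q * G"
    using linear_factor_prod_dvd[OF finA, of G1] unfolding Q_def by (auto elim: dvdE)
  then have G: "F = Q * Q * G" using G1 by (simp add: mult.assoc)
  have "\<exists>H. C i = Q * H" for i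
    using linear_factor_prod_dvd[OF finA, of "C i"] CA unfolding Q_def by (auto elim: dvdE)
  then obtain H where H: "\<And>i. C i = Q * H i" by metis
  \<comment> \<open>Applied to the curve, the linear form \<open>c\<close> returns the parameter at
    every zero, hence modulo \<open>Q\<close>.\<close>
  have "\<exists>m. [:0, 1:] - (\<Sum>i\<in>UNIV. smult (c $ i) (L i)) = Q * m"
  proof -
    have "poly ([:0, 1:] - (\<Sum>i\<in>UNIV. smult (c $ i) (L i))) a = 0" if aA: "a \<in> \<A>" for a
    proof -
      obtain p where p: "p \<in> Z" "a = c \<bullet> p" using aA unfolding \<A>_def by blast
      have "poly (L i) a = p $ i" for i using L[OF p(1)] p(2) by simp
      then have "poly ([:0, 1:] - (\<Sum>i\<in>UNIV. smult (c $ i) (L i))) a = a - (\<Sum>i\<in>UNIV. c $ i * p $ i)"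
        by (simp add: poly_sum)
      then show ?thesis by (simp add: p(2) inner_vec_def)
    qed
    from linear_factor_prod_dvd[OF finA this] show ?thesis unfolding Q_def by (auto elim: dvdE)
  qed
  then obtain m where m: "[:0, 1:] - (\<Sum>i\<in>UNIV. smult (c $ i) (L i)) = Q * m" by blast
  note hu = ringhomD[OF ringhom_upoly[of U]]
  \<comment> \<open>The coefficients of the linear relation between the \<open>q a\<close> that is
    obtained from \<open>m\<close>.\<close>
  define s where "s a = (case a of None \<Rightarrow> - upoly U m | Some i \<Rightarrow> Const (c $ i))" for a
  have sN: "s None = - upoly U m" and sS: "s (Some i) = Const (c $ i)" for i
    by (simp_all add: s_def)
  have syz: "(\<Sum>a\<in>UNIV. s a * q a) = 0"
  proof -
    have "upoly U [:0, 1:] = U" by (simp add: upoly_pCons)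
    moreover have "upoly U (smult e P) = Const e * upoly U P" for e P
      using hu(3)[of "[:e:]" P] by (simp add: upoly_pCons)
    ultimately have "upoly U (Q * m) = U - (\<Sum>i\<in>UNIV. Const (c $ i) * upoly U (L i))"
      unfolding m[symmetric] hu(6) hu(9) by simp
    then have e: "upoly U Q * upoly U m = U - (\<Sum>i\<in>UNIV. Const (c $ i) * upoly U (L i))"
      unfolding hu(3) .
    have "(\<Sum>i\<in>UNIV. Const (c $ i) * (Var i - upoly U (L i))) = U - (\<Sum>i\<in>UNIV. Const (c $ i) * upoly U (L i))"
      unfolding U_def by (simp add: right_diff_distrib sum_subtractf)
    then show ?thesis
      unfolding sum_UNIV_option sN sS qN qS using e by (simp add: mult.commute)
  qed
  \<comment> \<open>Off the diagonal the coefficients are split into halves to make the matrix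
    symmetric.\<close>
  define A0 where "A0 a b = (case a of
      None \<Rightarrow> (case b of None \<Rightarrow> upoly U G | Some j \<Rightarrow> Const (1/2) * upoly U (H j))
    | Some i \<Rightarrow> (case b of None \<Rightarrow> Const (1/2) * upoly U (H i) | Some j \<Rightarrow> Const (1/2) * (B i j + B j i)))" for a b
  have A0sym: "A0 a b = A0 b a" for a b
    unfolding A0_def by (auto split: option.split simp: add.commute)
  have halves: "Const (1/2) * x + Const (1/2) * x = x" for x :: "'d rpoly"
    unfolding distrib_right[symmetric] Const_half by simp
  have f0: "(\<Sum>a\<in>UNIV. \<Sum>b\<in>UNIV. A0 a b * q a * q b) = f"
  proof -
    define QS where "QS = (\<Sum>i\<in>UNIV. Const (1/2) * upoly U (H i) * upoly U Q * q (Some i))"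
    have QS2: "QS + QS = (\<Sum>i\<in>UNIV. upoly U (C i) * q (Some i))"
      unfolding QS_def sum.distrib[symmetric] H hu(3) mult.assoc halves by (simp add: mult_ac)
    have "(\<Sum>a\<in>UNIV. \<Sum>b\<in>UNIV. A0 a b * q a * q b) = upoly U G * upoly U Q * upoly U Q + QS
        + (QS + (\<Sum>i\<in>UNIV. \<Sum>j\<in>UNIV. Const (1/2) * (B i j + B j i) * q (Some i) * q (Some j)))"
      unfolding sum_UNIV_option QS_def by (simp add: A0_def qN sum.distrib mult_ac)
    moreover have "(\<Sum>i\<in>UNIV. \<Sum>j\<in>UNIV. Const (1/2) * (B i j + B j i) * q (Some i) * q (Some j))
        = (\<Sum>i\<in>UNIV. \<Sum>j\<in>UNIV. B i j * q (Some i) * q (Some j))"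
    proof -
      define S where "S = (\<Sum>i\<in>UNIV. \<Sum>j\<in>UNIV. B i j * q (Some i) * q (Some j))"
      have S': "(\<Sum>i\<in>UNIV. \<Sum>j\<in>UNIV. B j i * q (Some i) * q (Some j)) = S"
        unfolding S_def by (subst sum.swap) (simp add: mult_ac)
      have "Const (1/2) * (B i j + B j i) * q (Some i) * q (Some j) = Const (1/2) * (B i j * q (Some i) * q (Some j))
          + Const (1/2) * (B j i * q (Some i) * q (Some j))" for i j
        by (simp add: algebra_simps)
      then have "(\<Sum>i\<in>UNIV. \<Sum>j\<in>UNIV. Const (1/2) * (B i j + B j i) * q (Some i) * q (Some j)) = Const (1/2) * S + Const (1/2) * S"
        by (simp only: sum.distrib sum_distrib_left[symmetric] S') (simp only: S_def)
      then show ?thesis unfolding S_def[symmetric] halves .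
    qed
    moreover have "upoly U G * upoly U Q * upoly U Q = upoly U F" unfolding G hu(3) by (simp add: mult_ac)
    ultimately have "(\<Sum>a\<in>UNIV. \<Sum>b\<in>UNIV. A0 a b * q a * q b) = upoly U F + (QS + QS)
        + (\<Sum>i\<in>UNIV. \<Sum>j\<in>UNIV. B i j * q (Some i) * q (Some j))"
      by (simp add: algebra_simps)
    then show ?thesis unfolding QS2 using f by simp
  qed
  define sv where "sv x = (\<chi> a. peval (s a) x)" for x
  define qv where "qv x = (\<chi> a. peval (q a) x)" for x
  define FF where "FF z = (\<Sum>a\<in>UNIV. \<Sum>b\<in>UNIV. peval (A0 a b) (fst z) * snd z $ a * snd z $ b)"
    for z :: "(real ^ 'd) \<times> (real ^ 'd option)"
  define PP where "PP z = (sv (fst z) \<bullet> snd z)\<^sup>2 + ((qv (fst z) \<bullet> qv (fst z)) * (snd z \<bullet> snd z) - (qv (fst z) \<bullet> snd z)\<^sup>2)"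
    for z :: "(real ^ 'd) \<times> (real ^ 'd option)"
  have fq: "peval f x = FF (x, qv x)" for x
    unfolding f0[symmetric] FF_def qv_def by simp
  \<comment> \<open>Along a line through a zero \<open>q\<close> vanishes to first order and
    \<open>f\<close> to second order. Dividing by \<open>h\<^sup>2\<close> identifies
    \<open>FF\<close> on the kernel of \<open>sv p\<close> with half the Hessian form.\<close>
  have second: "0 < FF (p, v)" if p: "p \<in> Z" and v: "v \<noteq> 0" and sv0: "sv p \<bullet> v = 0" for p v
  proof -
    define a where "a = c \<bullet> p"
    have aA: "a \<in> \<A>" unfolding a_def \<A>_def using p by blast
    \<comment> \<open>\<open>v\<close> is to be the derivative of \<open>q\<close> at
      \<open>p\<close> in a direction \<open>w\<close>. The component \<open>None\<close> forces the
      value \<open>t\<close> of \<open>c \<bullet> w\<close>, and the other components then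
      determine \<open>w\<close>. That this \<open>w\<close> does satisfy
      \<open>c \<bullet> w = t\<close> is what \<open>sv p \<bullet> v = 0\<close> ensures.\<close>
    define t where "t = v $ None / poly (pderiv Q) a"
    define w where "w = (\<chi> i. v $ Some i + poly (pderiv (L i)) a * t)"
    have vN: "v $ None = poly (pderiv Q) a * t" using Q'[OF aA] unfolding t_def by simp
    have sv1: "(\<Sum>i\<in>UNIV. c $ i * v $ Some i) = poly m a * v $ None"
      using sv0 unfolding sv_def inner_vec_def sum_UNIV_option by (simp add: sN sS U a_def)
    have dm: "1 - (\<Sum>i\<in>UNIV. c $ i * poly (pderiv (L i)) a) = poly (pderiv Q) a * poly m a"
      using arg_cong[OF m, of "\<lambda>P. poly (pderiv P) a"] Q0[of a] aA
      by (simp add: pderiv_diff pderiv_setsum pderiv_smult pderiv_pCons poly_sum pderiv_mult)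
    have cw: "c \<bullet> w = t"
    proof -
      have "c \<bullet> w = (\<Sum>i\<in>UNIV. c $ i * v $ Some i) + (\<Sum>i\<in>UNIV. c $ i * poly (pderiv (L i)) a) * t"
        unfolding w_def inner_vec_def by (simp add: distrib_left sum.distrib sum_distrib_right mult.assoc)
      also have "(\<Sum>i\<in>UNIV. c $ i * poly (pderiv (L i)) a) = 1 - poly (pderiv Q) a * poly m a" using dm by simp
      finally show ?thesis unfolding sv1 vN by (simp add: algebra_simps)
    qed
    have w0: "w \<noteq> 0"
    proof
      assume "w = 0"
      then have "t = 0" using cw by simp
      then have "v $ None = 0" "\<And>i. v $ Some i = 0"
        using vN \<open>w = 0\<close> unfolding w_def by (simp_all add: vec_eq_iff)
      then have "v $ b = 0" for b by (cases b) simp_all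
      then show False using v by (simp add: vec_eq_iff)
    qed
    have line: "peval U (p + h *\<^sub>R w) = a + h * t" for h
      unfolding U a_def by (simp add: inner_add_right cw)
    have dpoly: "((\<lambda>h. poly P (a + h * t)) has_real_derivative poly (pderiv P) a * t) (at 0)" for P
    proof -
      have "((\<lambda>h. a + h * t) has_real_derivative t) (at 0)" by (auto intro!: derivative_eq_intros)
      moreover have "(poly P has_real_derivative poly (pderiv P) a) (at (a + 0 * t))" by simp
      ultimately show ?thesis using DERIV_chain2[of "poly P" _ "\<lambda>h. a + h * t" 0] by blast
    qed
    have dq: "((\<lambda>h. peval (q b) (p + h *\<^sub>R w)) has_real_derivative v $ b) (at 0)" for b
    proof (cases b)
      case None
      then show ?thesis using dpoly[of Q] by (simp add: qN line vN)
    next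
      case (Some i)
      have "((\<lambda>h. (p $ i + h * w $ i) - poly (L i) (a + h * t)) has_real_derivative w $ i - poly (pderiv (L i)) a * t) (at 0)"
        by (intro DERIV_diff dpoly) (auto intro!: derivative_eq_intros)
      moreover have "w $ i - poly (pderiv (L i)) a * t = v $ Some i" by (simp add: w_def)
      ultimately show ?thesis unfolding Some by (simp add: qS line)
    qed
    have q0: "peval (q b) p = 0" for b
      using L[OF p] Q0[of a] aA by (cases b) (simp_all add: qN qS U a_def)
    have "((\<lambda>h. peval (q b) (p + h *\<^sub>R w) / h) \<longlongrightarrow> v $ b) (at 0)" for b
      using dq[of b] unfolding has_field_derivative_iff by (simp add: q0)
    moreover have "((\<lambda>h. peval (A0 b b') (p + h *\<^sub>R w)) \<longlongrightarrow> peval (A0 b b') p) (at 0)" for b b'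
      using DERIV_isCont[OF peval_line_derivative[of "A0 b b'" p w 0]] by (simp add: isCont_def)
    ultimately have lim1: "((\<lambda>h. \<Sum>b\<in>UNIV. \<Sum>b'\<in>UNIV. peval (A0 b b') (p + h *\<^sub>R w) * (peval (q b) (p + h *\<^sub>R w) / h) * (peval (q b') (p + h *\<^sub>R w) / h))
        \<longlongrightarrow> (\<Sum>b\<in>UNIV. \<Sum>b'\<in>UNIV. peval (A0 b b') p * v $ b * v $ b')) (at 0)"
      by (intro tendsto_sum tendsto_mult)
    have eq: "(\<Sum>b\<in>UNIV. \<Sum>b'\<in>UNIV. peval (A0 b b') (p + h *\<^sub>R w) * (peval (q b) (p + h *\<^sub>R w) / h) * (peval (q b') (p + h *\<^sub>R w) / h))
        = peval f (p + h *\<^sub>R w) / h\<^sup>2" for h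
      unfolding f0[symmetric] by (simp add: sum_divide_distrib power2_eq_square)
    have lim2: "((\<lambda>h. peval f (p + h *\<^sub>R w) / h\<^sup>2) \<longlongrightarrow> (w \<bullet> (hessian (peval f) p *v w)) / 2) (at 0)"
      using p grad[OF p] unfolding Z_def by (intro peval_second_order) auto
    have "FF (p, v) = (w \<bullet> (hessian (peval f) p *v w)) / 2"
      using tendsto_unique[OF _ lim1[unfolded eq] lim2] unfolding FF_def by simp
    moreover have "0 < w \<bullet> (hessian (peval f) p *v w)"
      using hess[of p] p w0 unfolding Z_def pos_def_def by blast
    ultimately show ?thesis by simp
  qed
  \<comment> \<open>On the unit sphere the penalty vanishes only where \<open>FF\<close> is positive
    anyway: on multiples of \<open>qv x\<close> off the zeros, and on the kernel of
    \<open>sv x\<close> at the zeros.\<close>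
  have "\<exists>l. \<forall>z\<in>K \<times> sphere 0 1. 0 < FF z + l * PP z"
  proof (rule penalty)
    show "compact (K \<times> sphere (0 :: real ^ 'd option) 1)" using comp by (intro compact_Times) auto
    show "continuous_on (K \<times> sphere 0 1) FF" unfolding FF_def by (intro continuous_intros)
    show "continuous_on (K \<times> sphere 0 1) PP"
      unfolding PP_def sv_def qv_def inner_vec_def by (simp, intro continuous_intros)
    fix z assume z: "z \<in> K \<times> sphere (0 :: real ^ 'd option) 1"
    obtain x v where xv: "z = (x, v)" by (cases z)
    have x: "x \<in> K" and v: "norm v = 1" using z unfolding xv by auto
    have CS: "(qv x \<bullet> v)\<^sup>2 \<le> (qv x \<bullet> qv x) * (v \<bullet> v)" by (rule Cauchy_Schwarz_ineq)
    then show "0 \<le> PP z" unfolding PP_def xv by simp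
    assume "PP z = 0"
    then have P0: "sv x \<bullet> v = 0" "(qv x \<bullet> v)\<^sup>2 = (qv x \<bullet> qv x) * (v \<bullet> v)"
      using CS unfolding PP_def xv by (auto simp: add_nonneg_eq_0_iff)
    have v0: "v \<noteq> 0" using v by auto
    show "0 < FF z"
    proof (cases "qv x = 0")
      case True
      then have q0: "peval (q b) x = 0" for b unfolding qv_def by (simp add: vec_eq_iff)
      have "c \<bullet> x \<in> \<A>" using q0[of None] Q0 by (simp add: qN U)
      then obtain p where p: "p \<in> Z" "c \<bullet> x = c \<bullet> p" unfolding \<A>_def by blast
      have "x $ i = p $ i" for i using q0[of "Some i"] L[OF p(1), of i] by (simp add: qS U p(2))
      then have "x = p" by (simp add: vec_eq_iff)
      then show ?thesis using second p(1) v0 P0(1) unfolding xv by simp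
    next
      case False
      \<comment> \<open>Equality in the Cauchy-Schwarz inequality makes \<open>v\<close> a multiple
        of \<open>qv x\<close>, and there \<open>FF\<close> is a positive multiple of
        \<open>peval f x\<close>.\<close>
      define k where "k = (qv x \<bullet> v) / (qv x \<bullet> qv x)"
      have qq: "0 < qv x \<bullet> qv x" using False by simp
      have "(v - k *\<^sub>R qv x) \<bullet> (v - k *\<^sub>R qv x) = v \<bullet> v - 2 * k * (qv x \<bullet> v) + k\<^sup>2 * (qv x \<bullet> qv x)"
        by (simp add: inner_diff_left inner_diff_right inner_commute[of v "qv x"] power2_eq_square) (simp add: algebra_simps)
      also have "\<dots> = v \<bullet> v - (qv x \<bullet> v)\<^sup>2 / (qv x \<bullet> qv x)"
        using qq unfolding k_def by (simp add: field_simps power2_eq_square)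
      also have "\<dots> = 0" unfolding P0(2) using qq by simp
      finally have vk: "v = k *\<^sub>R qv x" by simp
      then have k0: "k \<noteq> 0" using v0 by auto
      have "x \<notin> Z"
      proof
        assume xZ: "x \<in> Z"
        have "peval (q b) x = 0" for b
          using L[OF xZ] Q0[of "c \<bullet> x"] xZ unfolding \<A>_def by (cases b) (simp_all add: qN qS U)
        then show False using False unfolding qv_def by (simp add: vec_eq_iff)
      qed
      then have "0 < peval f x" using pos[OF x] x unfolding Z_def by force
      moreover have "FF z = k\<^sup>2 * FF (x, qv x)"
        unfolding xv FF_def by (subst vk, subst vk) (simp add: sum_distrib_left power2_eq_square mult_ac)
      ultimately show ?thesis using k0 by (simp add: fq)
    qed
  qed
  then obtain l where l0: "\<forall>z\<in>K \<times> sphere 0 1. 0 < FF z + l * PP z" by blast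
  have l: "0 < FF (x, v) + l * PP (x, v)" if "x \<in> K" "norm v = 1" for x v
    using bspec[OF l0, of "(x, v)"] that by simp
  define q2 where "q2 = (\<Sum>a\<in>UNIV. q a * q a)"
  \<comment> \<open>Both added matrices are annihilated by \<open>q\<close>, the first by
    \<open>syz\<close>, the second by cancellation, so the form still represents
    \<open>f\<close>.\<close>
  define A where "A a b = A0 a b + Const l * (s a * s b + ((if a = b then q2 else 0) - q a * q b))" for a b
  have "(\<Sum>a\<in>UNIV. \<Sum>b\<in>UNIV. A a b * q a * q b) \<in> M"
  proof (rule pd_form_in_qm[OF M ar K comp])
    show "A a b = A b a" for a b unfolding A_def using A0sym[of a b] by (simp add: mult.commute)
    fix x and v :: "real ^ 'd option" assume x: "x \<in> K" and v: "norm v = 1"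
    have "(\<Sum>a\<in>UNIV. \<Sum>b\<in>UNIV. peval (A a b) x * v $ a * v $ b)
      = FF (x, v) + l * ((\<Sum>a\<in>UNIV. \<Sum>b\<in>UNIV. peval (s a) x * peval (s b) x * v $ a * v $ b)
        + ((\<Sum>a\<in>UNIV. \<Sum>b\<in>UNIV. (if a = b then peval q2 x else 0) * v $ a * v $ b)
          - (\<Sum>a\<in>UNIV. \<Sum>b\<in>UNIV. peval (q a) x * peval (q b) x * v $ a * v $ b)))"
    proof -
      have "peval (A a b) x * v $ a * v $ b = peval (A0 a b) x * v $ a * v $ b
          + l * (peval (s a) x * peval (s b) x * v $ a * v $ b + ((if a = b then peval q2 x else 0) * v $ a * v $ b
            - peval (q a) x * peval (q b) x * v $ a * v $ b))" for a b
        unfolding A_def by (simp add: algebra_simps)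
      then show ?thesis
        unfolding FF_def by (simp only: sum.distrib sum_distrib_left[symmetric] sum_subtractf fst_conv snd_conv)
    qed
    also have "(\<Sum>a\<in>UNIV. \<Sum>b\<in>UNIV. peval (s a) x * peval (s b) x * v $ a * v $ b) = (sv x \<bullet> v)\<^sup>2"
      unfolding sv_def inner_vec_def power2_eq_square sum_product by (intro sum.cong refl) (simp add: mult_ac)
    also have "(\<Sum>a\<in>UNIV. \<Sum>b\<in>UNIV. peval (q a) x * peval (q b) x * v $ a * v $ b) = (qv x \<bullet> v)\<^sup>2"
      unfolding qv_def inner_vec_def power2_eq_square sum_product by (intro sum.cong refl) (simp add: mult_ac)
    also have "(\<Sum>a\<in>UNIV. \<Sum>b\<in>UNIV. (if a = b then peval q2 x else 0) * v $ a * v $ b) = (qv x \<bullet> qv x) * (v \<bullet> v)"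
      unfolding qv_def q2_def inner_vec_def by (simp add: mult_delta_left sum_distrib_left mult.assoc)
    finally show "0 < (\<Sum>a\<in>UNIV. \<Sum>b\<in>UNIV. peval (A a b) x * v $ a * v $ b)"
      using l[OF x v] unfolding PP_def by simp
  qed
  also have "(\<Sum>a\<in>UNIV. \<Sum>b\<in>UNIV. A a b * q a * q b) = f"
  proof -
    have "A a b * q a * q b = A0 a b * q a * q b + Const l * ((s a * q a) * (s b * q b)
        + ((if a = b then q2 else 0) * q a * q b - (q a * q a) * (q b * q b)))" for a b
      unfolding A_def by (simp add: algebra_simps)
    then have "(\<Sum>a\<in>UNIV. \<Sum>b\<in>UNIV. A a b * q a * q b) = f
        + Const l * ((\<Sum>a\<in>UNIV. \<Sum>b\<in>UNIV. (s a * q a) * (s b * q b))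
          + ((\<Sum>a\<in>UNIV. \<Sum>b\<in>UNIV. (if a = b then q2 else 0) * q a * q b)
            - (\<Sum>a\<in>UNIV. \<Sum>b\<in>UNIV. (q a * q a) * (q b * q b))))"
      by (simp only: sum.distrib sum_distrib_left[symmetric] sum_subtractf f0)
    moreover have "(\<Sum>a\<in>UNIV. \<Sum>b\<in>UNIV. (s a * q a) * (s b * q b)) = 0"
      unfolding sum_product[symmetric] syz by simp
    moreover have "(\<Sum>a\<in>UNIV. \<Sum>b\<in>UNIV. (q a * q a) * (q b * q b)) = q2 * q2"
      unfolding sum_product[symmetric] q2_def by simp
    moreover have "(\<Sum>a\<in>UNIV. \<Sum>b\<in>UNIV. (if a = b then q2 else 0) * q a * q b) = q2 * q2"
    proof -
      have "(\<Sum>a\<in>UNIV. \<Sum>b\<in>UNIV. (if a = b then q2 else 0) * q a * q b) = (\<Sum>a\<in>UNIV. q2 * (q a * q a))"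
        by (simp add: mult_delta_left mult.assoc)
      then show ?thesis unfolding sum_distrib_left[symmetric] q2_def[symmetric] .
    qed
    ultimately show ?thesis by simp
  qed
  finally show ?thesis .
qed

section \<open>Diagonal matrices\<close>

lemma nonneg_po_gen: "{x. \<forall>a\<in>po_gen G. 0 \<le> peval a x} = nonneg_set G"
proof (intro equalityI subsetI)
  have "G \<subseteq> po_gen G" unfolding po_gen_def by blast
  then show "x \<in> nonneg_set G" if "x \<in> {x. \<forall>a\<in>po_gen G. 0 \<le> peval a x}" for x
    using that unfolding nonneg_set_def by blast
  fix x assume x: "x \<in> nonneg_set G"
  have "ring_preordering {a. 0 \<le> peval a x}" unfolding ring_preordering_def by simp
  then have "po_gen G \<subseteq> {a. 0 \<le> peval a x}"
    using x unfolding po_gen_def nonneg_set_def by (intro Inter_lower) blast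
  then show "x \<in> {x. \<forall>a\<in>po_gen G. 0 \<le> peval a x}" by blast
qed

lemma nonneg_qm_gen: "{x. \<forall>a\<in>qm_gen G. 0 \<le> peval a x} = nonneg_set G"
proof (intro equalityI subsetI)
  have "G \<subseteq> qm_gen G" unfolding qm_gen_def by blast
  then show "x \<in> nonneg_set G" if "x \<in> {x. \<forall>a\<in>qm_gen G. 0 \<le> peval a x}" for x
    using that unfolding nonneg_set_def by blast
  fix x assume x: "x \<in> nonneg_set G"
  have "quadratic_module {a. 0 \<le> peval a x}" unfolding quadratic_module_def by simp
  then have "qm_gen G \<subseteq> {a. 0 \<le> peval a x}"
    using x unfolding qm_gen_def nonneg_set_def by (intro Inter_lower) blast
  then show "x \<in> {x. \<forall>a\<in>qm_gen G. 0 \<le> peval a x}" by blast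
qed

text \<open>Every entry of the list thus occurs on the diagonal, and its nonnegativity can be read
  off from the positive semidefinite matrix.\<close>

lemma rank_surj:
  assumes "k < CARD('n::{finite,linorder})"
  shows "\<exists>p :: 'n::{finite,linorder}. card {i. i < p} = k"
proof -
  let ?r = "\<lambda>p :: 'n. card {i. i < p}"
  have less: "?r p < ?r p'" if "p < p'" for p p'
    using that by (intro psubset_card_mono) auto
  have "inj ?r"
  proof (rule injI)
    fix p p' assume "?r p = ?r p'"
    then show "p = p'" using less[of p p'] less[of p' p] by (cases p p' rule: linorder_cases) auto
  qed
  moreover have "range ?r \<subseteq> {..<CARD('n)}"
    by (auto intro!: psubset_card_mono)
  ultimately have "range ?r = {..<CARD('n)}"
    by (intro card_subset_eq) (auto simp: card_image)
  then show ?thesis using assms by (metis (no_types, lifting) imageE lessThan_iff)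
qed

lemma diag_list_in_mat_power:
  fixes M :: "'a::comm_ring_1 set"
  assumes "set ds \<subseteq> M" "0 \<in> M"
  shows "(diag_list ds :: 'a ^ ('n::{finite,linorder}) ^ ('n::{finite,linorder})) \<in> mat_power M"
proof -
  obtain e :: "nat \<Rightarrow> 'n" where e: "bij_betw e {0..<CARD('n)} UNIV"
    using ex_bij_betw_nat_finite[of "UNIV :: 'n set"] by auto
  define d where "d p = (if card {k. k < p} < length ds then ds ! card {k. k < p} else 0)" for p :: 'n
  \<comment> \<open>Diagonal matrix units, each of which is its own product with its transpose;
    positions beyond the list receive the weight \<open>0\<close>.\<close>
  define A :: "nat \<Rightarrow> 'a ^ ('n::{finite,linorder}) ^ ('n::{finite,linorder})" where "A j = (\<chi> p p'. if p = e j \<and> p' = e j then 1 else 0)" for j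
  have AA: "transpose (A j) ** A j = A j" for j
  proof -
    have "(\<Sum>k\<in>UNIV. (if k = e j \<and> p = e j then 1 else 0) * (if k = e j \<and> p' = e j then 1 else 0)) =
        (\<Sum>k\<in>UNIV. if k = e j then (if p = e j \<and> p' = e j then 1 else 0) else (0 :: 'a))" for p p'
      by (intro sum.cong) auto
    then show ?thesis
      by (simp add: A_def matrix_matrix_mult_def transpose_def vec_eq_iff)
  qed
  have mA: "mat z ** A j = (\<chi> p p'. if p = e j \<and> p' = e j then z else 0)" for z j
  proof -
    have "(\<Sum>k\<in>UNIV. (if p = k then z else 0) * (if k = e j \<and> p' = e j then 1 else 0)) =
        (\<Sum>k\<in>UNIV. if p = k then (if p = e j \<and> p' = e j then z else 0) else (0 :: 'a))" for p p'
      by (intro sum.cong) auto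
    then show ?thesis
      by (simp add: A_def matrix_matrix_mult_def mat_def vec_eq_iff)
  qed
  have "diag_list ds = (\<Sum>j<CARD('n). mat (d (e j)) ** (transpose (A j) ** A j))"
  proof -
    have "(\<Sum>j<CARD('n). if p = e j \<and> p' = e j then d (e j) else 0) = (if p = p' then d p else 0)" for p p'
    proof -
      have "(\<Sum>j<CARD('n). if p = e j \<and> p' = e j then d (e j) else 0) =
          (\<Sum>k\<in>UNIV. if p = k \<and> p' = k then d k else 0)"
        using e by (intro sum.reindex_bij_betw) (simp add: lessThan_atLeast0)
      also have "\<dots> = (\<Sum>k\<in>UNIV. if p = k then (if p = p' then d p else 0) else 0)"
        by (intro sum.cong) auto
      finally show ?thesis by simp
    qed
    then show ?thesis
      unfolding AA mA by (simp add: diag_list_def vec_eq_iff d_def)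
  qed
  moreover have "d p \<in> M" for p
    unfolding d_def using assms by auto
  ultimately show ?thesis
    unfolding mat_power_def
    by - (rule CollectI, rule exI[of _ "CARD('n)"], rule exI[of _ "\<lambda>j. d (e j)"], rule exI[of _ A], blast)
qed

lemma psd_diagonal:
  fixes A :: "real ^ 'n ^ 'n"
  assumes "psd A" shows "0 \<le> A $ p $ p"
proof -
  have "0 \<le> axis p 1 \<bullet> (A *v axis p 1)" using assms unfolding psd_def by blast
  also have "\<dots> = A $ p $ p"
    by (simp add: inner_axis' matrix_vector_mult_basis column_def)
  finally show ?thesis .
qed

theorem proposition6p6:
  fixes \<G> :: "('d::finite rpoly ^ ('n::{finite,linorder}) ^ ('n::{finite,linorder})) set"
    and G :: "'d rpoly set"
    and ds :: "'d rpoly list"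
    and D :: "'d rpoly ^ ('n::{finite,linorder}) ^ ('n::{finite,linorder})"
  assumes "finite \<G>" and "\<forall>A\<in>\<G>. symmetric_matrix A"
    and "finite G"
    and "psd_set \<G> = nonneg_set G"
    and "mat_power (qm_gen G) \<subseteq> mat_qm_gen \<G>"
    and "mat_power (po_gen G) \<subseteq> mat_po_gen \<G>"
    and "length ds \<le> CARD('n)" and "D = diag_list ds"
    and "\<forall>x\<in>psd_set \<G>. psd (meval D x)"
    and "\<forall>f\<in>set ds. finite {p\<in>psd_set \<G>. peval f p = 0} \<and>
           {p\<in>psd_set \<G>. peval f p = 0} \<subseteq> interior (psd_set \<G>)"
    and "\<forall>f\<in>set ds. \<forall>p\<in>psd_set \<G>. peval f p = 0 \<longrightarrow> pos_def (hessian (peval f) p)"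
  shows "(compact (psd_set \<G>) \<longrightarrow>
            D \<in> mat_power (po_gen G) \<and> mat_power (po_gen G) \<subseteq> mat_po_gen \<G>) \<and>
         (archimedean (qm_gen G) \<longrightarrow>
            D \<in> mat_power (qm_gen G) \<and> mat_power (qm_gen G) \<subseteq> mat_qm_gen \<G>)"
proof -
  \<comment> \<open>Both versions are instances of this claim, for \<open>po_gen G\<close> and for
    \<open>qm_gen G\<close>; they differ only in the source of the Archimedean property.\<close>
  have member: "D \<in> mat_power M"
    if M: "quadratic_module M" "archimedean M" and K: "nonneg_set G = {x. \<forall>a\<in>M. 0 \<le> peval a x}" for M
  proof -
    have "f \<in> M" if f: "f \<in> set ds" for f
    proof (rule nonneg_nondegenerate_in_qm[OF M K])
      obtain k where k: "k < length ds" "f = ds ! k" using f by (metis in_set_conv_nth)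
      then obtain p :: 'n where p: "card {i. i < p} = k"
        using rank_surj[of k] assms(7) by (metis less_le_trans)
      show "0 \<le> peval f x" if x: "x \<in> nonneg_set G" for x
      proof -
        have "psd (meval D x)" using assms(4,9) x by blast
        from psd_diagonal[OF this, of p] show ?thesis
          using k p assms(8) by (simp add: map_matrix_def diag_list_def)
      qed
      show "finite {p \<in> nonneg_set G. peval f p = 0}"
        "{p \<in> nonneg_set G. peval f p = 0} \<subseteq> interior (nonneg_set G)"
        using assms(4,10) f by auto
      show "pos_def (hessian (peval f) p)" if "p \<in> nonneg_set G" "peval f p = 0" for p
        using assms(4,11) f that by blast
    qed
    then show ?thesis
      unfolding assms(8) using quadratic_moduleD(4)[OF M(1)] by (intro diag_list_in_mat_power) auto
  qed
  show ?thesis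
    using member[OF ring_preordering_quadratic_module[OF ring_preordering_po_gen]
        compact_po_gen_archimedean[OF assms(3)] nonneg_po_gen[symmetric]]
      member[OF quadratic_module_qm_gen _ nonneg_qm_gen[symmetric]] assms(4-6) by simp
qed

end
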